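(* Let $n$ be a positive integer and let $L$ be an even integral positive definite lattice of rank $m=2k$ and level $N$. Let $d$ be a positive divisor of $N$ with $(d,\frac Nd)=1$, and $c:=\frac Nd$. Choose integers $a,b$ such that $M=\begin{pmatrix}a&b\\c&d\end{pmatrix}\in\mathrm{SL}_2(\mathbb{Z})$ and let $\mathfrak{M}:=\begin{pmatrix}a\cdot1_n&b\cdot1_n\\c\cdot1_n&d\cdot1_n\end{pmatrix}\in\mathrm{Sp}_n(\mathbb{Z})$ be its $n$-fold diagonal embedding. Then, with a suitable constant $\kappa$, $$\theta_L^{(n)}|_k\mathfrak{M}=\kappa\cdot\theta_{L'}^{(n)},$$ where $L'$ is the lattice characterized by $$L'\otimes\mathbb{Z}_p=\begin{cases}L\otimes\mathbb{Z}_p&\text{if }p\nmid d,\\(L\otimes\mathbb{Z}_p)^*&\text{if }p\mid d,\end{cases}$$ for all primes $p$, and $*$ denotes the dual.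
   Context: $L$ is a lattice in a Euclidean space $(\mathbb{R}^m,\langle\ ,\ \rangle)$; even integral means $\langle x,x\rangle\in2\mathbb{Z}$ for all $x\in L$. With respect to a $\mathbb{Z}$-basis of $L$ the Gram matrix is $2S$ with $S$ half-integral, symmetric and positive definite; the level of $L$ is the least $N\ge1$ such that $N(2S)^{-1}$ is integral with even diagonal. $L'$ is a lattice in $L\otimes\mathbb{Q}$; the dual $(L\otimes\mathbb{Z}_p)^*$ is $\{x\in L\otimes\mathbb{Q}_p:\langle x,y\rangle\in\mathbb{Z}_p\ \forall y\in L\otimes\mathbb{Z}_p\}$. For a lattice $K$ (such as $L$ or $L'$), $\theta_K^{(n)}(Z)=\sum_{(x_1,\dots,x_n)\in K^n}e^{\pi i\,\mathrm{tr}\left((\langle x_i,x_j\rangle)_{i,j}Z\right)}$ for $Z$ in the Siegel upper half space $\mathbb{H}_n$; equivalently $\theta_K^{(n)}=\theta_S^{(n)}(Z)=\sum_{X\in\mathbb{Z}^{m,n}}e^{2\pi i\,\mathrm{tr}({}^tXSX\,Z)}$ if $2S$ is a Gram matrix of $K$. The slash operator is $(F|_kg)(Z)=\det(CZ+D)^{-k}F((AZ+B)(CZ+D)^{-1})$ for $g=\begin{pmatrix}A&B\\C&D\end{pmatrix}\in\mathrm{Sp}_n(\mathbb{Z})$. The constant $\kappa$ is a complex number. *)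

theory Defs
  imports
    "HOL-Analysis.Analysis"
    "HOL-Algebra.QuotRing"
    "HOL-Computational_Algebra.Primes"
begin

definition lattice_basis :: "real^'m^'m \<Rightarrow> (real^'m) set \<Rightarrow> bool" where
  "lattice_basis B L \<longleftrightarrow>
     inj (\<lambda>i. B $ i) \<and> independent (range (\<lambda>i. B $ i)) \<and>
     L = range (\<lambda>z :: int^'m. \<Sum>i\<in>UNIV. of_int (z $ i) *\<^sub>R B $ i)"

definition is_lattice :: "(real^'m) set \<Rightarrow> bool" where
  "is_lattice L \<longleftrightarrow> (\<exists>B. lattice_basis B L)"

definition even_integral :: "(real^'m) set \<Rightarrow> bool" where
  "even_integral L \<longleftrightarrow> (\<forall>x\<in>L. \<exists>z::int. x \<bullet> x = 2 * of_int z)"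

definition gram :: "real^'m^'m \<Rightarrow> real^'m^'m" where
  "gram B = (\<chi> i j. B $ i \<bullet> B $ j)"

text \<open>In the usual notation \<open>gram B\<close> is $2S$, with $S$ half-integral if the lattice is even.
  The level depends only on the lattice, not on the basis \<open>B\<close> in which it is computed.\<close>

definition lattice_level :: "real^'m^'m \<Rightarrow> nat" where
  "lattice_level B =
     (LEAST N. N \<ge> 1 \<and>
        (\<forall>i j. (real N *\<^sub>R matrix_inv (gram B)) $ i $ j \<in> \<int>) \<and>
        (\<forall>i. \<exists>z::int. (real N *\<^sub>R matrix_inv (gram B)) $ i $ i = 2 * of_int z))"

text \<open>The vector of \<open>L \<otimes> \<rat>\<close> whose coordinates in the basis \<open>B\<close> of \<open>L\<close> are \<open>q\<close>.\<close>

definition rat_vector :: "real^'m^'m \<Rightarrow> rat^'m \<Rightarrow> real^'m" where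
  "rat_vector B q = (\<Sum>i\<in>UNIV. of_rat (q $ i) *\<^sub>R B $ i)"

text \<open>The field of p-adic numbers is the completion of \<open>\<rat>\<close> for the p-adic absolute value, i.e.
  the ring of p-adic Cauchy sequences modulo the ideal of p-adic null sequences. A p-adic number is
  therefore a set of rational sequences. Since \<open>p\<close> is quantified inside formulas, the field
  is an algebraic structure with explicit carrier rather than a type.\<close>

definition padic_abs :: "nat \<Rightarrow> rat \<Rightarrow> real" where
  "padic_abs p r =
     (if r = 0 then 0
      else real p powi (int (multiplicity (int p) (snd (quotient_of r)))
                        - int (multiplicity (int p) (fst (quotient_of r)))))"

definition padic_cauchy :: "nat \<Rightarrow> (nat \<Rightarrow> rat) set" where
  "padic_cauchy p =
     {f. \<forall>e>0. \<exists>n0. \<forall>m\<ge>n0. \<forall>n\<ge>n0. padic_abs p (f m - f n) < e}"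

definition padic_null :: "nat \<Rightarrow> (nat \<Rightarrow> rat) set" where
  "padic_null p = {f. (\<lambda>n. padic_abs p (f n)) \<longlonglongrightarrow> 0}"

definition padic_cauchy_ring :: "nat \<Rightarrow> (nat \<Rightarrow> rat) ring" where
  "padic_cauchy_ring p =
     \<lparr>carrier = padic_cauchy p,
      mult = (\<lambda>f g n. f n * g n), one = (\<lambda>n. 1),
      zero = (\<lambda>n. 0), add = (\<lambda>f g n. f n + g n)\<rparr>"

type_synonym padic = "(nat \<Rightarrow> rat) set"

definition Qp :: "nat \<Rightarrow> padic ring" where
  "Qp p = padic_cauchy_ring p Quot padic_null p"

definition padic_of_rat :: "nat \<Rightarrow> rat \<Rightarrow> padic" where
  "padic_of_rat p r = padic_null p +>\<^bsub>padic_cauchy_ring p\<^esub> (\<lambda>n. r)"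

text \<open>A p-adic number has absolute value at most 1 iff it is the limit of rationals of absolute
  value at most 1, the p-adic absolute value being discrete.\<close>

definition Zp :: "nat \<Rightarrow> padic set" where
  "Zp p = {x \<in> carrier (Qp p). \<exists>f\<in>x. \<forall>n. padic_abs p (f n) \<le> 1}"

text \<open>Let \<open>B\<close> be a \<open>\<int>\<close>-basis of \<open>L\<close>. The vector space \<open>L \<otimes> \<rat>\<^sub>p\<close> is free on \<open>B\<close>, and it
  is represented by coordinate vectors over \<open>\<rat>\<^sub>p\<close> with respect to \<open>B\<close>. For a lattice \<open>K\<close> in
  \<open>L \<otimes> \<rat>\<close>, the module \<open>K \<otimes> \<int>\<^sub>p\<close> is the \<open>\<int>\<^sub>p\<close>-submodule of \<open>L \<otimes> \<rat>\<^sub>p\<close> generated by \<open>K\<close>.\<close>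

inductive_set tensor_Zp :: "real^'m^'m \<Rightarrow> nat \<Rightarrow> (real^'m) set \<Rightarrow> (padic^'m) set"
  for B :: "real^'m^'m" and p :: nat and K :: "(real^'m) set" where
  zero: "(\<chi> i. \<zero>\<^bsub>Qp p\<^esub>) \<in> tensor_Zp B p K"
| add: "x \<in> tensor_Zp B p K \<Longrightarrow> z \<in> Zp p \<Longrightarrow> rat_vector B q \<in> K \<Longrightarrow>
    (\<chi> i. x $ i \<oplus>\<^bsub>Qp p\<^esub> z \<otimes>\<^bsub>Qp p\<^esub> padic_of_rat p (q $ i)) \<in> tensor_Zp B p K"

text \<open>The \<open>\<rat>\<^sub>p\<close>-bilinear extension of the inner product to \<open>L \<otimes> \<rat>\<^sub>p\<close>. For an integral
  lattice the entries of the Gram matrix are integers, and the floor is only the conversion of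
  these real numbers to type \<open>int\<close>.\<close>

definition inner_Qp :: "real^'m^'m \<Rightarrow> nat \<Rightarrow> padic^'m \<Rightarrow> padic^'m \<Rightarrow> padic" where
  "inner_Qp B p x y =
     (\<Oplus>\<^bsub>Qp p\<^esub>i\<in>UNIV. \<Oplus>\<^bsub>Qp p\<^esub>j\<in>UNIV.
        x $ i \<otimes>\<^bsub>Qp p\<^esub> padic_of_rat p (of_int \<lfloor>gram B $ i $ j\<rfloor>) \<otimes>\<^bsub>Qp p\<^esub> y $ j)"

definition dual_Zp :: "real^'m^'m \<Rightarrow> nat \<Rightarrow> (padic^'m) set \<Rightarrow> (padic^'m) set" where
  "dual_Zp B p T =
     {x. (\<forall>i. x $ i \<in> carrier (Qp p)) \<and> (\<forall>y\<in>T. inner_Qp B p x y \<in> Zp p)}"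

definition partial_dual :: "real^'m^'m \<Rightarrow> (real^'m) set \<Rightarrow> nat \<Rightarrow> (real^'m) set \<Rightarrow> bool" where
  "partial_dual B L d L' \<longleftrightarrow>
     is_lattice L' \<and> L' \<subseteq> range (rat_vector B) \<and>
     (\<forall>p. prime p \<longrightarrow>
        tensor_Zp B p L' = (if p dvd d then dual_Zp B p (tensor_Zp B p L) else tensor_Zp B p L))"

definition siegel_upper_half_space :: "(complex^'n^'n) set" where
  "siegel_upper_half_space =
     {Z. transpose Z = Z \<and> (\<forall>v. v \<noteq> 0 \<longrightarrow> v \<bullet> (map_matrix Im Z *v v) > 0)}"

definition theta :: "(real^'m) set \<Rightarrow> complex^'n^'n \<Rightarrow> complex" where
  "theta K Z =
     (\<Sum>\<^sub>\<infinity>x\<in>{x :: (real^'m)^'n. \<forall>i. x $ i \<in> K}.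
        exp (of_real pi * \<i> * trace ((\<chi> i j. of_real (x $ i \<bullet> x $ j)) ** Z)))"

text \<open>Matrices of size $2n$ are indexed by the sum type \<open>'n + 'n\<close>.\<close>

definition block_matrix ::
  "'a^'n^'n \<Rightarrow> 'a^'n^'n \<Rightarrow> 'a^'n^'n \<Rightarrow> 'a^'n^'n \<Rightarrow> 'a^('n::finite + 'n)^('n + 'n)" where
  "block_matrix A B C D =
     (\<chi> i j. case i of
         Inl r \<Rightarrow> (case j of Inl s \<Rightarrow> A $ r $ s | Inr s \<Rightarrow> B $ r $ s)
       | Inr r \<Rightarrow> (case j of Inl s \<Rightarrow> C $ r $ s | Inr s \<Rightarrow> D $ r $ s))"

definition symplectic_int :: "(int^('n::finite + 'n)^('n + 'n)) set" where
  "symplectic_int =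
     {g. transpose g ** block_matrix 0 (mat 1) (- mat 1) 0 ** g
           = block_matrix 0 (mat 1) (- mat 1) 0}"

definition slash ::
  "nat \<Rightarrow> int^('n::finite + 'n)^('n + 'n) \<Rightarrow> (complex^'n^'n \<Rightarrow> complex) \<Rightarrow> complex^'n^'n \<Rightarrow> complex" where
  "slash k g F Z =
     (let A = (\<chi> r s. of_int (g $ Inl r $ Inl s)); B = (\<chi> r s. of_int (g $ Inl r $ Inr s));
          C = (\<chi> r s. of_int (g $ Inr r $ Inl s)); D = (\<chi> r s. of_int (g $ Inr r $ Inr s))
      in det (C ** Z + D) powi (- int k) * F ((A ** Z + B) ** matrix_inv (C ** Z + D)))"

definition diag_embed :: "int \<Rightarrow> int \<Rightarrow> int \<Rightarrow> int \<Rightarrow> int^('n::finite + 'n)^('n + 'n)" where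
  "diag_embed a b c d = block_matrix (mat a) (mat b) (mat c) (mat d)"

lemma block_matrix_mult:
  fixes A B C D A' B' C' D' :: "'a::semiring_1^'n^'n"
  shows "block_matrix A B C D ** block_matrix A' B' C' D' =
    block_matrix (A ** A' + B ** C') (A ** B' + B ** D') (C ** A' + D ** C') (C ** B' + D ** D')"
proof -
  have sum_sum: "(\<Sum>t\<in>UNIV. f t) = (\<Sum>r\<in>UNIV. f (Inl r)) + (\<Sum>r\<in>UNIV. f (Inr r))"
    for f :: "'n + 'n \<Rightarrow> 'a"
    using sum.Plus[of "UNIV :: 'n set" "UNIV :: 'n set" f]
    by (simp add: comp_def)
  show ?thesis
    unfolding vec_eq_iff matrix_matrix_mult_def block_matrix_def
    by (intro allI) (simp add: sum_sum split: sum.split)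
qed

lemma diag_embed_mult:
  "(diag_embed a b c d :: int^('n::finite + 'n)^('n + 'n)) ** diag_embed a' b' c' d' =
    diag_embed (a * a' + b * c') (a * b' + b * d') (c * a' + d * c') (c * b' + d * d')"
proof -
  have mm: "mat x ** mat y = (mat (x * y) :: int^'n^'n)" for x y
    by (auto simp: vec_eq_iff matrix_matrix_mult_def mat_def if_distrib[of "\<lambda>t. t * _"]
        sum.delta cong: if_cong)
  have ma: "mat x + mat y = (mat (x + y) :: int^'n^'n)" for x y
    by (auto simp: vec_eq_iff mat_def)
  show ?thesis
    unfolding diag_embed_def block_matrix_mult mm ma ..
qed

lemma diag_embed_symplectic:
  assumes "a * d - b * c = 1"
  shows "(diag_embed a b c d :: int^('n::finite + 'n)^('n + 'n)) \<in> symplectic_int"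
proof -
  have tr: "transpose (diag_embed a b c d :: int^('n + 'n)^('n + 'n)) = diag_embed a c b d"
    by (auto simp: vec_eq_iff diag_embed_def block_matrix_def transpose_def mat_def
        split: sum.splits)
  have J: "(block_matrix 0 (mat 1) (- mat 1) 0 :: int^('n + 'n)^('n + 'n)) =
      diag_embed 0 1 (-1) 0"
    by (auto simp: vec_eq_iff diag_embed_def block_matrix_def mat_def split: sum.splits)
  have "a * 0 + c * -1 = - c" "a * 1 + c * 0 = a" "b * 0 + d * -1 = - d" "b * 1 + d * 0 = b"
    "- c * a + a * c = 0" "- c * b + a * d = 1" "- d * a + b * c = -1" "- d * b + b * d = 0"
    using assms by (simp_all add: algebra_simps)
  then show ?thesis
    unfolding symplectic_int_def mem_Collect_eq tr J diag_embed_mult by (simp only:)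
qed

end

theory Submission
  imports
    Defs
    "HOL-Complex_Analysis.Conformal_Mappings"
    "HOL-Probability.Characteristic_Functions"
begin

text \<open>
  Put \<open>Z' = Z + d/c\<close>, so that \<open>\<MM>Z = a/c - (c\<^sup>2 Z')\<^sup>-\<^sup>1\<close>. Sorting the tuples of \<open>L\<^sup>n\<close> by their residue
  modulo \<open>c\<close> and applying Poisson summation to every residue class turns \<open>\<theta>\<^sub>L(\<MM>Z)\<close> into a
  constant times \<open>det (cZ + d)\<^sup>k\<close> times the sum over tuples \<open>y\<close> of the dual lattice of
  \<open>G(y) exp (\<pi> \<i> tr ((y\<^sub>i \<bullet> y\<^sub>j) Z))\<close>, where \<open>G(y) = \<Sum> exp (\<pi> \<i> (a (r \<bullet> r) + 2 (r \<bullet> y) + d (y \<bullet> y)) / c)\<close>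
  is a Gauss sum over \<open>r \<in> (L / cL)\<^sup>n\<close>. The lattice \<open>L'\<close> consists of the \<open>y\<close> in the dual lattice with
  \<open>d y \<in> L\<close>. If all \<open>y\<^sub>i\<close> lie in \<open>L'\<close>, the shift of \<open>r\<close> by \<open>d y\<close> shows \<open>G(y) = G(0)\<close>; otherwise a shift
  of \<open>r\<close> by \<open>c u\<close>, with \<open>u\<close> in the dual lattice and \<open>c u \<in> L\<close>, multiplies \<open>G(y)\<close> by a nontrivial root
  of unity, so \<open>G(y) = 0\<close>.

  Poisson summation is proved for real positive definite Gaussians, one variable at a time, and
  extends to complex ones by analytic continuation along a line of symmetric matrices; as the rank
  of \<open>L\<close> is even, only the integral power \<open>det\<^sup>k\<close> occurs and no branch has to be chosen.
\<close>

section \<open>Poisson summation for Gaussians in one variable\<close>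

text \<open>Poisson summation is applied to the matrix \<open>\<Omega> = - \<i> Z'\<close>, whose
  real part is \<open>Im Z\<close>. The factor \<open>det \<Omega> ^ k\<close> cancels the
  automorphy factor up to a power of \<open>- \<i> / c\<close>, so the constant comes out
  explicitly: that power, the inverse covolume of \<open>L\<^sup>n\<close> and the Gauss sum at 0.
  Two obstacles shape the rest. The statement describes L' by its completions, inside spaces over a
  field of classes of Cauchy sequences, whereas the summation needs a global set of vectors. The
  bridge is that every p-adic number is a p-adic integer plus a rational number, and that all local
  conditions are integrality conditions on finitely many linear forms with rational coefficients.
  Such forms also show that L' is unique. The second obstacle is parity. The shift of the Gauss sum
  by d y is harmless only if d (y, y) is even for y in L'. This follows from the even norms on L
  together with the even diagonal in the definition of the level, because c and d are not both
  even.\<close>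

lemma has_sum_int_symmetric_limit:
  fixes f :: "int \<Rightarrow> 'a :: {comm_monoid_add, topological_space}"
  assumes "(f has_sum S) UNIV"
  shows "(\<lambda>R. \<Sum>k\<in>{-int R..int R}. f k) \<longlonglongrightarrow> S"
proof -
  have "filterlim (\<lambda>R. {-int R..int R}) (finite_subsets_at_top UNIV) sequentially"
    unfolding filterlim_finite_subsets_at_top
  proof (intro allI impI)
    fix X :: "int set" assume X: "finite X \<and> X \<subseteq> UNIV"
    define R0 where "R0 = nat (Max (insert 0 (abs ` X)))"
    have "\<bar>x\<bar> \<le> int R0" if "x \<in> X" for x
      using X that by (simp add: R0_def)
    then have "X \<subseteq> {-int R..int R}" if "R \<ge> R0" for R
      using that by (force simp: abs_le_iff)
    then show "\<forall>\<^sub>F R in sequentially. finite {-int R..int R} \<and> X \<subseteq> {-int R..int R} \<and> {-int R..int R} \<subseteq> UNIV"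
      unfolding eventually_sequentially by auto
  qed
  with assms show ?thesis
    unfolding has_sum_def by (rule filterlim_compose)
qed

section \<open>Fourier series on the unit interval\<close>

lemma measurable_cnj[measurable (raw)]: "f \<in> borel_measurable M \<Longrightarrow> (\<lambda>x. cnj (f x)) \<in> borel_measurable M"
proof -
  have "cnj \<in> borel_measurable borel"
    by (intro borel_measurable_continuous_onI continuous_intros)
  then show "f \<in> borel_measurable M \<Longrightarrow> (\<lambda>x. cnj (f x)) \<in> borel_measurable M"
    by (rule measurable_compose[rotated])
qed

lemma measurable_cis[measurable (raw)]: "f \<in> borel_measurable M \<Longrightarrow> (\<lambda>x. cis (f x)) \<in> borel_measurable M"
proof -
  have "cis \<in> borel_measurable borel"
    by (intro borel_measurable_continuous_onI continuous_intros)
  then show "f \<in> borel_measurable M \<Longrightarrow> (\<lambda>x. cis (f x)) \<in> borel_measurable M"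
    by (rule measurable_compose[rotated])
qed

text \<open>\<open>P\<close> is the orthogonal projection of \<open>G\<close> to the span of the
  \<open>e k\<close>. Expanding the nonnegative integral of the squared modulus of
  \<open>G - P\<close> leaves the integral of the squared modulus of \<open>G\<close>, which is at
  most \<open>C\<^sup>2\<close>, minus the sum in question.\<close>

lemma (in prob_space) bessel_inequality:
  fixes e :: "'k \<Rightarrow> 'a \<Rightarrow> complex"
  assumes K: "finite K"
    and e[measurable]: "\<And>k. e k \<in> borel_measurable M"
    and e1: "\<And>k x. cmod (e k x) \<le> 1"
    and orth: "\<And>k l. k \<in> K \<Longrightarrow> l \<in> K \<Longrightarrow> (\<integral>x. e k x * cnj (e l x) \<partial>M) = of_bool (k = l)"
    and G[measurable]: "G \<in> borel_measurable M" and GC: "\<And>x. cmod (G x) \<le> C"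
  shows "(\<Sum>k\<in>K. (cmod (\<integral>x. G x * cnj (e k x) \<partial>M))\<^sup>2) \<le> C\<^sup>2"
proof -
  define c where "c k = (\<integral>x. G x * cnj (e k x) \<partial>M)" for k
  define P where "P x = (\<Sum>k\<in>K. c k * e k x)" for x
  have C0: "0 \<le> C" by (rule order_trans[OF norm_ge_zero GC])
  have int: "integrable M f" if [measurable]: "f \<in> borel_measurable M" and "\<And>x. cmod (f x) \<le> D" for f :: "'a \<Rightarrow> complex" and D
    by (rule integrable_const_bound[of _ D]) (use that in auto)
  have iGe: "integrable M (\<lambda>x. G x * cnj (e k x))" for k
    by (rule int[of _ "C * 1"]) (auto simp: norm_mult simp del: mult_1 mult_1_right intro!: mult_mono GC e1 C0)
  have iee: "integrable M (\<lambda>x. e k x * cnj (e l x))" for k l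
    by (rule int[of _ 1]) (auto simp: norm_mult intro!: mult_le_one e1)
  have iGG: "integrable M (\<lambda>x. G x * cnj (G x))"
    by (rule int[of _ "C * C"]) (auto simp: norm_mult simp del: mult_1 mult_1_right intro!: mult_mono GC C0)
  have ieG: "integrable M (\<lambda>x. e k x * cnj (G x))" for k
    using integrable_bounded_linear[OF bounded_linear_cnj iGe[of k]] by (simp add: mult.commute)
  have ceG: "(\<integral>x. e k x * cnj (G x) \<partial>M) = cnj (c k)" for k
    using Bochner_Integration.integral_cnj[of M "\<lambda>x. G x * cnj (e k x)"] by (simp add: c_def mult.commute)
  have exp1: "(G x - P x) * cnj (G x - P x) = G x * cnj (G x) - (\<Sum>k\<in>K. c k * (e k x * cnj (G x)))
       - (\<Sum>k\<in>K. cnj (c k) * (G x * cnj (e k x))) + (\<Sum>k\<in>K. \<Sum>l\<in>K. (c k * cnj (c l)) * (e k x * cnj (e l x)))" for x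
  proof -
    have 1: "P x * cnj (G x) = (\<Sum>k\<in>K. c k * (e k x * cnj (G x)))"
      unfolding P_def sum_distrib_right by (simp only: mult.assoc)
    have cP: "cnj (P x) = (\<Sum>k\<in>K. cnj (c k) * cnj (e k x))"
      unfolding P_def by simp
    have 2: "G x * cnj (P x) = (\<Sum>k\<in>K. cnj (c k) * (G x * cnj (e k x)))"
      unfolding cP sum_distrib_left by (simp only: mult.left_commute)
    have 3: "P x * cnj (P x) = (\<Sum>k\<in>K. \<Sum>l\<in>K. (c k * cnj (c l)) * (e k x * cnj (e l x)))"
      unfolding cP unfolding P_def sum_product by (intro sum.cong refl) (simp only: mult_ac)
    show ?thesis
      unfolding 1[symmetric] 2[symmetric] 3[symmetric] by (simp add: algebra_simps)
  qed
  have "(\<integral>x. (G x - P x) * cnj (G x - P x) \<partial>M) =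
      (\<integral>x. G x * cnj (G x) \<partial>M) - (\<Sum>k\<in>K. c k * cnj (c k))
       - (\<Sum>k\<in>K. cnj (c k) * c k) + (\<Sum>k\<in>K. \<Sum>l\<in>K. (c k * cnj (c l)) * (of_bool (k = l)))"
    unfolding exp1
    by (simp add: iGe iee iGG ieG ceG orth c_def[symmetric])
  also have "(\<Sum>k\<in>K. \<Sum>l\<in>K. (c k * cnj (c l)) * (of_bool (k = l))) = (\<Sum>k\<in>K. c k * cnj (c k))"
    using K by (intro sum.cong refl) (simp add: of_bool_def if_distrib cong: if_cong)
  finally have main: "(\<integral>x. (G x - P x) * cnj (G x - P x) \<partial>M) = (\<integral>x. G x * cnj (G x) \<partial>M) - (\<Sum>k\<in>K. c k * cnj (c k))"
    by (simp add: mult.commute)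
  have sq: "(\<integral>x. f x * cnj (f x) \<partial>M) = complex_of_real (\<integral>x. (cmod (f x))\<^sup>2 \<partial>M)" for f
    unfolding complex_norm_square[symmetric] by (rule integral_complex_of_real)
  have "c k * cnj (c k) = complex_of_real ((cmod (c k))\<^sup>2)" for k
    by (rule complex_norm_square[symmetric])
  then have "complex_of_real (\<integral>x. (cmod (G x - P x))\<^sup>2 \<partial>M) = complex_of_real ((\<integral>x. (cmod (G x))\<^sup>2 \<partial>M) - (\<Sum>k\<in>K. (cmod (c k))\<^sup>2))"
    using main unfolding sq by simp
  then have "(\<integral>x. (cmod (G x - P x))\<^sup>2 \<partial>M) = (\<integral>x. (cmod (G x))\<^sup>2 \<partial>M) - (\<Sum>k\<in>K. (cmod (c k))\<^sup>2)"
    by (simp only: of_real_eq_iff)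
  moreover have "(\<integral>x. (cmod (G x - P x))\<^sup>2 \<partial>M) \<ge> 0" by simp
  moreover have "(\<integral>x. (cmod (G x))\<^sup>2 \<partial>M) \<le> C\<^sup>2"
    by (rule integral_le_const) (auto intro!: power_mono GC AE_I2 integrable_const_bound[of _ "C\<^sup>2"])
  ultimately show ?thesis by (simp add: c_def)
qed

text \<open>The interval is half open so that its integer translates tile the line without overlap
  when integrals over the line are folded.\<close>

abbreviation circle_measure :: "real measure" where
  "circle_measure \<equiv> restrict_space lborel {0..<1}"

abbreviation fourier_coeff :: "real measure \<Rightarrow> (real \<Rightarrow> complex) \<Rightarrow> int \<Rightarrow> complex" where
  "fourier_coeff M f k \<equiv> (\<integral>x. f x * cis (- (2 * pi * of_int k * x)) \<partial>M)"

lemma prob_space_circle: "prob_space circle_measure"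
  by (rule prob_spaceI) (simp add: emeasure_restrict_space space_restrict_space)

lemma measurable_circle[measurable (raw)]: "f \<in> borel_measurable borel \<Longrightarrow> f \<in> borel_measurable circle_measure"
  by (rule measurable_restrict_space1) simp

lemma integral_circle_cis:
  "(\<integral>x. cis (2 * pi * of_int k * x) \<partial>circle_measure) = of_bool (k = 0)"
proof (cases "k = 0")
  case True
  interpret prob_space circle_measure by (rule prob_space_circle)
  show ?thesis using True prob_space by (simp add: space_restrict_space)
next
  case False
  let ?F = "\<lambda>x. cis (2 * pi * of_int k * x) / (2 * pi * of_int k * \<i>)"
  have "(\<integral>x. indicator {0..1} x *\<^sub>R cis (2 * pi * of_int k * x) \<partial>lborel) = ?F 1 - ?F 0"
  proof (rule integral_FTC_Icc)
    show "(?F has_vector_derivative cis (2 * pi * of_int k * x)) (at x within {0..1})" for x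
      unfolding cis_conv_exp using False
      by (auto intro!: derivative_eq_intros has_vector_derivative_real_field simp: field_simps)
    show "continuous_on {0..1} (\<lambda>x. cis (2 * pi * of_int k * x))"
      by (intro continuous_intros)
  qed simp
  also have "\<dots> = 0"
    using cis_multiple_2pi[of "of_int k"] by (simp add: mult.commute mult.left_commute mult.assoc)
  finally have "(\<integral>x. indicator {0..1} x *\<^sub>R cis (2 * pi * of_int k * x) \<partial>lborel) = 0" .
  \<comment> \<open>The fundamental theorem of calculus speaks about the closed interval; the extra
    endpoint is a null set.\<close>
  moreover have "(\<integral>x. indicator {0..1} x *\<^sub>R cis (2 * pi * of_int k * x) \<partial>lborel) = 
      (\<integral>x. indicator {0..<1} x *\<^sub>R cis (2 * pi * of_int k * x) \<partial>lborel)"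
  proof (rule integral_cong_AE)
    have "AE x in lborel. x \<noteq> (1::real)" by (rule AE_lborel_singleton)
    then show "AE x in lborel. indicator {0..1} x *\<^sub>R cis (2 * pi * of_int k * x) = indicator {0..<1} x *\<^sub>R cis (2 * pi * of_int k * x)"
      by eventually_elim (auto simp: indicator_def)
  qed (auto intro!: borel_measurable_scaleR borel_measurable_indicator measurable_cis)
  ultimately show ?thesis
    using False by (simp add: integral_restrict_space)
qed

text \<open>By Bessel's inequality the squared moduli are summable along any injective sequence of
  frequencies. The sequence \<open>h\<close> is arbitrary because both ends of the integers are
  needed later.\<close>

lemma riemann_lebesgue_circle:
  fixes G :: "real \<Rightarrow> complex" and h :: "nat \<Rightarrow> int"
  assumes G: "G \<in> borel_measurable circle_measure" and GC: "\<And>x. cmod (G x) \<le> C" and h: "inj h"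
  shows "(\<lambda>R. fourier_coeff circle_measure G (h R)) \<longlonglongrightarrow> 0"
proof -
  interpret prob_space circle_measure by (rule prob_space_circle)
  define c where "c k = fourier_coeff circle_measure G k" for k :: int
  have "(\<Sum>k\<in>K. (cmod (c k))\<^sup>2) \<le> C\<^sup>2" if "finite K" for K
    unfolding c_def cis_cnj
  proof (rule bessel_inequality[OF that _ _ _ G GC, where e = "\<lambda>k x. cis (2 * pi * of_int k * x)", unfolded cis_cnj])
    fix k l :: int
    have "(\<integral>x. cis (2 * pi * of_int k * x) * cis (- (2 * pi * of_int l * x)) \<partial>circle_measure)
        = (\<integral>x. cis (2 * pi * of_int (k - l) * x) \<partial>circle_measure)"
      by (intro Bochner_Integration.integral_cong refl) (simp add: cis_mult algebra_simps)
    then show "(\<integral>x. cis (2 * pi * of_int k * x) * cis (- (2 * pi * of_int l * x)) \<partial>circle_measure) = of_bool (k = l)"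
      by (simp only: integral_circle_cis) simp
  qed auto
  then have "(\<Sum>R\<in>K. (cmod (c (h R)))\<^sup>2) \<le> C\<^sup>2" if "finite K" for K
    using sum.reindex[OF inj_on_subset[OF h subset_UNIV, of K], of "\<lambda>k. (cmod (c k))\<^sup>2"] that
    unfolding comp_def by (metis finite_imageI)
  then have "summable (\<lambda>R. (cmod (c (h R)))\<^sup>2)"
    by (intro bounded_imp_summable[where B = "C\<^sup>2"]) auto
  then have "(\<lambda>R. (cmod (c (h R)))\<^sup>2) \<longlonglongrightarrow> 0" by (rule summable_LIMSEQ_zero)
  then have "(\<lambda>R. sqrt ((cmod (c (h R)))\<^sup>2)) \<longlonglongrightarrow> sqrt 0" by (rule tendsto_real_sqrt)
  then show ?thesis unfolding c_def[symmetric] by (simp add: tendsto_norm_zero_iff)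
qed

text \<open>Chernoff's argument: dividing by \<open>cis (2 * pi * x) - 1\<close> makes the partial sums telescope.\<close>

lemma fourier_sum_at_0:
  fixes F :: "real \<Rightarrow> complex"
  assumes F[measurable]: "F \<in> borel_measurable circle_measure"
    and C: "\<And>x. x \<in> {0..<1} \<Longrightarrow> cmod (F x - F 0) \<le> C * cmod (cis (2 * pi * x) - 1)"
  shows "(\<lambda>R. \<Sum>k\<in>{-int R..int R}. fourier_coeff circle_measure F k) \<longlonglongrightarrow> F 0"
proof -
  interpret prob_space circle_measure by (rule prob_space_circle)
  define C' where "C' = max C 0"
  \<comment> \<open>Where the denominator vanishes the hypothesis forces \<open>F x = F 0\<close>,
    so the default value 0 keeps \<open>FG\<close> valid at every point.\<close>
  define G where "G x = (if x \<in> {0..<1} \<and> cis (2 * pi * x) \<noteq> 1 then (F x - F 0) / (cis (2 * pi * x) - 1) else 0)" for x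
  have G[measurable]: "G \<in> borel_measurable circle_measure"
    unfolding G_def by measurable
  have GC: "cmod (G x) \<le> C'" for x
    using C[of x] unfolding G_def C'_def by (auto simp: norm_divide divide_simps intro: order_trans[OF _ mult_right_mono[of C "max C 0"]])
  have FG: "F x = F 0 + G x * (cis (2 * pi * x) - 1)" if "x \<in> {0..<1}" for x
    using C[OF that] that by (auto simp: G_def)
  define g where "g k = fourier_coeff circle_measure G k" for k :: int
  have iG: "integrable circle_measure (\<lambda>x. G x * cis (- (2 * pi * of_int k * x)))" for k :: int
    by (rule integrable_const_bound[of _ C']) (auto simp: norm_mult intro: GC)
  have Fk: "fourier_coeff circle_measure F k = F 0 * of_bool (k = 0) + (g (k - 1) - g k)" for k :: int
  proof -
    have "fourier_coeff circle_measure F k =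
      (\<integral>x. F 0 * cis (2 * pi * of_int (-k) * x) + (G x * cis (- (2 * pi * of_int (k-1) * x)) - G x * cis (- (2 * pi * of_int k * x))) \<partial>circle_measure)"
    proof (intro Bochner_Integration.integral_cong refl)
      fix x assume "x \<in> space circle_measure"
      then have x: "x \<in> {0..<1}" by (simp add: space_restrict_space)
      have "cis (2 * pi * x) * cis (- (2 * pi * of_int k * x)) = cis (- (2 * pi * of_int (k-1) * x))"
        by (simp add: cis_mult algebra_simps)
      then show "F x * cis (- (2 * pi * of_int k * x)) = F 0 * cis (2 * pi * of_int (-k) * x) + (G x * cis (- (2 * pi * of_int (k-1) * x)) - G x * cis (- (2 * pi * of_int k * x)))"
        by (subst FG[OF x]) (simp add: algebra_simps)
    qed
    also have "\<dots> = F 0 * (\<integral>x. cis (2 * pi * of_int (-k) * x) \<partial>circle_measure) + (g (k - 1) - g k)"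
    proof -
      have "integrable circle_measure (\<lambda>x. cis (2 * pi * of_int (-k) * x))"
        by (rule integrable_const_bound[of _ 1]) auto
      then show ?thesis unfolding g_def using iG by (simp del: of_int_minus of_int_diff)
    qed
    finally show ?thesis by (simp only: integral_circle_cis) simp
  qed
  have tel: "(\<Sum>k\<in>{-int R..int R}. g (k - 1) - g k) = g (- int R - 1) - g (int R)" for R
  proof (induction R)
    case (Suc R)
    have "{-int (Suc R)..int (Suc R)} = insert (-int (Suc R)) (insert (int (Suc R)) {-int R..int R})"
      by auto
    then have "(\<Sum>k\<in>{-int (Suc R)..int (Suc R)}. g (k - 1) - g k) = (g (-int (Suc R) - 1) - g (-int (Suc R)))
      + ((g (int (Suc R) - 1) - g (int (Suc R))) + (\<Sum>k\<in>{-int R..int R}. g (k - 1) - g k))"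
      by (simp only:) (subst sum.insert, simp, simp, subst sum.insert, simp_all)
    moreover have "-int (Suc R) = - int R - 1" "int (Suc R) - 1 = int R" by simp_all
    ultimately show ?case using Suc by (simp only:) (simp add: algebra_simps)
  qed simp
  have "(\<Sum>k\<in>{-int R..int R}. fourier_coeff circle_measure F k) = F 0 + (g (- int R - 1) - g (int R))" for R
    unfolding Fk sum.distrib tel by (simp flip: sum_distrib_left)
  \<comment> \<open>Only two end coefficients survive the telescoping; their frequencies
    \<open>- R - 1\<close> and \<open>R\<close> are injective in \<open>R\<close>.\<close>
  moreover have "(\<lambda>R. F 0 + (g (- int R - 1) - g (int R))) \<longlonglongrightarrow> F 0 + (0 - 0)"
    unfolding g_def by (intro tendsto_intros riemann_lebesgue_circle[OF G GC]) (auto simp: inj_def)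
  ultimately show ?thesis by simp
qed


text \<open>The right side equals \<open>2 * \<bar>sin (pi * x)\<bar>\<close>, the left side is the
  distance to the nearest integer. This turns a Lipschitz bound for a periodic function into the
  hypothesis of \<open>fourier_sum_at_0\<close>.\<close>

lemma cis_minus_1_lower_bound:
  assumes "x \<in> {0..1}"
  shows "min x (1 - x) \<le> cmod (cis (2 * pi * x) - 1)"
proof -
  have sin_ge: "y \<le> 2 * sin (pi * y)" if "0 \<le> y" "y \<le> 1/2" for y :: real
  proof -
    define t where "t = pi * y"
    have "pi * y \<le> pi * (1/2)"
      using that by (intro mult_left_mono) auto
    then have t: "0 \<le> t" "t \<le> 2"
      using that pi_less_4 unfolding t_def by (simp, linarith)
    \<comment> \<open>For \<open>t \<le> 2\<close> the cubic error term is at most two thirds of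
      \<open>t\<close>, which leaves \<open>sin t \<ge> t / 3\<close>; together with
      \<open>pi > 3\<close> this is more than enough.\<close>
    have "\<bar>sin t - (\<Sum>m<3. sin_coeff m * t ^ m)\<bar> \<le> inverse (fact 3) * \<bar>t\<bar> ^ 3"
      by (rule Maclaurin_sin_bound)
    then have "t - sin t \<le> t ^ 3 / 6"
      by (simp add: eval_nat_numeral sin_coeff_def abs_le_iff) (use t in \<open>simp add: algebra_simps abs_if split: if_splits\<close>)
    also have "t ^ 3 \<le> t * 4"
      using t mult_left_mono[OF power_mono[of t 2 2], of t] by (simp add: power2_eq_square power3_eq_cube)
    finally have "2 * sin t \<ge> 2 * t / 3" by simp
    moreover have "3 * y \<le> pi * y"
      using that pi_gt3 by (intro mult_right_mono) auto
    ultimately show ?thesis unfolding t_def using that by linarith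
  qed
  have eq: "cmod (cis (2 * pi * x) - 1) = 2 * \<bar>sin (pi * x)\<bar>"
    using dist_exp_i_1[of "2 * pi * x"] by (simp add: cis_conv_exp)
  show ?thesis
  proof (cases "x \<le> 1/2")
    case True
    then show ?thesis using sin_ge[of x] assms by (simp add: eq)
  next
    case False
    have "sin (pi * x) = sin (pi * (1 - x))"
      by (simp add: right_diff_distrib)
    then show ?thesis using False sin_ge[of "1 - x"] assms by (simp add: eq)
  qed
qed

text \<open>The Fourier series of the periodization \<open>F\<close>, evaluated at 0. The summable
  bounds \<open>K\<close> control \<open>f\<close> and its Lipschitz constant on each unit cell,
  which makes \<open>F\<close> Lipschitz. The conclusion only claims convergence of symmetric
  partial sums, so no decay of the Fourier transform has to be assumed.\<close>

lemma poisson_summation: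
  fixes f :: "real \<Rightarrow> complex" and K :: "int \<Rightarrow> real"
  assumes cont: "continuous_on UNIV f" and int: "integrable lborel f"
    and K: "K summable_on UNIV"
    and fK: "\<And>n x. x \<in> {0..1} \<Longrightarrow> cmod (f (of_int n + x)) \<le> K n"
    and lip: "\<And>n x y. x \<in> {0..1} \<Longrightarrow> y \<in> {0..1} \<Longrightarrow> cmod (f (of_int n + x) - f (of_int n + y)) \<le> K n * \<bar>x - y\<bar>"
  shows "(\<lambda>R. \<Sum>k\<in>{-int R..int R}. fourier_coeff lborel f k) \<longlonglongrightarrow> (\<Sum>\<^sub>\<infinity>n. f (of_int n))"
proof -
  interpret prob_space circle_measure by (rule prob_space_circle)
  have fm[measurable]: "f \<in> borel_measurable borel"
    using cont by (rule borel_measurable_continuous_onI)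
  have K0: "K n \<ge> 0" for n by (rule order_trans[OF norm_ge_zero fK[of 0 n]]) simp
  define F where "F x = (\<Sum>\<^sub>\<infinity>n. f (of_int n + x))" for x
  define C where "C = (\<Sum>\<^sub>\<infinity>n. K n)"
  have abs: "(\<lambda>n. cmod (f (of_int n + x))) summable_on UNIV" if "x \<in> {0..1}" for x
    by (rule Infinite_Sum.abs_summable_on_comparison_test'[OF K]) (use fK that in auto)
  have sm: "(\<lambda>n. f (of_int n + x)) summable_on UNIV" if "x \<in> {0..1}" for x
    using abs[OF that] by (rule abs_summable_summable)
  have F1: "F 1 = F 0"
  proof -
    have "bij_betw (\<lambda>n::int. n + 1) UNIV UNIV"
      by (rule bij_betw_byWitness[of _ "\<lambda>n. n - 1"]) auto
    from infsum_reindex_bij_betw[OF this, of "\<lambda>n. f (of_int n)"]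
    show ?thesis unfolding F_def by simp
  qed
  have FL: "cmod (F x - F y) \<le> C * \<bar>x - y\<bar>" if x: "x \<in> {0..1}" and y: "y \<in> {0..1}" for x y
  proof -
    have "((\<lambda>n. f (of_int n + x) + - f (of_int n + y)) has_sum (F x + - F y)) UNIV"
      unfolding F_def by (intro has_sum_add has_sum_uminusI has_sum_infsum sm x y)
    then have "((\<lambda>n. f (of_int n + x) - f (of_int n + y)) has_sum (F x - F y)) UNIV"
      by simp
    then have "cmod (F x - F y) \<le> (\<Sum>\<^sub>\<infinity>n. K n * \<bar>x - y\<bar>)"
    proof (rule norm_infsum_le)
      show "((\<lambda>n. K n * \<bar>x - y\<bar>) has_sum (\<Sum>\<^sub>\<infinity>n. K n * \<bar>x - y\<bar>)) UNIV"
        by (intro has_sum_infsum summable_on_cmult_left K)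
    qed (use lip x y in auto)
    also have "(\<Sum>\<^sub>\<infinity>n. K n * \<bar>x - y\<bar>) = C * \<bar>x - y\<bar>"
      unfolding C_def by (rule infsum_cmult_left') 
    finally show ?thesis .
  qed
  have C0: "C \<ge> 0" unfolding C_def by (rule infsum_nonneg) (rule K0)
  define S where "S R x = (\<Sum>n\<in>{-int R..int R}. f (of_int n + x))" for R x
  have SF: "(\<lambda>R. S R x) \<longlonglongrightarrow> F x" if "x \<in> {0..1}" for x
    unfolding S_def F_def by (rule has_sum_int_symmetric_limit) (intro has_sum_infsum sm that)
  have SC: "cmod (S R x) \<le> C" if "x \<in> {0..1}" for R x
  proof -
    have "cmod (S R x) \<le> (\<Sum>n\<in>{-int R..int R}. K n)"
      unfolding S_def by (rule order_trans[OF norm_sum]) (intro sum_mono fK that)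
    also have "\<dots> \<le> C"
      unfolding C_def by (rule finite_sum_le_infsum) (use K K0 in auto)
    finally show ?thesis .
  qed
  have Sm[measurable]: "S R \<in> borel_measurable borel" for R
    unfolding S_def by measurable
  have Fm[measurable]: "F \<in> borel_measurable circle_measure"
    by (rule borel_measurable_LIMSEQ_metric[of S]) (auto intro!: SF simp: space_restrict_space)
  have "(\<lambda>R. \<Sum>k\<in>{-int R..int R}. fourier_coeff circle_measure F k) \<longlonglongrightarrow> F 0"
  proof (rule fourier_sum_at_0[OF Fm, of C])
    fix x :: real assume x: "x \<in> {0..<1}"
    \<comment> \<open>By periodicity \<open>x\<close> may be compared with either end of the
      interval, hence with the nearer one.\<close>
    have "cmod (F x - F 0) \<le> C * min x (1 - x)"
      using FL[of x 0] FL[of x 1] x by (auto simp: F1 min_def)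
    also have "\<dots> \<le> C * cmod (cis (2 * pi * x) - 1)"
      by (intro mult_left_mono cis_minus_1_lower_bound C0) (use x in auto)
    finally show "cmod (F x - F 0) \<le> C * cmod (cis (2 * pi * x) - 1)" .
  qed
  moreover have "fourier_coeff circle_measure F k
      = fourier_coeff lborel f k" for k :: int
  \<comment> \<open>Both coefficients are limits of the same integrals of the truncated sums
    \<open>S R\<close>: over the circle dominated by \<open>C\<close>, and unfolded over the growing
    intervals from \<open>- R\<close> to \<open>R + 1\<close> dominated by
    \<open>\<bar>g\<bar>\<close>.\<close>
  proof (rule LIMSEQ_unique)
    define g where "g x = f x * cis (- (2 * pi * of_int k * x))" for x
    have gm[measurable]: "g \<in> borel_measurable borel" unfolding g_def by measurable
    have ig: "integrable lborel g"
      by (rule Bochner_Integration.integrable_bound[OF int]) (auto simp: g_def norm_mult)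
    show "(\<lambda>R. \<integral>x. S R x * cis (- (2 * pi * of_int k * x)) \<partial>circle_measure) \<longlonglongrightarrow> fourier_coeff circle_measure F k"
      by (rule integral_dominated_convergence[where w = "\<lambda>_. C"])
        (auto simp: norm_mult space_restrict_space intro!: AE_I2 tendsto_mult_right SF SC)
    have shift: "(\<integral>x. f (of_int n + x) * cis (- (2 * pi * of_int k * x)) \<partial>circle_measure) = (\<integral>x. indicator {of_int n..<of_int n + 1} x *\<^sub>R g x \<partial>lborel)" for n
    proof -
      have c: "cis (- (2 * pi * of_int k * (of_int n + x))) = cis (- (2 * pi * of_int k * x))" for x
      proof -
        have "cis (2 * pi * of_int (- k * n)) = 1" by (rule cis_multiple_2pi) auto
        then show ?thesis
          using cis_mult[of "2 * pi * of_int (- k * n)" "- (2 * pi * of_int k * x)"] by (simp add: algebra_simps)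
      qed
      have "(\<integral>x. indicator {of_int n..<of_int n + 1} x *\<^sub>R g x \<partial>lborel) = (\<integral>x. indicator {of_int n..<of_int n + 1} (of_int n + x) *\<^sub>R g (of_int n + x) \<partial>lborel)"
        using lborel_integral_real_affine[of 1 "\<lambda>x. indicator {of_int n..<of_int n + 1} x *\<^sub>R g x" "of_int n"] by simp
      also have "\<dots> = (\<integral>x. indicator {0..<1} x *\<^sub>R (f (of_int n + x) * cis (- (2 * pi * of_int k * x))) \<partial>lborel)"
        by (intro Bochner_Integration.integral_cong refl) (auto simp: g_def c indicator_def)
      finally show ?thesis by (simp add: integral_restrict_space)
    qed
    have "(\<integral>x. S R x * cis (- (2 * pi * of_int k * x)) \<partial>circle_measure) = (\<integral>x. indicator {-of_int R..<of_int R+1} x *\<^sub>R g x \<partial>lborel)" for R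
    proof -
      have i1: "integrable circle_measure (\<lambda>x. f (of_int n + x) * cis (- (2 * pi * of_int k * x)))" for n
        by (rule integrable_const_bound[of _ "K n"]) (auto simp: norm_mult space_restrict_space intro!: AE_I2 fK)
      have "(\<integral>x. S R x * cis (- (2 * pi * of_int k * x)) \<partial>circle_measure) = (\<Sum>n\<in>{-int R..int R}. \<integral>x. indicator {of_int n..<of_int n + 1} x *\<^sub>R g x \<partial>lborel)"
        unfolding S_def sum_distrib_right by (subst Bochner_Integration.integral_sum) (simp_all add: i1 shift)
      also have "\<dots> = (\<integral>x. (\<Sum>n\<in>{-int R..int R}. indicator {of_int n..<of_int n + 1} x *\<^sub>R g x) \<partial>lborel)"
        by (subst Bochner_Integration.integral_sum) (auto intro!: integrable_mult_indicator ig)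
      also have "\<dots> = (\<integral>x. indicator {-of_int R..<of_int R+1} x *\<^sub>R g x \<partial>lborel)"
      proof (intro Bochner_Integration.integral_cong refl)
        fix x :: real
        have "(\<Sum>n\<in>{-int R..int R}. indicator {of_int n..<of_int n + 1} x) = (\<Sum>n\<in>{-int R..int R}. if n = \<lfloor>x\<rfloor> then 1 else 0::real)"
          by (intro sum.cong refl) (auto simp: indicator_def floor_eq_iff eq_commute[of _ "\<lfloor>x\<rfloor>"])
        also have "\<dots> = indicator {-of_int R..<of_int R+1} x"
          by (auto simp: indicator_def le_floor_iff floor_le_iff)
        finally show "(\<Sum>n\<in>{-int R..int R}. indicator {of_int n..<of_int n + 1} x *\<^sub>R g x) = indicator {-of_int R..<of_int R+1} x *\<^sub>R g x"
          by (simp only: scaleR_left.sum[symmetric])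
      qed
      finally show ?thesis .
    qed
    moreover have "(\<lambda>R. \<integral>x. indicator {-of_int (int R)..<of_int (int R)+1} x *\<^sub>R g x \<partial>lborel) \<longlonglongrightarrow> (\<integral>x. g x \<partial>lborel)"
    proof (rule integral_dominated_convergence[where w = "\<lambda>x. cmod (g x)"])
      show "AE x in lborel. (\<lambda>R. indicator {-of_int (int R)..<of_int (int R)+1} x *\<^sub>R g x) \<longlonglongrightarrow> g x"
      proof (intro AE_I2 tendsto_eventually)
        fix x :: real
        have "indicator {-of_int (int R)..<of_int (int R)+1} x *\<^sub>R g x = g x" if "R \<ge> nat \<lceil>\<bar>x\<bar>\<rceil>" for R
        proof -
          have "\<bar>x\<bar> \<le> real R" using that by linarith
          then show ?thesis by (auto simp: indicator_def)
        qed
        then show "\<forall>\<^sub>F R in sequentially. indicator {-of_int (int R)..<of_int (int R)+1} x *\<^sub>R g x = g x"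
          unfolding eventually_sequentially by blast
      qed
      show "AE x in lborel. cmod (indicator {-of_int (int R)..<of_int (int R)+1} x *\<^sub>R g x) \<le> cmod (g x)" for R
        by (auto simp: indicator_def)
    qed (use ig in auto)
    ultimately show "(\<lambda>R. \<integral>x. S R x * cis (- (2 * pi * of_int k * x)) \<partial>circle_measure) \<longlonglongrightarrow> fourier_coeff lborel f k"
      by (simp add: g_def)
  qed
  ultimately show ?thesis by (simp add: F_def)
qed


text \<open>The difference of the two sides is half the square of \<open>x + 2 * y\<close>. Shifts
  in Gaussian exponents are absorbed in this way at the price of half the exponent.\<close>

lemma square_shift_ge: "(x + y)\<^sup>2 \<ge> x\<^sup>2 / 2 - (y::real)\<^sup>2"
  using zero_le_power2[of "x + 2 * y"] by (simp add: power2_eq_square algebra_simps)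

text \<open>After removal of the shift, \<open>n \<le> n\<^sup>2\<close> for natural
  \<open>n\<close> allows a comparison with a geometric series on each half of the integers.\<close>

lemma summable_on_gauss_int:
  fixes c w :: real
  assumes c: "c > 0"
  shows "(\<lambda>n::int. exp (- (c * (of_int n + w)\<^sup>2))) summable_on UNIV"
proof -
  define e where "e n = exp (c * w\<^sup>2) * exp (- (c/2) * real n)" for n
  have "summable (\<lambda>n. exp (c * w\<^sup>2) * exp (- (c/2)) ^ n)"
    by (intro summable_mult summable_geometric) (use c in simp)
  then have "summable e"
    unfolding e_def by (simp flip: exp_of_nat_mult add: mult.commute)
  then have e: "e summable_on UNIV"
    by (subst summable_on_UNIV_nonneg_real_iff) (auto simp: e_def)
  have bound: "exp (- (c * (of_int m + w)\<^sup>2)) \<le> e n" if "real n \<le> \<bar>of_int m\<bar>" for m :: int and n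
  proof -
    have "real n \<le> (real n)\<^sup>2"
      using of_nat_mono[OF le_square[of n], where 'a = real] by (simp add: power2_eq_square)
    also have "\<dots> \<le> \<bar>of_int m\<bar>\<^sup>2" by (intro power_mono that) simp
    finally have "real n / 2 - w\<^sup>2 \<le> (of_int m + w)\<^sup>2"
      using square_shift_ge[of "of_int m" w] by simp
    then have "c * (real n / 2 - w\<^sup>2) \<le> c * (of_int m + w)\<^sup>2"
      using c by (intro mult_left_mono) auto
    then show ?thesis unfolding e_def exp_add[symmetric] by (simp add: algebra_simps)
  qed
  have b1: "bij_betw int UNIV {0..}"
    by (rule bij_betw_byWitness[of _ nat]) auto
  have b2: "bij_betw (\<lambda>n. - int n - 1) UNIV {..<0}"
    by (rule bij_betw_byWitness[of _ "\<lambda>m. nat (- m - 1)"]) auto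
  have "(\<lambda>n::int. exp (- (c * (of_int n + w)\<^sup>2))) summable_on {0..}"
    unfolding summable_on_reindex_bij_betw[OF b1, symmetric]
    by (rule summable_on_comparison_test[OF e]) (use bound[of n "int n" for n] in auto)
  moreover have "(\<lambda>n::int. exp (- (c * (of_int n + w)\<^sup>2))) summable_on {..<0}"
    unfolding summable_on_reindex_bij_betw[OF b2, symmetric]
    by (rule summable_on_comparison_test[OF e]) (use bound[of n "- int n - 1" for n] in auto)
  ultimately have "(\<lambda>n::int. exp (- (c * (of_int n + w)\<^sup>2))) summable_on ({0..} \<union> {..<0})"
    by (rule summable_on_Un_disjoint) auto
  moreover have "{0..} \<union> {..<0} = (UNIV :: int set)" by auto
  ultimately show ?thesis by simp
qed

section \<open>Gaussian integrals and the one-variable formula\<close>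

lemma integrable_gauss:
  assumes "a > 0"
  shows "integrable lborel (\<lambda>x. exp (- (pi * a * (x + w)\<^sup>2)))"
proof -
  \<comment> \<open>The function is a constant multiple of the normal density with mean
    \<open>- w\<close> and this standard deviation.\<close>
  define \<sigma> where "\<sigma> = sqrt (1 / (2 * pi * a))"
  have s: "\<sigma> > 0" "\<sigma>\<^sup>2 = 1 / (2 * pi * a)" using assms by (auto simp: \<sigma>_def)
  have "exp (- (pi * a * (x + w)\<^sup>2)) = sqrt (2 * pi * \<sigma>\<^sup>2) * normal_density (- w) \<sigma> x" for x
    unfolding normal_density_def using s assms by (simp add: field_simps)
  then show ?thesis
    using integrable_normal_density[OF s(1), of "- w"] by simp
qed

text \<open>The affine substitution with mean \<open>- w\<close> and standard deviation
  \<open>c\<close> turns the integral into the characteristic function of the standard normal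
  distribution.\<close>

lemma fourier_gauss:
  assumes a: "a > 0"
  shows "(\<integral>x. of_real (exp (- (pi * a * (x + w)\<^sup>2))) * cis (2 * pi * s * x) \<partial>lborel)
       = of_real (exp (- (pi * s\<^sup>2 / a)) / sqrt a) * cis (- (2 * pi * s * w))"
proof -
  define c where "c = 1 / sqrt (2 * pi * a)"
  have c: "c > 0" "c\<^sup>2 = 1 / (2 * pi * a)" using a by (auto simp: c_def power_divide)
  have "(\<integral>x. of_real (exp (- (pi * a * (x + w)\<^sup>2))) * cis (2 * pi * s * x) \<partial>lborel)
     = c *\<^sub>R (\<integral>x. of_real (exp (- (pi * a * (c * x)\<^sup>2))) * cis (2 * pi * s * (- w + c * x)) \<partial>lborel)"
    using lborel_integral_real_affine[of c "\<lambda>x. of_real (exp (- (pi * a * (x + w)\<^sup>2))) * cis (2 * pi * s * x)" "- w"] c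
    by simp
  also have "(\<integral>x. of_real (exp (- (pi * a * (c * x)\<^sup>2))) * cis (2 * pi * s * (- w + c * x)) \<partial>lborel) =
    (\<integral>x. (sqrt (2 * pi) * cis (- (2 * pi * s * w))) * (std_normal_density x *\<^sub>R iexp ((2 * pi * s * c) * x)) \<partial>lborel)"
  proof (intro Bochner_Integration.integral_cong refl)
    fix x :: real
    have "pi * a * (c * x)\<^sup>2 = x\<^sup>2 / 2"
      using a by (simp add: power_mult_distrib c)
    then have 1: "exp (- (pi * a * (c * x)\<^sup>2)) = sqrt (2 * pi) * std_normal_density x"
      by (simp add: std_normal_density_def)
    have 2: "cis (2 * pi * s * (- w + c * x)) = cis (- (2 * pi * s * w)) * iexp ((2 * pi * s * c) * x)"
      unfolding cis_conv_exp exp_add[symmetric] by (simp add: algebra_simps)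
    show "of_real (exp (- (pi * a * (c * x)\<^sup>2))) * cis (2 * pi * s * (- w + c * x)) = (sqrt (2 * pi) * cis (- (2 * pi * s * w))) * (std_normal_density x *\<^sub>R iexp ((2 * pi * s * c) * x))"
      unfolding 1 2 by (simp add: scaleR_conv_of_real mult_ac)
  qed
  also have "\<dots> = (sqrt (2 * pi) * cis (- (2 * pi * s * w))) * char std_normal_distribution (2 * pi * s * c)"
    unfolding char_def integral_mult_right_zero by (subst integral_density) (auto simp: normal_density_nonneg)
  also have "\<dots> = (sqrt (2 * pi) * cis (- (2 * pi * s * w))) * of_real (exp (- (pi * s\<^sup>2 / a)))"
  proof -
    have "(2 * pi * s * c)\<^sup>2 = (2 * pi * s)\<^sup>2 * c\<^sup>2"
      by (rule power_mult_distrib)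
    then have "(2 * pi * s * c)\<^sup>2 / 2 = pi * s\<^sup>2 / a"
      unfolding c(2) using a by (simp add: field_simps power2_eq_square)
    then show ?thesis by (simp add: char_std_normal_distribution)
  qed
  also have "c *\<^sub>R \<dots> = of_real (c * sqrt (2 * pi)) * of_real (exp (- (pi * s\<^sup>2 / a))) * cis (- (2 * pi * s * w))"
    by (simp add: scaleR_conv_of_real mult_ac)
  also have "c * sqrt (2 * pi) = 1 / sqrt a"
    by (simp add: c_def real_sqrt_mult)
  finally show ?thesis by simp
qed

text \<open>The left side dominates the derivative of a Gaussian times a character of frequency
  \<open>b\<close>. Half of the exponent is given up to absorb the linear factor, by
  \<open>1 + y \<le> exp y\<close>.\<close>

lemma gauss_derivative_bound:
  fixes a t b :: real
  assumes a: "a > 0"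
  shows "(2 * pi * a * \<bar>t\<bar> + 2 * pi * \<bar>b\<bar>) * exp (- (pi * a * t\<^sup>2)) \<le>
     (pi * a + 2 + 2 * pi * \<bar>b\<bar>) * exp (- (pi * a / 2 * t\<^sup>2))"
proof -
  define y where "y = pi * a / 2 * t\<^sup>2"
  have y: "y \<ge> 0" "pi * a * t\<^sup>2 = 2 * y" using a by (auto simp: y_def)
  have e: "1 + y \<le> exp y" by (rule exp_ge_add_one_self)
  have "2 * \<bar>t\<bar> \<le> 1 + t\<^sup>2"
    using zero_le_power2[of "\<bar>t\<bar> - 1"] by (simp add: power2_diff)
  then have "pi * a * (2 * \<bar>t\<bar>) \<le> pi * a * (1 + t\<^sup>2)"
    using a by (intro mult_left_mono) auto
  then have "2 * pi * a * \<bar>t\<bar> \<le> pi * a + 2 * y"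
    using y(2) by (simp add: algebra_simps)
  also have "\<dots> + 2 * pi * \<bar>b\<bar> \<le> (pi * a + 2 + 2 * pi * \<bar>b\<bar>) * (1 + y)"
    using y(1) a mult_nonneg_nonneg[of "pi * a" y] mult_nonneg_nonneg[of "pi * \<bar>b\<bar>" y] by (simp add: algebra_simps)
  also have "\<dots> \<le> (pi * a + 2 + 2 * pi * \<bar>b\<bar>) * exp y"
    using e a by (intro mult_left_mono) auto
  finally have "(2 * pi * a * \<bar>t\<bar> + 2 * pi * \<bar>b\<bar>) * exp (- (2 * y)) \<le> (pi * a + 2 + 2 * pi * \<bar>b\<bar>) * exp y * exp (- (2 * y))"
    by (intro mult_right_mono) auto
  also have "\<dots> = (pi * a + 2 + 2 * pi * \<bar>b\<bar>) * exp (- y)"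
    by (simp add: mult.assoc flip: exp_add)
  finally show ?thesis by (simp only: y(2) y_def[symmetric])
qed

text \<open>Up to the factor \<open>1 / sqrt a\<close>, this is the value of
  \<open>fourier_gauss\<close> at the frequency \<open>s = \<beta> - t\<close>.\<close>

abbreviation dual_gauss :: "real \<Rightarrow> real \<Rightarrow> real \<Rightarrow> real \<Rightarrow> complex" where
  "dual_gauss a w \<beta> t \<equiv> of_real (exp (- (pi * (t - \<beta>)\<^sup>2 / a))) * cis (2 * pi * (t - \<beta>) * w)"

lemma poisson_gauss_1:
  fixes a w \<beta> :: real
  assumes a: "a > 0"
  shows "(\<Sum>\<^sub>\<infinity>n::int. of_real (exp (- (pi * a * (of_int n + w)\<^sup>2))) * cis (2 * pi * \<beta> * of_int n))
      = of_real (1 / sqrt a) * (\<Sum>\<^sub>\<infinity>k::int. dual_gauss a w \<beta> (of_int k))"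
proof -
  define f where "f x = of_real (exp (- (pi * a * (x + w)\<^sup>2))) * cis (2 * pi * \<beta> * x)" for x
  define D where "D = pi * a + 2 + 2 * pi * \<bar>\<beta>\<bar>"
  define E where "E = exp (pi * a / 2 * (1 + \<bar>w\<bar>)\<^sup>2)"
  \<comment> \<open>The coefficient of the square drops twice: from \<open>pi * a\<close> to one
    half of it in the derivative bound, where \<open>D\<close> arises, and to one quarter when the
    shift by \<open>x + w\<close> is removed at the cost of \<open>E\<close>.\<close>
  define K where "K n = D * (E * exp (- (pi * a / 4 * (of_int n)\<^sup>2)))" for n :: int
  have D1: "D \<ge> 1" using a by (simp add: D_def add_nonneg_nonneg)
  have ex: "exp (- (pi * a / 2 * (of_int n + x + w)\<^sup>2)) \<le> E * exp (- (pi * a / 4 * (of_int n)\<^sup>2))" if x: "x \<in> {0..1}" for n :: int and x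
  proof -
    have "\<bar>x + w\<bar>\<^sup>2 \<le> (1 + \<bar>w\<bar>)\<^sup>2"
      using x by (intro power_mono) auto
    then have "(of_int n)\<^sup>2 / 2 - (1 + \<bar>w\<bar>)\<^sup>2 \<le> (of_int n + (x + w))\<^sup>2"
      using square_shift_ge[of "of_int n" "x + w"] by simp
    then have "pi * a / 2 * ((of_int n)\<^sup>2 / 2 - (1 + \<bar>w\<bar>)\<^sup>2) \<le> pi * a / 2 * (of_int n + (x + w))\<^sup>2"
      using a by (intro mult_left_mono) auto
    then show ?thesis unfolding E_def exp_add[symmetric] by (simp add: algebra_simps)
  qed
  have "(\<lambda>R. \<Sum>k\<in>{-int R..int R}. fourier_coeff lborel f k) \<longlonglongrightarrow> (\<Sum>\<^sub>\<infinity>n. f (of_int n))"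
  proof (rule poisson_summation)
    show "continuous_on UNIV f"
      unfolding f_def by (intro continuous_intros)
    have [measurable]: "f \<in> borel_measurable borel" unfolding f_def by measurable
    show "integrable lborel f"
      by (rule Bochner_Integration.integrable_bound[OF integrable_gauss[OF a, of w]]) (auto simp: f_def norm_mult)
    have "(\<lambda>n::int. exp (- (pi * a / 4 * (of_int n + 0)\<^sup>2))) summable_on UNIV"
      by (rule summable_on_gauss_int) (use a in simp)
    then show "K summable_on UNIV"
      unfolding K_def by (intro summable_on_cmult_right) simp
    fix n :: int and x :: real assume x: "x \<in> {0..1}"
    have "cmod (f (of_int n + x)) \<le> exp (- (pi * a / 2 * (of_int n + x + w)\<^sup>2))"
      using a by (simp add: f_def norm_mult mult_right_mono)
    also have "\<dots> \<le> E * exp (- (pi * a / 4 * (of_int n)\<^sup>2))" by (rule ex[OF x])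
    also have "\<dots> \<le> D * \<dots>" using D1 mult_right_mono[of 1 D "E * exp (- (pi * a / 4 * (of_int n)\<^sup>2))"] by (simp add: E_def)
    finally show "cmod (f (of_int n + x)) \<le> K n" by (simp add: K_def)
    fix y :: real assume y: "y \<in> {0..1}"
    define f' where "f' z = of_real (exp (- (pi * a * (z + w)\<^sup>2)) * (- (2 * pi * a * (z + w)))) * cis (2 * pi * \<beta> * z)
       + of_real (exp (- (pi * a * (z + w)\<^sup>2))) * ((2 * pi * \<beta>) *\<^sub>R (\<i> * cis (2 * pi * \<beta> * z)))" for z
    have "(f has_vector_derivative f' z) (at z)" for z
      unfolding f_def f'_def cis_conv_exp
      by (auto intro!: derivative_eq_intros has_vector_derivative_real_field simp: scaleR_conv_of_real algebra_simps)
    then have der: "(f has_derivative (\<lambda>h. h *\<^sub>R f' z)) (at z within S)" for z S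
      using has_derivative_at_withinI unfolding has_vector_derivative_def by blast
    have f': "cmod (f' z) \<le> K n" if z: "z \<in> {of_int n..of_int n + 1}" for z
    proof -
      have "cmod (f' z) \<le> exp (- (pi * a * (z + w)\<^sup>2)) * (2 * pi * a * \<bar>z + w\<bar>) + exp (- (pi * a * (z + w)\<^sup>2)) * (2 * pi * \<bar>\<beta>\<bar>)"
        unfolding f'_def using a by (intro order_trans[OF norm_triangle_ineq] add_mono) (simp_all add: norm_mult abs_mult del: of_real_add)
      also have "\<dots> = (2 * pi * a * \<bar>z + w\<bar> + 2 * pi * \<bar>\<beta>\<bar>) * exp (- (pi * a * (z + w)\<^sup>2))"
        by (simp add: algebra_simps)
      also have "\<dots> \<le> D * exp (- (pi * a / 2 * (z + w)\<^sup>2))"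
        unfolding D_def by (rule gauss_derivative_bound[OF a])
      also have "\<dots> \<le> K n"
        unfolding K_def using ex[of "z - of_int n" n] z D1 by (intro mult_left_mono) auto
      finally show ?thesis .
    qed
    \<comment> \<open>The Lipschitz bound on a cell is the mean value inequality with the derivative
      \<open>f'\<close> of \<open>f\<close>.\<close>
    have "cmod (f (of_int n + x) - f (of_int n + y)) \<le> K n * norm (of_int n + x - (of_int n + y))"
    proof (rule differentiable_bound[where S = "{of_int n..of_int n + 1}"])
      fix z assume "z \<in> {real_of_int n..of_int n + 1}"
      then show "onorm (\<lambda>h. h *\<^sub>R f' z) \<le> K n"
        using f'[of z] by (intro onorm_le) (auto simp: mult.commute intro!: mult_left_mono)
    qed (use der x y in auto)
    then show "cmod (f (of_int n + x) - f (of_int n + y)) \<le> K n * \<bar>x - y\<bar>" by simp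
  qed
  moreover have "fourier_coeff lborel f k
     = of_real (1 / sqrt a) * (dual_gauss a w \<beta> (of_int k))" for k :: int
  proof -
    have "f x * cis (- (2 * pi * of_int k * x)) = of_real (exp (- (pi * a * (x + w)\<^sup>2))) * cis (2 * pi * (\<beta> - of_int k) * x)" for x
      unfolding f_def by (simp add: mult.assoc cis_mult) (simp add: algebra_simps)
    moreover have "(\<beta> - of_int k)\<^sup>2 = (of_int k - \<beta>)\<^sup>2" by (rule power2_commute)
    moreover have "- (2 * pi * (\<beta> - of_int k) * w) = 2 * pi * (of_int k - \<beta>) * w" by (simp add: algebra_simps)
    ultimately show ?thesis by (simp only: fourier_gauss[OF a]) simp
  qed
  ultimately have "(\<lambda>R. \<Sum>k\<in>{-int R..int R}. of_real (1 / sqrt a) * (dual_gauss a w \<beta> (of_int k))) \<longlonglongrightarrow> (\<Sum>\<^sub>\<infinity>n. f (of_int n))"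
    by simp
  \<comment> \<open>The dual side is absolutely summable, so its symmetric limit is the unordered
    sum.\<close>
  moreover have "(\<lambda>R. \<Sum>k\<in>{-int R..int R}. of_real (1 / sqrt a) * (dual_gauss a w \<beta> (of_int k)))
     \<longlonglongrightarrow> of_real (1 / sqrt a) * (\<Sum>\<^sub>\<infinity>k::int. dual_gauss a w \<beta> (of_int k))"
  proof (intro has_sum_int_symmetric_limit has_sum_cmult_right has_sum_infsum, rule abs_summable_summable)
    have "(\<lambda>k::int. exp (- (pi / a * (of_int k + - \<beta>)\<^sup>2))) summable_on UNIV"
      by (rule summable_on_gauss_int) (use a in simp)
    then show "(\<lambda>k::int. cmod (dual_gauss a w \<beta> (of_int k))) summable_on UNIV"
      by (simp add: norm_mult)
  qed
  ultimately show ?thesis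
    unfolding f_def by (rule LIMSEQ_unique)
qed

section \<open>Poisson summation for positive definite quadratic forms\<close>

text \<open>Integer vectors are plain functions, so that a coordinate can be replaced by
  \<open>v(M := n)\<close>.\<close>

definition ivec :: "('i \<Rightarrow> int) \<Rightarrow> real^'i" where
  "ivec v = (\<chi> i. of_int (v i))"

definition qform :: "real^'i^'i \<Rightarrow> real^'i \<Rightarrow> real" where
  "qform W x = x \<bullet> (W *v x)"

text \<open>Support conditions stand in for spaces of smaller dimension: the index type stays fixed
  while the Poisson formula is built up coordinate by coordinate.\<close>

definition supported_on :: "'i set \<Rightarrow> ('i \<Rightarrow> 'a::zero) set" where
  "supported_on J = {v. \<forall>i. i \<notin> J \<longrightarrow> v i = 0}"

definition vec_supported_on :: "'i set \<Rightarrow> ('a::zero^'i) set" where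
  "vec_supported_on J = {x. \<forall>i. i \<notin> J \<longrightarrow> x $ i = 0}"

lemma ivec_nth [simp]: "ivec v $ i = of_int (v i)"
  by (simp add: ivec_def)

lemma supported_on_UNIV [simp]: "supported_on UNIV = UNIV"
  by (simp add: supported_on_def)

lemma vec_supported_on_UNIV [simp]: "vec_supported_on UNIV = UNIV"
  by (simp add: vec_supported_on_def)

lemma vec_supported_onD: "x \<in> vec_supported_on J \<Longrightarrow> i \<notin> J \<Longrightarrow> x $ i = 0"
  by (simp add: vec_supported_on_def)

lemma ivec_supported_on: "v \<in> supported_on J \<Longrightarrow> ivec v \<in> vec_supported_on J"
  by (simp add: supported_on_def vec_supported_on_def)

lemma add_vec_supported_on:
  fixes x y :: "'a::monoid_add^'i"
  shows "x \<in> vec_supported_on J \<Longrightarrow> y \<in> vec_supported_on J \<Longrightarrow> x + y \<in> vec_supported_on J"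
  by (simp add: vec_supported_on_def)

lemma scaleR_vec_supported_on:
  fixes x :: "real^'i"
  shows "x \<in> vec_supported_on J \<Longrightarrow> c *\<^sub>R x \<in> vec_supported_on J"
  by (simp add: vec_supported_on_def)

lemma bij_betw_supported_on_insert:
  assumes "M \<notin> J"
  shows "bij_betw (\<lambda>(n, v). v(M := n)) (UNIV \<times> supported_on J) (supported_on (insert M J) :: ('i \<Rightarrow> int) set)"
  by (rule bij_betw_byWitness[of _ "\<lambda>v. (v M, v(M := 0))"])
    (use assms in \<open>auto simp: supported_on_def fun_eq_iff\<close>)

lemma ivec_upd:
  assumes "v \<in> supported_on J" "M \<notin> J"
  shows "ivec (v(M := n)) = ivec v + of_int n *\<^sub>R axis M 1"
  using assms by (auto simp: vec_eq_iff supported_on_def axis_def)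

lemma summable_on_Times_mult:
  fixes f :: "'a \<Rightarrow> real" and g :: "'b \<Rightarrow> real"
  assumes "f summable_on A" "g summable_on B" "\<And>x. f x \<ge> 0" "\<And>y. g y \<ge> 0"
  shows "(\<lambda>(x, y). f x * g y) summable_on A \<times> B"
proof (rule summable_on_SigmaI)
  show "((\<lambda>y. case (x, y) of (x, y) \<Rightarrow> f x * g y) has_sum f x * infsum g B) B" for x
    using assms(2) by (auto intro!: has_sum_cmult_right)
  show "(\<lambda>x. f x * infsum g B) summable_on A"
    using assms(1) by (rule summable_on_cmult_left)
qed (use assms in auto)

lemma summable_on_gauss_supported_on:
  fixes c :: real and u :: "'i::finite \<Rightarrow> real"
  assumes c: "c > 0"
  shows "(\<lambda>v::'i \<Rightarrow> int. exp (- (c * (\<Sum>i\<in>J. (of_int (v i) + u i)\<^sup>2)))) summable_on supported_on J"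
  using finite[of J]
proof (induction J rule: finite_induct)
  case empty
  have "supported_on {} = {\<lambda>_::'i. 0 :: int}" by (auto simp: supported_on_def)
  then show ?case by simp
next
  case (insert M J)
  have "(\<lambda>(n::int, v::'i \<Rightarrow> int). exp (- (c * (of_int n + u M)\<^sup>2)) * exp (- (c * (\<Sum>i\<in>J. (of_int (v i) + u i)\<^sup>2))))
      summable_on (UNIV \<times> supported_on J)"
    by (rule summable_on_Times_mult[OF summable_on_gauss_int[OF c] insert.IH]) auto
  also have "(\<lambda>(n::int, v::'i \<Rightarrow> int). exp (- (c * (of_int n + u M)\<^sup>2)) * exp (- (c * (\<Sum>i\<in>J. (of_int (v i) + u i)\<^sup>2))))
    = (\<lambda>p. exp (- (c * (\<Sum>i\<in>insert M J. (of_int ((case p of (n, v) \<Rightarrow> v(M := n)) i) + u i)\<^sup>2))))"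
  proof (intro ext)
    fix p :: "int \<times> ('i \<Rightarrow> int)"
    obtain n v where p: "p = (n, v)" by fastforce
    have "(\<Sum>i\<in>J. (of_int ((v(M := n)) i) + u i)\<^sup>2) = (\<Sum>i\<in>J. (of_int (v i) + u i)\<^sup>2)"
      using insert.hyps by (intro sum.cong) auto
    then show "(case p of (n, v) \<Rightarrow> exp (- (c * (of_int n + u M)\<^sup>2)) * exp (- (c * (\<Sum>i\<in>J. (of_int (v i) + u i)\<^sup>2))))
     = exp (- (c * (\<Sum>i\<in>insert M J. (of_int ((case p of (n, v) \<Rightarrow> v(M := n)) i) + u i)\<^sup>2)))"
      using insert.hyps by (simp add: p distrib_left flip: exp_add)
  qed
  finally show ?case
    by (subst (asm) summable_on_reindex_bij_betw[OF bij_betw_supported_on_insert[OF insert.hyps(2)]])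
qed

text \<open>The minimum on the compact unit sphere of the coordinate subspace serves as
  \<open>\<epsilon>\<close>; homogeneity does the rest.\<close>

lemma qform_lower_bound:
  fixes W :: "real^'i^'i"
  assumes pos: "\<And>x. x \<in> vec_supported_on J \<Longrightarrow> x \<noteq> 0 \<Longrightarrow> qform W x > 0"
  obtains \<epsilon> where "\<epsilon> > 0" "\<And>x. x \<in> vec_supported_on J \<Longrightarrow> \<epsilon> * (norm x)\<^sup>2 \<le> qform W x"
proof -
  define S where "S = sphere (0::real^'i) 1 \<inter> vec_supported_on J"
  have scale: "qform W (c *\<^sub>R x) = c\<^sup>2 * qform W x" for c and x :: "real^'i"
    by (simp add: qform_def matrix_vector_mult_scaleR power2_eq_square)
  have S: "(1 / norm x) *\<^sub>R x \<in> S" if "x \<in> vec_supported_on J" "x \<noteq> 0" for x :: "real^'i"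
    using that by (auto simp: S_def scaleR_vec_supported_on)
  have "closed (vec_supported_on J :: (real^'i) set)"
  proof -
    have "(vec_supported_on J :: (real^'i) set) = (\<Inter>i\<in>-J. {x. x $ i = 0})"
      by (auto simp: vec_supported_on_def)
    then show ?thesis by (auto intro!: closed_INT closed_Collect_eq continuous_intros)
  qed
  then have comp: "compact S" unfolding S_def by (intro compact_Int_closed) auto
  show ?thesis
  proof (cases "S = {}")
    \<comment> \<open>The subspace is zero, as for empty \<open>J\<close>, and any positive constant
      works.\<close>
    case True
    then have x0: "x = 0" if "x \<in> vec_supported_on J" for x :: "real^'i" using S[of x] that by blast
    show ?thesis
    proof (rule that)
      show "1 * (norm x)\<^sup>2 \<le> qform W x" if "x \<in> vec_supported_on J" for x
        using x0[OF that] by (simp add: qform_def)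
    qed simp
  next
    case False
    have "continuous_on S (qform W)"
      unfolding qform_def by (intro continuous_intros linear_continuous_on) (simp add: linear_conv_bounded_linear[symmetric])
    from continuous_attains_inf[OF comp False this]
    obtain y where y: "y \<in> S" "\<And>x. x \<in> S \<Longrightarrow> qform W y \<le> qform W x" by blast
    show ?thesis
    proof (rule that)
      show "qform W y > 0" using y(1) by (intro pos) (auto simp: S_def)
      fix x :: "real^'i" assume x: "x \<in> vec_supported_on J"
      show "qform W y * (norm x)\<^sup>2 \<le> qform W x"
      proof (cases "x = 0")
        case False
        have "qform W y \<le> qform W ((1 / norm x) *\<^sub>R x)" by (intro y S x False)
        also have "\<dots> = qform W x / (norm x)\<^sup>2" by (simp add: scale power_divide)
        finally show ?thesis using False by (simp add: field_simps)
      qed (simp add: qform_def)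
    qed
  qed
qed

lemma power2_norm_vec: "(norm (x::real^'i))\<^sup>2 = (\<Sum>i\<in>UNIV. (x $ i)\<^sup>2)"
  unfolding power2_norm_eq_inner inner_vec_def by (simp add: power2_eq_square)

lemma summable_on_gauss_norm:
  fixes u :: "real^'i"
  assumes "c > 0"
  shows "(\<lambda>v. exp (- (c * (norm (ivec v + u))\<^sup>2))) summable_on (A :: ('i \<Rightarrow> int) set)"
proof -
  have "(\<lambda>v::'i \<Rightarrow> int. exp (- (c * (\<Sum>i\<in>UNIV. (of_int (v i) + u $ i)\<^sup>2)))) summable_on supported_on UNIV"
    by (rule summable_on_gauss_supported_on[OF assms])
  then have "(\<lambda>v::'i \<Rightarrow> int. exp (- (c * (norm (ivec v + u))\<^sup>2))) summable_on UNIV"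
    by (simp add: power2_norm_vec)
  then show ?thesis by (rule summable_on_subset_banach) simp
qed

lemma summable_on_gauss_qform:
  fixes W :: "real^'i^'i" and u :: "real^'i"
  assumes pos: "\<And>x. x \<in> vec_supported_on J \<Longrightarrow> x \<noteq> 0 \<Longrightarrow> qform W x > 0"
    and u: "u \<in> vec_supported_on J"
  shows "(\<lambda>v. exp (- (pi * qform W (ivec v + u)))) summable_on supported_on J"
proof -
  from pos obtain \<epsilon> where \<epsilon>: "\<epsilon> > 0" "\<And>x. x \<in> vec_supported_on J \<Longrightarrow> \<epsilon> * (norm x)\<^sup>2 \<le> qform W x"
    by (rule qform_lower_bound[of J W]) blast+
  have "pi * \<epsilon> > 0" using \<epsilon> by simp
  from summable_on_gauss_norm[OF this] show ?thesis
  proof (rule summable_on_comparison_test)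
    fix v :: "'i \<Rightarrow> int" assume "v \<in> supported_on J"
    then have "\<epsilon> * (norm (ivec v + u))\<^sup>2 \<le> qform W (ivec v + u)"
      by (intro \<epsilon> add_vec_supported_on ivec_supported_on u)
    then show "exp (- (pi * qform W (ivec v + u))) \<le> exp (- (pi * \<epsilon> * (norm (ivec v + u))\<^sup>2))"
      by (simp add: mult.assoc)
  qed auto
qed

text \<open>In the Leibniz formula only permutations fixing \<open>M\<close> contribute, so the
  entries of column \<open>M\<close> outside row \<open>M\<close> are irrelevant.\<close>

lemma det_eq_if_unit_row:
  fixes A B :: "'a::comm_ring_1^'n^'n"
  assumes A: "\<And>j. A $ M $ j = of_bool (M = j)" and B: "\<And>j. B $ M $ j = of_bool (M = j)"
    and AB: "\<And>i j. i \<noteq> M \<Longrightarrow> j \<noteq> M \<Longrightarrow> A $ i $ j = B $ i $ j"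
  shows "det A = det B"
  unfolding det_def
proof (intro sum.cong refl)
  fix p :: "'n \<Rightarrow> 'n" assume "p \<in> {p. p permutes UNIV}"
  then have inj: "inj p" by (auto simp: permutes_inj)
  show "of_int (sign p) * (\<Prod>i\<in>UNIV. A $ i $ p i) = of_int (sign p) * (\<Prod>i\<in>UNIV. B $ i $ p i)"
  proof (cases "p M = M")
    case True
    have "A $ i $ p i = B $ i $ p i" for i
      using True AB[of i "p i"] A B inj by (cases "i = M") (auto simp: inj_def, metis)
    then show ?thesis by simp
  next
    case False
    then have "A $ M $ p M = 0" "B $ M $ p M = 0" using A B by auto
    then have "(\<Prod>i\<in>UNIV. A $ i $ p i) = 0" "(\<Prod>i\<in>UNIV. B $ i $ p i) = 0"
      by (auto intro!: prod_zero)
    then show ?thesis by simp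
  qed
qed

text \<open>Padding with the identity keeps the matrix type fixed; the determinant is the principal
  minor on \<open>J\<close>.\<close>

definition principal_block :: "'i set \<Rightarrow> real^'i^'i \<Rightarrow> real^'i^'i" where
  "principal_block J W = (\<chi> i j. if i \<in> J \<and> j \<in> J then W $ i $ j else of_bool (i = j))"

text \<open>Subtracting from row \<open>M\<close> the combination of the rows in \<open>J\<close>
  with coefficients \<open>p\<close> leaves \<open>a\<close>, the Schur complement, times a unit
  vector.\<close>

lemma det_principal_block_insert:
  fixes W :: "real^'i^'i"
  assumes M: "M \<notin> J" and p: "p \<in> vec_supported_on J"
    and Wp: "\<And>j. j \<in> J \<Longrightarrow> (\<Sum>i\<in>UNIV. p $ i * W $ i $ j) = W $ M $ j"
    and a: "a = W $ M $ M - (\<Sum>i\<in>UNIV. p $ i * W $ i $ M)"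
  shows "det (principal_block (insert M J) W) = a * det (principal_block J W)"
proof -
  define A where "A = principal_block (insert M J) W"
  define x where "x = - (\<Sum>i\<in>J. p $ i *s row i A)"
  have "x \<in> vec.span {row j A |j. j \<noteq> M}"
    unfolding x_def using M by (intro vec.span_neg vec.span_sum vec.span_scale vec.span_base) auto
  from det_row_span[OF this] have "det A = det (\<chi> k. if k = M then row M A + x else row k A)" ..
  also have "row M A + x = a *s axis M 1"
  proof (unfold vec_eq_iff, intro allI)
    fix j
    have sumJ: "(\<Sum>i\<in>J. p $ i * W $ i $ j) = (\<Sum>i\<in>UNIV. p $ i * W $ i $ j)" for j
      using p by (intro sum.mono_neutral_left) (auto simp: vec_supported_onD)
    have "(row M A + x) $ j = A $ M $ j - (\<Sum>i\<in>J. p $ i * A $ i $ j)"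
      by (simp add: x_def row_def)
    also have "\<dots> = (a *s axis M 1) $ j"
    proof (cases "j \<in> insert M J")
      case True
      then have "(\<Sum>i\<in>J. p $ i * A $ i $ j) = (\<Sum>i\<in>J. p $ i * W $ i $ j)"
        by (intro sum.cong) (auto simp: A_def principal_block_def)
      with True Wp[of j] M show ?thesis
        by (auto simp: sumJ a A_def principal_block_def axis_def)
    next
      case False
      then have "(\<Sum>i\<in>J. p $ i * A $ i $ j) = 0"
        by (intro sum.neutral) (auto simp: A_def principal_block_def)
      with False show ?thesis by (auto simp: A_def principal_block_def axis_def)
    qed
    finally show "(row M A + x) $ j = (a *s axis M 1) $ j" .
  qed
  also have "det (\<chi> k. if k = M then a *s axis M 1 else row k A) = a * det (\<chi> k. if k = M then axis M 1 else row k A)"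
    using det_row_mul[of M a "\<lambda>_. axis M 1" "\<lambda>k. row k A"] by simp
  also have "det (\<chi> k. if k = M then axis M 1 else row k A) = det (principal_block J W)"
    by (rule det_eq_if_unit_row[of _ M]) (use M in \<open>auto simp: axis_def principal_block_def row_def A_def\<close>)
  finally show ?thesis by (simp add: A_def)
qed

abbreviation gauss :: "real^'i^'i \<Rightarrow> real^'i \<Rightarrow> complex" where
  "gauss W x \<equiv> of_real (exp (- (pi * qform W x)))"

abbreviation gauss_sum :: "real^'i^'i \<Rightarrow> ('i \<Rightarrow> int) set \<Rightarrow> real^'i \<Rightarrow> complex" where
  "gauss_sum W S u \<equiv> (\<Sum>\<^sub>\<infinity>v\<in>S. gauss W (ivec v + u))"

abbreviation dual_sum :: "real^'i^'i \<Rightarrow> ('i \<Rightarrow> int) set \<Rightarrow> real^'i \<Rightarrow> complex" where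
  "dual_sum H S u \<equiv> (\<Sum>\<^sub>\<infinity>k\<in>S. gauss H (ivec k) * cis (2 * pi * (ivec k \<bullet> u)))"

lemma inner_axis_1 [simp]: "x \<bullet> axis M 1 = (x::real^'i) $ M" "axis M 1 \<bullet> x = (x::real^'i) $ M"
  by (simp_all add: inner_axis inner_commute)

lemma qform_add_scaleR:
  fixes W :: "real^'i^'i"
  assumes "transpose W = W"
  shows "qform W (x + t *\<^sub>R y) = qform W x + 2 * t * (x \<bullet> (W *v y)) + t\<^sup>2 * qform W y"
proof -
  have "y \<bullet> (W *v x) = x \<bullet> (W *v y)"
    using dot_lmul_matrix[of y W x] transpose_matrix_vector[of W y] assms by (simp add: inner_commute)
  then show ?thesis
    by (simp add: qform_def matrix_vector_right_distrib matrix_vector_mult_scaleR inner_add_left inner_add_right power2_eq_square algebra_simps)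
qed

text \<open>The induction invariant: \<open>H\<close> is the inverse of the block of
  \<open>W\<close> on \<open>J\<close>, padded with zeros. Its positivity on vectors supported on
  \<open>J\<close> makes the dual series converge.\<close>

locale block_inverse =
  fixes W H :: "real^'i^'i" and J :: "'i set"
  assumes W_sym: "transpose W = W" and W_pos: "\<And>x. x \<noteq> 0 \<Longrightarrow> qform W x > 0"
    and H_sym: "transpose H = H" and H_supp: "\<And>i j. i \<notin> J \<or> j \<notin> J \<Longrightarrow> H $ i $ j = 0"
    and WH: "\<And>i j. i \<in> J \<Longrightarrow> j \<in> J \<Longrightarrow> (W ** H) $ i $ j = of_bool (i = j)"
    and H_pos: "\<And>x. x \<in> vec_supported_on J \<Longrightarrow> x \<noteq> 0 \<Longrightarrow> qform H x > 0"

text \<open>\<open>p\<close> is the projection of the \<open>M\<close>-th unit vector onto the coordinates in \<open>J\<close> that is orthogonal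
  for \<open>W\<close>, \<open>a\<close> is the Schur complement, and \<open>H'\<close> is the inverse of the enlarged block.\<close>

locale block_inverse_step = block_inverse W H J for W H :: "real^'i^'i" and J :: "'i set" +
  fixes M :: 'i
  assumes M: "M \<notin> J"
begin

definition g :: "real^'i" where "g = (\<chi> i. if i \<in> J then W $ i $ M else 0)"
definition p :: "real^'i" where "p = H *v g"
definition a :: real where "a = W $ M $ M - g \<bullet> p"
definition q :: "real^'i" where "q = p - axis M 1"
definition H' :: "real^'i^'i" where "H' = (\<chi> i j. H $ i $ j + q $ i * q $ j / a)"

lemma W_swap: "W $ i $ j = W $ j $ i"
  using W_sym unfolding transpose_def by (metis vec_lambda_beta)

lemma H_swap: "H $ i $ j = H $ j $ i"
  using H_sym unfolding transpose_def by (metis vec_lambda_beta)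

lemma g_supp: "g \<in> vec_supported_on J" by (simp add: g_def vec_supported_on_def)

lemma p_supp: "p \<in> vec_supported_on J"
  by (simp add: p_def vec_supported_on_def matrix_vector_mult_def H_supp)

lemma p_M [simp]: "p $ M = 0" using p_supp M by (rule vec_supported_onD)

lemma W_p: assumes "i \<in> J" shows "(W *v p) $ i = g $ i"
proof -
  have "(W *v p) $ i = (\<Sum>j\<in>UNIV. (W ** H) $ i $ j * g $ j)"
    unfolding p_def matrix_vector_mul_assoc by (simp add: matrix_vector_mult_def)
  also have "\<dots> = (\<Sum>j\<in>UNIV. of_bool (i = j) * g $ j)"
    using WH[OF assms] g_supp by (intro sum.cong refl) (metis mult_zero_right vec_supported_onD)
  also have "\<dots> = g $ i" by (simp add: of_bool_def if_distrib if_distribR cong: if_cong)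
  finally show ?thesis .
qed

lemma W_p_M: "(W *v p) $ M = g \<bullet> p"
  unfolding matrix_vector_mult_def inner_vec_def g_def
  using p_supp by (auto intro!: sum.cong simp: W_swap[of M] vec_supported_onD)

text \<open>Hence \<open>- q / a\<close> is column \<open>M\<close> of the inverse of the enlarged
  block, which explains the rank-one correction in \<open>H'\<close>.\<close>

lemma W_q: assumes "i \<in> insert M J" shows "(W *v q) $ i = (if i = M then - a else 0)"
  using assms M
  by (auto simp: q_def matrix_vector_mult_diff_distrib matrix_vector_mult_basis column_def W_p W_p_M a_def g_def)

lemma inner_supp:
  fixes x y z :: "real^'i"
  assumes "x \<in> vec_supported_on J" "\<And>i. i \<in> J \<Longrightarrow> y $ i = z $ i"
  shows "x \<bullet> y = x \<bullet> z"
  unfolding inner_vec_def using assms by (intro sum.cong refl) (metis inner_zero_left vec_supported_onD)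

text \<open>Against vectors supported on \<open>J\<close>, both \<open>W *v axis M 1\<close> and
  \<open>W *v p\<close> act as \<open>g\<close>. The mixed terms therefore agree, and the terms
  quadratic in \<open>t\<close> differ by \<open>a\<close>.\<close>

lemma complete_square:
  assumes "y \<in> vec_supported_on J"
  shows "qform W (y + t *\<^sub>R axis M 1) = qform W (y + t *\<^sub>R p) + a * t\<^sup>2"
proof -
  have 1: "y \<bullet> (W *v axis M 1) = y \<bullet> g"
    by (rule inner_supp[OF assms]) (simp add: matrix_vector_mult_basis column_def g_def)
  have 2: "y \<bullet> (W *v p) = y \<bullet> g" by (rule inner_supp[OF assms]) (rule W_p)
  have 3: "p \<bullet> (W *v p) = p \<bullet> g" by (rule inner_supp[OF p_supp]) (rule W_p)
  have 4: "qform W (axis M 1) = W $ M $ M" by (simp add: qform_def matrix_vector_mult_basis column_def)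
  show ?thesis unfolding qform_add_scaleR[OF W_sym] 1 2 4
    by (simp add: qform_def 3 a_def algebra_simps inner_commute)
qed

text \<open>At \<open>y = - p\<close> and \<open>t = 1\<close> the completed square reduces to
  \<open>a\<close>, which is thus a value of the positive form at a vector with \<open>M\<close>-th
  coordinate 1.\<close>

lemma a_pos: "a > 0"
proof -
  have "qform W ((- p) + 1 *\<^sub>R axis M 1) = qform W ((- p) + 1 *\<^sub>R p) + a * 1\<^sup>2"
    by (rule complete_square) (use p_supp in \<open>simp add: vec_supported_on_def\<close>)
  moreover have "(- p + 1 *\<^sub>R axis M 1) $ M \<noteq> 0" by (simp add: axis_def)
  then have "- p + 1 *\<^sub>R axis M 1 \<noteq> 0" by (metis zero_index)
  ultimately show ?thesis using W_pos[of "- p + 1 *\<^sub>R axis M 1"] by (simp add: qform_def)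
qed

text \<open>The correction term is the exponent on the dual side of the one-variable formula with
  \<open>\<beta> = y \<bullet> p\<close>, so \<open>H'\<close> is exactly the form that the
  summation over coordinate \<open>M\<close> produces.\<close>

lemma qform_H':
  assumes "y \<in> vec_supported_on J"
  shows "qform H' (y + t *\<^sub>R axis M 1) = qform H y + (y \<bullet> p - t)\<^sup>2 / a"
proof -
  have "H' *v x = H *v x + ((q \<bullet> x) / a) *\<^sub>R q" for x
    by (simp add: vec_eq_iff H'_def matrix_vector_mult_def inner_vec_def algebra_simps sum.distrib sum_distrib_left sum_divide_distrib)
  then have H': "qform H' x = qform H x + (q \<bullet> x)\<^sup>2 / a" for x
    by (simp add: qform_def inner_add_right power2_eq_square inner_commute)
  have "H *v axis M 1 = 0"
    by (simp add: vec_eq_iff matrix_vector_mult_basis column_def H_supp M)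
  then have "qform H (y + t *\<^sub>R axis M 1) = qform H y"
    by (simp add: qform_add_scaleR[OF H_sym]) (simp add: qform_def)
  moreover have "q \<bullet> (y + t *\<^sub>R axis M 1) = y \<bullet> p - t"
    using assms M by (simp add: q_def inner_diff_left inner_diff_right inner_add_left inner_add_right inner_commute vec_supported_onD)
  ultimately show ?thesis by (simp add: H')
qed

lemma split_supp:
  assumes "x \<in> vec_supported_on (insert M J)"
  shows "x - (x $ M) *\<^sub>R axis M 1 \<in> vec_supported_on J" "x = (x - (x $ M) *\<^sub>R axis M 1) + (x $ M) *\<^sub>R axis M (1::real)"
  using assms by (auto simp: vec_supported_on_def axis_def)

lemma block_inverse_insert: "block_inverse W H' (insert M J)"
proof
  show "transpose W = W" by (rule W_sym)
  show "qform W x > 0" if "x \<noteq> 0" for x using that by (rule W_pos)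
  show "transpose H' = H'"
    by (simp add: transpose_def H'_def vec_eq_iff H_swap mult.commute)
  show "H' $ i $ j = 0" if "i \<notin> insert M J \<or> j \<notin> insert M J" for i j
  proof -
    have "q $ i = 0" if "i \<notin> insert M J" for i
      using that p_supp by (simp add: q_def vec_supported_onD axis_def)
    then show ?thesis using that by (auto simp: H'_def H_supp)
  qed
  show "(W ** H') $ i $ j = of_bool (i = j)" if i: "i \<in> insert M J" and j: "j \<in> insert M J" for i j
  proof -
    \<comment> \<open>By \<open>W_q\<close> the rank-one term changes only row \<open>M\<close> of
      the product.\<close>
    have "(W ** H') $ i $ j = (W ** H) $ i $ j + (W *v q) $ i * q $ j / a"
      by (simp add: matrix_matrix_mult_def matrix_vector_mult_def H'_def algebra_simps sum.distrib sum_distrib_left sum_distrib_right sum_divide_distrib)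
    also have "\<dots> = (W ** H) $ i $ j - (if i = M then q $ j else 0)"
      using W_q[OF i] a_pos by simp
    also have "\<dots> = of_bool (i = j)"
    proof (cases "j = M")
      case True
      have "(W ** H) $ i $ j = 0" by (simp add: True matrix_matrix_mult_def H_supp M)
      then show ?thesis by (simp add: True q_def)
    next
      case False
      with j have j: "j \<in> J" by simp
      show ?thesis
      proof (cases "i = M")
        case True
        have "(W ** H) $ M $ j = (\<Sum>l\<in>UNIV. H $ j $ l * g $ l)"
          unfolding matrix_matrix_mult_def
          by (auto intro!: sum.cong simp: g_def H_supp W_swap[of M] H_swap[of _ j])
        also have "\<dots> = p $ j" by (simp add: p_def matrix_vector_mult_def)
        finally show ?thesis using True False by (simp add: q_def axis_def)
      next
        case i2: False
        with i have "i \<in> J" by simp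
        with j WH[of i j] i2 show ?thesis by simp
      qed
    qed
    finally show ?thesis .
  qed
  fix x :: "real^'i" assume x: "x \<in> vec_supported_on (insert M J)" "x \<noteq> 0"
  define y t where "y = x - (x $ M) *\<^sub>R axis M 1" and "t = x $ M"
  have y: "y \<in> vec_supported_on J" "x = y + t *\<^sub>R axis M 1"
    using split_supp[OF x(1)] by (simp_all add: y_def t_def)
  have eq: "qform H' x = qform H y + (y \<bullet> p - t)\<^sup>2 / a"
    unfolding y(2) by (rule qform_H'[OF y(1)])
  show "qform H' x > 0"
  proof (cases "y = 0")
    case True
    then have "t \<noteq> 0" using x(2) y(2) by auto
    then show ?thesis using a_pos by (simp add: eq True) (simp add: qform_def)
  next
    case False
    have "(y \<bullet> p - t)\<^sup>2 / a \<ge> 0" using a_pos by simp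
    with H_pos[OF y(1) False] show ?thesis by (simp add: eq)
  qed
qed

lemma det_insert: "det (principal_block (insert M J) W) = a * det (principal_block J W)"
proof (rule det_principal_block_insert[OF M p_supp])
  show "(\<Sum>i\<in>UNIV. p $ i * W $ i $ j) = W $ M $ j" if "j \<in> J" for j
  proof -
    have "(\<Sum>i\<in>UNIV. p $ i * W $ i $ j) = (W *v p) $ j"
      by (simp add: matrix_vector_mult_def W_swap[of j] mult.commute)
    then show ?thesis using that by (simp add: W_p g_def W_swap)
  qed
  have "(\<Sum>i\<in>UNIV. p $ i * W $ i $ M) = (W *v p) $ M"
    by (simp add: matrix_vector_mult_def W_swap[of M] mult.commute)
  then show "a = W $ M $ M - (\<Sum>i\<in>UNIV. p $ i * W $ i $ M)" by (simp add: W_p_M a_def)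
qed

text \<open>For fixed \<open>n\<close> in coordinate \<open>M\<close>, completing the square turns
  the sum over the other coordinates into the known one with shift \<open>u' + (n + s) p\<close>.
  For each dual vector \<open>k\<close> the remaining sum over \<open>n\<close> is then a
  one-variable Gaussian sum.\<close>

lemma poisson_insert:
  assumes D: "D > 0"
    and IH: "\<And>u. u \<in> vec_supported_on J \<Longrightarrow>
      gauss_sum W (supported_on J) u =
      of_real (1 / sqrt D) * dual_sum H (supported_on J) u"
    and u: "u \<in> vec_supported_on (insert M J)"
  shows "gauss_sum W (supported_on (insert M J)) u =
      of_real (1 / sqrt (a * D)) * dual_sum H' (supported_on (insert M J)) u"
proof -
  interpret new: block_inverse W H' "insert M J" by (rule block_inverse_insert)
  define s u' where "s = u $ M" and "u' = u - s *\<^sub>R axis M 1"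
  have u': "u' \<in> vec_supported_on J" "u = u' + s *\<^sub>R axis M 1"
    using split_supp[OF u] by (simp_all add: u'_def s_def)
  note bij = bij_betw_supported_on_insert[OF M]
  let ?S = "supported_on J :: ('i \<Rightarrow> int) set" and ?S' = "supported_on (insert M J) :: ('i \<Rightarrow> int) set"
  define A where "A n = exp (- (pi * a * (of_int n + s)\<^sup>2))" for n :: int
  define E where "E n k = of_real (A n) * (gauss H (ivec k) * cis (2 * pi * (ivec k \<bullet> (u' + (of_int n + s) *\<^sub>R p))))" for n :: int and k :: "'i \<Rightarrow> int"
  have qW: "qform W (ivec (v(M := n)) + u) = qform W (ivec v + (u' + (of_int n + s) *\<^sub>R p)) + a * (of_int n + s)\<^sup>2"
    if "v \<in> supported_on J" for v n
  proof -
    have "ivec (v(M := n)) + u = (ivec v + u') + (of_int n + s) *\<^sub>R axis M 1"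
      by (subst u'(2)) (simp add: ivec_upd[OF that M] algebra_simps)
    moreover have "ivec v + u' \<in> vec_supported_on J"
      by (intro add_vec_supported_on ivec_supported_on that u')
    ultimately show ?thesis
      using complete_square[of "ivec v + u'" "of_int n + s"] by (simp add: add.assoc)
  qed
  have "(\<lambda>v. gauss W (ivec v + u)) summable_on ?S'"
    by (intro summable_on_of_real summable_on_gauss_qform W_pos u)
  then have sum1: "(\<lambda>(n, v). gauss W (ivec (v(M := n)) + u)) summable_on (UNIV \<times> ?S)"
    unfolding summable_on_reindex_bij_betw[OF bij, symmetric] by (simp add: case_prod_unfold)
  have "gauss_sum W ?S' u
      = (\<Sum>\<^sub>\<infinity>(n, v)\<in>UNIV \<times> ?S. gauss W (ivec (v(M := n)) + u))"
    unfolding infsum_reindex_bij_betw[OF bij, symmetric] by (simp add: case_prod_unfold)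
  also have "\<dots> = (\<Sum>\<^sub>\<infinity>n. \<Sum>\<^sub>\<infinity>v\<in>?S. gauss W (ivec (v(M := n)) + u))"
    by (rule infsum_Sigma'_banach[symmetric]) (rule sum1)
  also have "\<dots> = (\<Sum>\<^sub>\<infinity>n. of_real (1 / sqrt D) * (\<Sum>\<^sub>\<infinity>k\<in>?S. E n k))"
  proof (intro infsum_cong)
    fix n :: int
    have "(\<Sum>\<^sub>\<infinity>v\<in>?S. gauss W (ivec (v(M := n)) + u))
      = (\<Sum>\<^sub>\<infinity>v\<in>?S. of_real (A n) * gauss W (ivec v + (u' + (of_int n + s) *\<^sub>R p)))"
    proof (intro infsum_cong)
      fix v assume v: "v \<in> ?S"
      show "gauss W (ivec (v(M := n)) + u) = of_real (A n) * gauss W (ivec v + (u' + (of_int n + s) *\<^sub>R p))"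
        unfolding qW[OF v] A_def of_real_mult[symmetric] exp_add[symmetric] by (simp only: distrib_left mult.assoc minus_add)
    qed
    also have "\<dots> = of_real (A n) * (of_real (1 / sqrt D) * (\<Sum>\<^sub>\<infinity>k\<in>?S. gauss H (ivec k) * cis (2 * pi * (ivec k \<bullet> (u' + (of_int n + s) *\<^sub>R p)))))"
      by (subst infsum_cmult_right', subst IH) (auto intro!: add_vec_supported_on scaleR_vec_supported_on u' p_supp)
    also have "\<dots> = of_real (1 / sqrt D) * (\<Sum>\<^sub>\<infinity>k\<in>?S. E n k)"
      unfolding E_def infsum_cmult_right' by (simp add: mult.left_commute)
    finally show "(\<Sum>\<^sub>\<infinity>v\<in>?S. gauss W (ivec (v(M := n)) + u)) = of_real (1 / sqrt D) * (\<Sum>\<^sub>\<infinity>k\<in>?S. E n k)" .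
  qed
  also have "\<dots> = of_real (1 / sqrt D) * (\<Sum>\<^sub>\<infinity>n. \<Sum>\<^sub>\<infinity>k\<in>?S. E n k)"
    by (rule infsum_cmult_right')
  \<comment> \<open>The modulus of \<open>E n k\<close> is a Gaussian in \<open>n\<close> times a
    Gaussian in \<open>k\<close>, because \<open>n\<close> interacts with \<open>k\<close> only
    through a phase; this permits the exchange.\<close>
  also have "(\<Sum>\<^sub>\<infinity>n. \<Sum>\<^sub>\<infinity>k\<in>?S. E n k) = (\<Sum>\<^sub>\<infinity>k\<in>?S. \<Sum>\<^sub>\<infinity>n. E n k)"
  proof (rule infsum_swap_banach, rule abs_summable_summable)
    have "(\<lambda>(n, k). A n * exp (- (pi * qform H (ivec k + 0)))) summable_on UNIV \<times> ?S"
      unfolding A_def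
      by (intro summable_on_Times_mult summable_on_gauss_int summable_on_gauss_qform H_pos)
        (use a_pos in \<open>auto simp: vec_supported_on_def\<close>)
    then show "(\<lambda>x. cmod (case x of (n, k) \<Rightarrow> E n k)) summable_on UNIV \<times> ?S"
      by (simp add: E_def norm_mult case_prod_unfold A_def)
  qed
  also have "\<dots> = (\<Sum>\<^sub>\<infinity>k\<in>?S. of_real (1 / sqrt a) * (\<Sum>\<^sub>\<infinity>m. gauss H' (ivec (k(M := m))) * cis (2 * pi * (ivec (k(M := m)) \<bullet> u))))"
  proof (intro infsum_cong)
    fix k assume k: "k \<in> ?S"
    \<comment> \<open>The inner shift is linear in \<open>n\<close>, so \<open>n\<close> enters the
      phase with frequency \<open>\<beta>\<close>; \<open>c\<close> collects everything independent
      of \<open>n\<close>.\<close>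
    define \<beta> where "\<beta> = ivec k \<bullet> p"
    define c where "c = gauss H (ivec k) * cis (2 * pi * (ivec k \<bullet> u' + s * \<beta>))"
    have "E n k = c * (of_real (exp (- (pi * a * (of_int n + s)\<^sup>2))) * cis (2 * pi * \<beta> * of_int n))" for n
    proof -
      have "2 * pi * (ivec k \<bullet> (u' + (of_int n + s) *\<^sub>R p)) = 2 * pi * (ivec k \<bullet> u' + s * \<beta>) + 2 * pi * \<beta> * of_int n"
        by (simp add: \<beta>_def inner_add_right algebra_simps)
      then show ?thesis unfolding E_def c_def A_def by (simp add: mult_ac flip: cis_mult)
    qed
    then have "(\<Sum>\<^sub>\<infinity>n. E n k) = c * (of_real (1 / sqrt a) * (\<Sum>\<^sub>\<infinity>m::int. of_real (exp (- (pi * (of_int m - \<beta>)\<^sup>2 / a))) * cis (2 * pi * (of_int m - \<beta>) * s)))"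
      by (simp only: infsum_cmult_right' poisson_gauss_1[OF a_pos])
    also have "\<dots> = of_real (1 / sqrt a) * (\<Sum>\<^sub>\<infinity>m::int. c * (of_real (exp (- (pi * (of_int m - \<beta>)\<^sup>2 / a))) * cis (2 * pi * (of_int m - \<beta>) * s)))"
      by (simp only: infsum_cmult_right' mult.left_commute)
    also have "(\<Sum>\<^sub>\<infinity>m::int. c * (of_real (exp (- (pi * (of_int m - \<beta>)\<^sup>2 / a))) * cis (2 * pi * (of_int m - \<beta>) * s)))
      = (\<Sum>\<^sub>\<infinity>m. gauss H' (ivec (k(M := m))) * cis (2 * pi * (ivec (k(M := m)) \<bullet> u)))"
    proof (intro infsum_cong)
      fix m :: int
      have 1: "qform H' (ivec (k(M := m))) = qform H (ivec k) + (of_int m - \<beta>)\<^sup>2 / a"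
        unfolding ivec_upd[OF k M] using qform_H'[OF ivec_supported_on[OF k], of "of_int m"]
        by (simp add: \<beta>_def power2_commute)
      have "ivec (k(M := m)) \<bullet> u = ivec k \<bullet> u' + of_int m * s"
        using k u'(1) M unfolding ivec_upd[OF k M] by (subst u'(2))
          (simp add: inner_add_left inner_add_right supported_on_def vec_supported_onD algebra_simps)
      then have 2: "2 * pi * (ivec (k(M := m)) \<bullet> u) = 2 * pi * (ivec k \<bullet> u' + s * \<beta>) + 2 * pi * (of_int m - \<beta>) * s"
        by (simp add: algebra_simps)
      have 3: "exp (- (pi * (qform H (ivec k) + (of_int m - \<beta>)\<^sup>2 / a))) = exp (- (pi * qform H (ivec k))) * exp (- (pi * (of_int m - \<beta>)\<^sup>2 / a))"
        by (simp add: distrib_left flip: exp_add)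
      show "c * (of_real (exp (- (pi * (of_int m - \<beta>)\<^sup>2 / a))) * cis (2 * pi * (of_int m - \<beta>) * s))
        = gauss H' (ivec (k(M := m))) * cis (2 * pi * (ivec (k(M := m)) \<bullet> u))"
        unfolding 1 2 3 c_def by (simp add: mult_ac flip: cis_mult)
    qed
    finally show "(\<Sum>\<^sub>\<infinity>n. E n k) = of_real (1 / sqrt a) * (\<Sum>\<^sub>\<infinity>m. gauss H' (ivec (k(M := m))) * cis (2 * pi * (ivec (k(M := m)) \<bullet> u)))" .
  qed
  also have "\<dots> = of_real (1 / sqrt a) * (\<Sum>\<^sub>\<infinity>k\<in>?S. \<Sum>\<^sub>\<infinity>m. gauss H' (ivec (k(M := m))) * cis (2 * pi * (ivec (k(M := m)) \<bullet> u)))"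
    by (rule infsum_cmult_right')
  also have "(\<Sum>\<^sub>\<infinity>k\<in>?S. \<Sum>\<^sub>\<infinity>m. gauss H' (ivec (k(M := m))) * cis (2 * pi * (ivec (k(M := m)) \<bullet> u)))
     = dual_sum H' ?S' u"
  proof -
    define f where "f k = gauss H' (ivec k) * cis (2 * pi * (ivec k \<bullet> u))" for k
    have "(\<lambda>k. exp (- (pi * qform H' (ivec k + 0)))) summable_on ?S'"
      by (intro summable_on_gauss_qform new.H_pos) (auto simp: vec_supported_on_def)
    then have "f summable_on ?S'"
      by - (rule abs_summable_summable, simp add: f_def norm_mult)
    then have "(\<lambda>(n, k). f (k(M := n))) summable_on (UNIV \<times> ?S)"
      unfolding summable_on_reindex_bij_betw[OF bij, symmetric] by (simp add: case_prod_unfold)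
    then have "(\<Sum>\<^sub>\<infinity>n. \<Sum>\<^sub>\<infinity>k\<in>?S. f (k(M := n))) = (\<Sum>\<^sub>\<infinity>(n, k)\<in>UNIV \<times> ?S. f (k(M := n)))"
        "(\<Sum>\<^sub>\<infinity>n. \<Sum>\<^sub>\<infinity>k\<in>?S. f (k(M := n))) = (\<Sum>\<^sub>\<infinity>k\<in>?S. \<Sum>\<^sub>\<infinity>n. f (k(M := n)))"
      by (rule infsum_Sigma'_banach, rule infsum_swap_banach)
    moreover have "(\<Sum>\<^sub>\<infinity>(n, k)\<in>UNIV \<times> ?S. f (k(M := n))) = (\<Sum>\<^sub>\<infinity>k\<in>?S'. f k)"
      unfolding infsum_reindex_bij_betw[OF bij, symmetric] by (simp add: case_prod_unfold)
    ultimately show ?thesis by (simp add: f_def)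
  qed
  also have "of_real (1 / sqrt D) * (of_real (1 / sqrt a) * X) = of_real (1 / sqrt (a * D)) * X" for X :: complex
    by (simp add: real_sqrt_mult)
  finally show ?thesis .
qed

end

text \<open>Induction over the set of coordinates already transformed. For the empty set both sides
  are 1, and each step multiplies the determinant by the Schur complement.\<close>

theorem poisson_gauss:
  fixes W :: "real^'i^'i"
  assumes sym: "transpose W = W" and pos: "\<And>x. x \<noteq> 0 \<Longrightarrow> qform W x > 0"
  obtains H where "W ** H = mat 1" "transpose H = H" "\<And>x. x \<noteq> 0 \<Longrightarrow> qform H x > 0" "det W > 0"
    "\<And>u. gauss_sum W UNIV u =
      of_real (1 / sqrt (det W)) * dual_sum H UNIV u"
proof -
  have "\<exists>H. block_inverse W H J \<and> det (principal_block J W) > 0 \<and> (\<forall>u\<in>vec_supported_on J.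
      gauss_sum W (supported_on J) u =
      of_real (1 / sqrt (det (principal_block J W))) * dual_sum H (supported_on J) u)" for J
    using finite[of J]
  proof (induction J rule: finite_induct)
    case empty
    have 0: "vec_supported_on {} = {0 :: real^'i}" by (auto simp: vec_supported_on_def vec_eq_iff)
    have "block_inverse W 0 {}"
      by unfold_locales (use sym pos 0 in \<open>auto simp: transpose_def zero_vec_def\<close>)
    moreover have "principal_block {} W = mat 1" by (simp add: principal_block_def mat_def vec_eq_iff of_bool_def)
    moreover have "supported_on {} = {\<lambda>_::'i. 0::int}" by (auto simp: supported_on_def)
    moreover have "ivec (\<lambda>_::'i. 0) = 0" by (simp add: vec_eq_iff)
    ultimately show ?case by (intro exI[of _ 0]) (simp add: 0 qform_def)
  next
    case (insert M J)
    then obtain H where H: "block_inverse W H J" and D: "det (principal_block J W) > 0" and IH: "\<And>u. u\<in>vec_supported_on J \<Longrightarrow>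
      gauss_sum W (supported_on J) u =
      of_real (1 / sqrt (det (principal_block J W))) * dual_sum H (supported_on J) u"
      by blast
    interpret block_inverse W H J by (rule H)
    interpret block_inverse_step W H J M by unfold_locales (rule insert.hyps)
    show ?case
      using block_inverse_insert poisson_insert[OF D IH] D a_pos unfolding det_insert[symmetric]
      by (intro exI[of _ H'] conjI ballI) (auto simp: det_insert)
  qed
  from this[of UNIV] obtain H where H: "block_inverse W H UNIV" and D: "det (principal_block UNIV W) > 0" and P: "\<And>u.
      gauss_sum W UNIV u =
      of_real (1 / sqrt (det (principal_block UNIV W))) * dual_sum H UNIV u"
    by auto
  interpret block_inverse W H UNIV by (rule H)
  have pb: "principal_block UNIV W = W" by (simp add: principal_block_def vec_eq_iff)
  show ?thesis
  proof (rule that)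
    show "W ** H = mat 1" using WH by (simp add: vec_eq_iff mat_def of_bool_def)
  qed (use D P[unfolded pb] H_sym H_pos in \<open>auto simp: pb\<close>)
qed

section \<open>Kronecker products\<close>

text \<open>In flattened coordinates the quadratic form of an n-tuple is of this shape: the Gram
  matrix of the lattice in the first factor, the matrix on the tuple index in the second.\<close>

definition kron :: "'a::times^'m^'m \<Rightarrow> 'a^'n^'n \<Rightarrow> 'a^('m::finite \<times> 'n::finite)^('m \<times> 'n)" where
  "kron A B = (\<chi> p q. A $ fst p $ fst q * B $ snd p $ snd q)"

lemma kron_nth [simp]: "kron A B $ (\<mu>, i) $ (\<nu>, j) = A $ \<mu> $ \<nu> * B $ i $ j"
  by (simp add: kron_def)

lemma sum_UNIV_prod: "(\<Sum>p\<in>UNIV. f p) = (\<Sum>x\<in>(UNIV::'a::finite set). \<Sum>y\<in>(UNIV::'b::finite set). f (x, y))"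
  by (simp add: sum.cartesian_product UNIV_Times_UNIV[symmetric] del: UNIV_Times_UNIV)

lemma kron_mult:
  fixes A C :: "'a::comm_semiring_1^'m^'m" and B D :: "'a^'n^'n"
  shows "kron A B ** kron C D = kron (A ** C) (B ** D)"
proof (unfold vec_eq_iff, intro allI)
  fix p q :: "'m \<times> 'n"
  obtain \<mu> i \<nu> j where pq: "p = (\<mu>, i)" "q = (\<nu>, j)" by (cases p, cases q) auto
  have "(kron A B ** kron C D) $ p $ q = (\<Sum>\<rho>\<in>UNIV. \<Sum>l\<in>UNIV. (A $ \<mu> $ \<rho> * C $ \<rho> $ \<nu>) * (B $ i $ l * D $ l $ j))"
    unfolding matrix_matrix_mult_def pq vec_lambda_beta sum_UNIV_prod kron_nth
    by (intro sum.cong refl) (simp only: mult_ac)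
  also have "\<dots> = kron (A ** C) (B ** D) $ p $ q"
    unfolding pq kron_nth by (simp only: matrix_matrix_mult_def vec_lambda_beta sum_product)
  finally show "(kron A B ** kron C D) $ p $ q = kron (A ** C) (B ** D) $ p $ q" .
qed

lemma kron_mat_1: "kron (mat 1) (mat 1) = (mat 1 :: 'a::semiring_1^('m::finite \<times> 'n::finite)^('m \<times> 'n))"
  by (auto simp: vec_eq_iff mat_def kron_def prod_eq_iff)

lemma transpose_kron: "transpose (kron A B) = kron (transpose A) (transpose B)"
  by (simp add: vec_eq_iff transpose_def kron_def)

text \<open>A shear is conjugate to its square by a diagonal matrix, so \<open>f\<close> is 1 on it.\<close>

lemma multiplicative_elementary_matrix:
  fixes f :: "real^'n^'n \<Rightarrow> real"
  assumes f1: "f (mat 1) = 1" and fm: "\<And>A B. f (A ** B) = f A * f B" and mn: "m \<noteq> n"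
  shows "\<bar>f (\<chi> i j. mat 1 $ i $ Transposition.transpose m n j)\<bar> = 1"
    and "f (\<chi> i j. of_bool (i = m \<and> j = n \<or> i = j)) = 1"
proof -
  let ?S = "\<chi> i j. mat 1 $ i $ Transposition.transpose m n j :: real^'n^'n"
  have S: "(?S *v x) $ i = x $ Transposition.transpose m n i" for x i
  proof -
    have "(?S *v x) $ i = (\<Sum>j\<in>UNIV. if j = Transposition.transpose m n i then x $ j else 0)"
      unfolding matrix_vector_mult_def vec_lambda_beta
      by (intro sum.cong refl) (auto simp: mat_def)
    then show ?thesis by simp
  qed
  have "?S ** ?S = mat 1"
    by (simp add: matrix_eq matrix_vector_mul_assoc[symmetric] vec_eq_iff S)
  then have "f ?S * f ?S = 1" using f1 fm[of ?S ?S] by simp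
  then have "f ?S = 1 \<or> f ?S = - 1" by (simp only: square_eq_1_iff)
  then show "\<bar>f ?S\<bar> = 1" by auto
  define e :: "real \<Rightarrow> real^'n^'n" where "e t = (\<chi> i j. of_bool (i = j) + (if i = m \<and> j = n then t else 0))" for t
  define d :: "real \<Rightarrow> real^'n^'n" where "d t = (\<chi> i j. if i = j then (if i = m then t else 1) else 0)" for t
  have e: "(e t *v x) $ i = x $ i + (if i = m then t * x $ n else 0)" for t x i
  proof -
    have "(e t *v x) $ i = (\<Sum>j\<in>UNIV. (if j = i then x $ j else 0) + (if j = n then (if i = m then t * x $ j else 0) else 0))"
      unfolding matrix_vector_mult_def e_def vec_lambda_beta by (intro sum.cong refl) (auto simp: algebra_simps)
    then show ?thesis by (simp add: sum.distrib)
  qed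
  have d: "(d t *v x) $ i = (if i = m then t * x $ i else x $ i)" for t x i
  proof -
    have "(d t *v x) $ i = (\<Sum>j\<in>UNIV. (if j = i then (if i = m then t * x $ i else x $ i) else 0))"
      unfolding matrix_vector_mult_def d_def vec_lambda_beta by (intro sum.cong refl) auto
    then show ?thesis by simp
  qed
  have ee: "e s ** e t = e (s + t)" for s t
    using mn by (simp add: matrix_eq matrix_vector_mul_assoc[symmetric] vec_eq_iff e algebra_simps)
  have dd: "d s ** d t = d (s * t)" for s t
    by (simp add: matrix_eq matrix_vector_mul_assoc[symmetric] vec_eq_iff d algebra_simps)
  have de: "d s ** e t = e (s * t) ** d s" for s t
    using mn by (simp add: matrix_eq matrix_vector_mul_assoc[symmetric] vec_eq_iff d e algebra_simps)
  have e0: "e 0 = mat 1" "d 1 = mat 1"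
    by (simp_all add: matrix_eq vec_eq_iff d e)
  have "f (e 1) * f (e (-1)) = 1" using ee[of 1 "-1"] e0 f1 fm[of "e 1" "e (-1)"] by simp
  then have 1: "f (e 1) \<noteq> 0" by auto
  have "f (d 2) * f (d (1/2)) = 1" using dd[of 2 "1/2"] e0 f1 fm[of "d 2" "d (1/2)"] by simp
  then have 2: "f (d 2) \<noteq> 0" by auto
  have "f (d 2) * f (e 1) = f (e 1) * f (e 1) * f (d 2)"
    using arg_cong[OF de[of 2 1], of f] arg_cong[OF ee[of 1 1], of f] by (simp add: fm)
  then have "f (e 1) = 1" using 1 2 by simp
  moreover have "e 1 = (\<chi> i j. of_bool (i = m \<and> j = n \<or> i = j))"
    using mn by (auto simp: e_def vec_eq_iff)
  ultimately show "f (\<chi> i j. of_bool (i = m \<and> j = n \<or> i = j)) = 1" by simp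
qed

text \<open>Both sides are multiplicative in \<open>A\<close>, which leaves elementary and diagonal
  matrices and matrices with a zero row. Absolute values make the sign of a transposition
  immaterial.\<close>

lemma abs_det_kron_1:
  fixes A :: "real^'n^'n"
  shows "\<bar>det (kron (mat 1 :: real^'m^'m) A)\<bar> = \<bar>det A\<bar> ^ CARD('m)"
proof (induction A rule: induct_matrix_elementary_alt)
  have fm: "det (kron (mat 1 :: real^'m^'m) (A ** B)) = det (kron (mat 1 :: real^'m^'m) A) * det (kron (mat 1 :: real^'m^'m) B)"
    for A B :: "real^'n^'n"
    by (metis det_mul kron_mult matrix_mul_lid)
  have f1: "det (kron (mat 1 :: real^'m^'m) (mat 1 :: real^'n^'n)) = 1"
    by (simp add: kron_mat_1)
  {
    case (1 A B)
    then show ?case by (simp add: fm det_mul abs_mult power_mult_distrib)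
  next
    case (2 A i)
    have "row (\<mu>, i) (kron (mat 1 :: real^'m^'m) A) = 0" for \<mu>
      using 2 by (auto simp: row_def vec_eq_iff)
    then have "det (kron (mat 1 :: real^'m^'m) A) = 0" by (rule det_zero_row(1))
    moreover have "det A = 0" using 2 by (rule det_zero_row(1))
    ultimately show ?case by simp
  next
    case (3 A)
    have "kron (mat 1 :: real^'m^'m) A $ p $ q = 0" if "p \<noteq> q" for p q
      using 3 that by (cases p; cases q) (auto simp: mat_def)
    then have "det (kron (mat 1 :: real^'m^'m) A) = (\<Prod>p\<in>UNIV. kron (mat 1 :: real^'m^'m) A $ p $ p)"
      by (rule det_diagonal)
    also have "\<dots> = (\<Prod>(\<mu>, i)\<in>(UNIV::'m set) \<times> UNIV. A $ i $ i)"
      by (simp add: case_prod_unfold kron_def mat_def)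
    also have "\<dots> = (\<Prod>\<mu>\<in>(UNIV::'m set). \<Prod>i\<in>UNIV. A $ i $ i)"
      by (rule prod.cartesian_product[symmetric])
    also have "\<dots> = det A ^ CARD('m)"
      using det_diagonal[of A] 3 by simp
    finally show ?case by (simp add: power_abs)
  next
    case (4 m n)
    then show ?case
      using multiplicative_elementary_matrix(1)[OF f1 fm 4] multiplicative_elementary_matrix(1)[OF det_I det_mul 4] by simp
  next
    case (5 m n)
    then show ?case
      using multiplicative_elementary_matrix(2)[OF f1 fm 5] multiplicative_elementary_matrix(2)[OF det_I det_mul 5] by simp
  }
qed

section \<open>Theta series of complex quadratic forms\<close>

lemma matrix_inv_invertible:
  assumes "invertible A"
  shows matrix_inv_right: "A ** matrix_inv A = mat 1" and matrix_inv_left: "matrix_inv A ** A = mat 1"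
  using someI_ex[OF assms[unfolded invertible_def]] unfolding matrix_inv_def by blast+

lemma matrix_inv_eqI:
  fixes A B :: "'a::field^'n^'n"
  assumes "A ** B = mat 1"
  shows "matrix_inv A = B"
proof -
  have "B ** A = mat 1" using assms by (simp add: matrix_left_right_inverse)
  then have inv: "invertible A" using assms unfolding invertible_def by blast
  have "matrix_inv A = matrix_inv A ** (A ** B)" by (simp add: assms)
  also have "\<dots> = B" using inv by (simp add: matrix_mul_assoc matrix_inv_left)
  finally show ?thesis .
qed

text \<open>Cramer's rule, in the form needed twice: the entries of an inverse depend
  holomorphically on the matrix, and the determinant clears their denominators.\<close>

lemma matrix_inv_nth_det:
  fixes A :: "'a::field^'n^'n"
  assumes "det A \<noteq> 0"
  shows "matrix_inv A $ i $ j = det (\<chi> a b. if b = i then of_bool (a = j) else A $ a $ b) / det A"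
proof -
  have "invertible A" using assms by (simp add: invertible_det_nz)
  then have "A *v (matrix_inv A *v axis j 1) = axis j 1"
    by (simp add: matrix_vector_mul_assoc matrix_inv_right)
  then have "matrix_inv A *v axis j 1 = (\<chi> k. det (\<chi> a b. if b = k then axis j 1 $ a else A $ a $ b) / det A)"
    by (simp only: cramer[OF assms])
  then have "(matrix_inv A *v axis j 1) $ i = det (\<chi> a b. if b = i then axis j 1 $ a else A $ a $ b) / det A"
    by simp
  moreover have "(matrix_inv A *v axis j 1) $ i = matrix_inv A $ i $ j"
    by (simp add: matrix_vector_mult_def axis_def if_distrib cong: if_cong)
  moreover have "(axis j 1 :: 'a^'n) $ a = of_bool (a = j)" for a by (simp add: axis_def)
  ultimately show ?thesis by (simp cong: if_cong)
qed

lemma holomorphic_on_det: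
  fixes A :: "complex \<Rightarrow> complex^'n^'n"
  assumes "\<And>i j. (\<lambda>z. A z $ i $ j) holomorphic_on D"
  shows "(\<lambda>z. det (A z)) holomorphic_on D"
  unfolding det_def by (intro holomorphic_intros assms)

lemma qform_Re: "qform (map_matrix Re A) v = (\<Sum>i\<in>UNIV. \<Sum>j\<in>UNIV. Re (A $ i $ j) * (v $ i * v $ j))"
  unfolding qform_def inner_vec_def matrix_vector_mult_def map_matrix_def
  by (simp add: sum_distrib_left mult_ac)

lemma qform_sum: "qform A v = (\<Sum>i\<in>UNIV. \<Sum>j\<in>UNIV. A $ i $ j * (v $ i * v $ j))"
  unfolding qform_def inner_vec_def matrix_vector_mult_def
  by (simp add: sum_distrib_left mult_ac)

text \<open>For symmetric \<open>A\<close> the real part of the Hermitian form \<open>w \<mapsto> w* A w\<close> is the form of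
  \<open>Re A\<close> on the real and the imaginary part of \<open>w\<close>; this controls the inverse of \<open>A\<close>.\<close>

lemma Re_hermitian_form:
  fixes A :: "complex^'n^'n"
  assumes sym: "transpose A = A"
  shows "Re (\<Sum>i\<in>UNIV. cnj (w $ i) * (A *v w) $ i) =
    qform (map_matrix Re A) (\<chi> i. Re (w $ i)) + qform (map_matrix Re A) (\<chi> i. Im (w $ i))"
proof -
  have swap: "A $ i $ j = A $ j $ i" for i j
    using sym unfolding transpose_def by (metis vec_lambda_beta)
  \<comment> \<open>The cross terms with \<open>Im A\<close> form a double sum and its transpose
    with opposite signs; by symmetry of \<open>A\<close> they cancel.\<close>
  define I where "I = (\<Sum>i\<in>UNIV. \<Sum>j\<in>UNIV. Im (A $ i $ j) * (Im (w $ i) * Re (w $ j)))"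
  have I: "I = (\<Sum>i\<in>UNIV. \<Sum>j\<in>UNIV. Im (A $ i $ j) * (Re (w $ i) * Im (w $ j)))"
    unfolding I_def by (subst sum.swap) (simp add: swap mult_ac)
  have "Re (\<Sum>i\<in>UNIV. cnj (w $ i) * (A *v w) $ i) = (\<Sum>i\<in>UNIV. \<Sum>j\<in>UNIV. Re (cnj (w $ i) * (A $ i $ j * w $ j)))"
    by (simp add: matrix_vector_mult_def sum_distrib_left Re_sum)
  also have "\<dots> = (\<Sum>i\<in>UNIV. \<Sum>j\<in>UNIV. Re (A $ i $ j) * (Re (w $ i) * Re (w $ j)) + Re (A $ i $ j) * (Im (w $ i) * Im (w $ j))
      + (Im (A $ i $ j) * (Im (w $ i) * Re (w $ j)) - Im (A $ i $ j) * (Re (w $ i) * Im (w $ j))))"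
    by (intro sum.cong refl) (simp add: algebra_simps)
  also have "\<dots> = qform (map_matrix Re A) (\<chi> i. Re (w $ i)) + qform (map_matrix Re A) (\<chi> i. Im (w $ i)) + (I - I)"
    unfolding qform_Re by (subst (2) I, unfold I_def) (simp add: sum.distrib sum_subtractf)
  finally show ?thesis by simp
qed

lemma norm_matrix_vector_mult_le:
  fixes A :: "complex^'n^'n"
  shows "norm (A *v w) \<le> (\<Sum>i\<in>UNIV. \<Sum>j\<in>UNIV. cmod (A $ i $ j)) * norm w"
proof -
  have "norm (A *v w) \<le> (\<Sum>i\<in>UNIV. cmod ((A *v w) $ i))"
    unfolding norm_vec_def by (rule L2_set_le_sum) simp
  also have "\<dots> \<le> (\<Sum>i\<in>UNIV. \<Sum>j\<in>UNIV. cmod (A $ i $ j) * norm w)"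
    unfolding matrix_vector_mult_def vec_lambda_beta
    by (intro sum_mono order_trans[OF norm_sum]) (simp add: norm_mult mult_left_mono component_le_norm_cart Finite_Cartesian_Product.norm_nth_le)
  finally show ?thesis by (simp add: sum_distrib_right)
qed

lemma Re_Im_norm_vec:
  fixes w :: "complex^'n"
  shows "(norm (\<chi> i. Re (w $ i)))\<^sup>2 + (norm (\<chi> i. Im (w $ i)))\<^sup>2 = (norm w)\<^sup>2"
proof -
  have "(norm w)\<^sup>2 = (\<Sum>i\<in>UNIV. (cmod (w $ i))\<^sup>2)"
    unfolding norm_vec_def L2_set_def by (simp add: sum_nonneg)
  also have "\<dots> = (\<Sum>i\<in>UNIV. (Re (w $ i))\<^sup>2 + (Im (w $ i))\<^sup>2)"
    by (simp add: cmod_power2)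
  finally show ?thesis by (simp add: power2_norm_vec sum.distrib)
qed

text \<open>For a kernel vector the Hermitian form vanishes, hence the positive form
  \<open>Re A\<close> vanishes at its real and at its imaginary part.\<close>

lemma det_nonzero_if_Re_pos:
  fixes A :: "complex^'n^'n"
  assumes sym: "transpose A = A" and pos: "\<And>v. v \<noteq> 0 \<Longrightarrow> qform (map_matrix Re A) v > 0"
  shows "det A \<noteq> 0"
proof -
  have q0: "qform (map_matrix Re A) v \<ge> 0" for v
    using pos[of v] by (cases "v = 0") (auto simp: qform_def less_imp_le)
  have "w = 0" if "A *v w = 0" for w
  proof -
    have "qform (map_matrix Re A) (\<chi> i. Re (w $ i)) + qform (map_matrix Re A) (\<chi> i. Im (w $ i)) = 0"
      using Re_hermitian_form[OF sym, of w] that by simp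
    then have "qform (map_matrix Re A) (\<chi> i. Re (w $ i)) = 0" "qform (map_matrix Re A) (\<chi> i. Im (w $ i)) = 0"
      using q0[of "\<chi> i. Re (w $ i)"] q0[of "\<chi> i. Im (w $ i)"] by linarith+
    then have "(\<chi> i. Re (w $ i)) = 0" "(\<chi> i. Im (w $ i)) = 0"
      using pos by (metis less_irrefl)+
    then show "w = 0" by (simp add: vec_eq_iff complex_eq_iff)
  qed
  then obtain B where "B ** A = mat 1" using matrix_left_invertible_ker[of A] by blast
  then have "invertible A" unfolding invertible_def using matrix_left_right_inverse by blast
  then show ?thesis by (simp add: invertible_det_nz)
qed

text \<open>For \<open>w = matrix_inv A *v v\<close> the value on the right is the real part of the
  Hermitian form of \<open>A\<close> at \<open>w\<close>, at least
  \<open>\<epsilon> * (norm w)\<^sup>2\<close>, and \<open>norm v \<le> C * norm w\<close>. The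
  explicit constant makes the bound uniform on small balls of parameters.\<close>

lemma Re_matrix_inv_lower_bound:
  fixes A :: "complex^'n^'n"
  assumes sym: "transpose A = A" and \<epsilon>: "\<epsilon> > 0" "\<And>v. \<epsilon> * (norm v)\<^sup>2 \<le> qform (map_matrix Re A) v"
    and C: "C > 0" "(\<Sum>i\<in>UNIV. \<Sum>j\<in>UNIV. cmod (A $ i $ j)) \<le> C"
  shows "\<epsilon> / C\<^sup>2 * (norm v)\<^sup>2 \<le> qform (map_matrix Re (matrix_inv A)) v"
proof -
  have "qform (map_matrix Re A) v > 0" if "v \<noteq> 0" for v
    using \<epsilon>(2)[of v] \<epsilon>(1) that by (smt (verit) mult_pos_pos zero_less_norm_iff zero_less_power)
  from det_nonzero_if_Re_pos[OF sym this] have inv: "invertible A" by (simp add: invertible_det_nz)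
  define c where "c = (\<chi> i. complex_of_real (v $ i))"
  define w where "w = matrix_inv A *v c"
  have Aw: "A *v w = c" using inv by (simp add: w_def matrix_vector_mul_assoc matrix_inv_right)
  have "norm c = norm v" by (simp add: c_def norm_vec_def)
  then have "norm v \<le> C * norm w"
    using norm_matrix_vector_mult_le[of A w] mult_right_mono[OF C(2), of "norm w"] by (simp add: Aw)
  then have "(norm v)\<^sup>2 \<le> (C * norm w)\<^sup>2" by (intro power_mono) auto
  then have "\<epsilon> / C\<^sup>2 * (norm v)\<^sup>2 \<le> \<epsilon> / C\<^sup>2 * (C * norm w)\<^sup>2" using \<epsilon> by (intro mult_left_mono) auto
  also have "\<dots> = \<epsilon> * (norm w)\<^sup>2" using C by (simp add: power_mult_distrib)
  also have "\<dots> \<le> qform (map_matrix Re A) (\<chi> i. Re (w $ i)) + qform (map_matrix Re A) (\<chi> i. Im (w $ i))"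
    using \<epsilon>(2)[of "\<chi> i. Re (w $ i)"] \<epsilon>(2)[of "\<chi> i. Im (w $ i)"] by (simp add: Re_Im_norm_vec[symmetric] distrib_left)
  also have "\<dots> = Re (\<Sum>i\<in>UNIV. cnj (w $ i) * c $ i)"
    using Re_hermitian_form[OF sym, of w] by (simp add: Aw)
  also have "\<dots> = (\<Sum>i\<in>UNIV. v $ i * Re (w $ i))"
    by (simp add: c_def Re_sum mult.commute)
  also have "\<dots> = qform (map_matrix Re (matrix_inv A)) v"
    unfolding qform_Re w_def c_def matrix_vector_mult_def
    by (simp add: Re_sum sum_distrib_left mult_ac)
  finally show ?thesis .
qed

text \<open>The trace of \<open>A\<close> times the Gram matrix of the tuple \<open>y\<close>, as in
  the exponent of the theta series.\<close>

definition iform :: "complex^'n^'n \<Rightarrow> real^'m^'n \<Rightarrow> complex" where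
  "iform A y = (\<Sum>i\<in>UNIV. \<Sum>j\<in>UNIV. A $ i $ j * of_real (y $ i \<bullet> y $ j))"

text \<open>The form splits over the \<open>m\<close> coordinates of the ambient space; each
  contributes the form of \<open>A\<close> at the vector of the respective coordinates of all
  members of the tuple.\<close>

lemma Re_iform_lower_bound:
  assumes "\<And>v. \<epsilon> * (norm v)\<^sup>2 \<le> qform (map_matrix Re A) v"
  shows "\<epsilon> * (norm y)\<^sup>2 \<le> Re (iform A y)"
proof -
  have "(norm y)\<^sup>2 = (\<Sum>i\<in>UNIV. (norm (y $ i))\<^sup>2)"
    unfolding norm_vec_def[of y] L2_set_def by (simp add: sum_nonneg)
  also have "\<dots> = (\<Sum>i\<in>UNIV. \<Sum>l\<in>UNIV. (y $ i $ l)\<^sup>2)" by (simp only: power2_norm_vec)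
  also have "\<dots> = (\<Sum>l\<in>UNIV. \<Sum>i\<in>UNIV. (y $ i $ l)\<^sup>2)" by (rule sum.swap)
  also have "\<dots> = (\<Sum>l\<in>UNIV. (norm (\<chi> i. y $ i $ l))\<^sup>2)" by (simp add: power2_norm_vec)
  finally have "\<epsilon> * (norm y)\<^sup>2 = (\<Sum>l\<in>UNIV. \<epsilon> * (norm (\<chi> i. y $ i $ l))\<^sup>2)" by (simp add: sum_distrib_left)
  also have "\<dots> \<le> (\<Sum>l\<in>UNIV. qform (map_matrix Re A) (\<chi> i. y $ i $ l))" by (intro sum_mono assms)
  also have "\<dots> = (\<Sum>i\<in>UNIV. \<Sum>j\<in>UNIV. \<Sum>l\<in>UNIV. Re (A $ i $ j) * (y $ i $ l * y $ j $ l))"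
    unfolding qform_Re vec_lambda_beta by (subst sum.swap) (intro sum.cong refl sum.swap)
  also have "\<dots> = Re (iform A y)"
    unfolding iform_def by (simp add: Re_sum inner_vec_def sum_distrib_left)
  finally show ?thesis .
qed

text \<open>A lower bound for the form that is uniform on small balls gives a Weierstrass majorant,
  so the series converges locally uniformly. The coefficients \<open>c v\<close> leave room for
  characters.\<close>

lemma holomorphic_on_theta_series:
  fixes A :: "complex \<Rightarrow> complex^'n^'n" and y :: "'v \<Rightarrow> real^'m^'n"
  assumes D: "open D" and hol: "\<And>i j. (\<lambda>z. A z $ i $ j) holomorphic_on D"
    and c: "\<And>v. cmod (c v) \<le> 1"
    and bound: "\<And>z. z \<in> D \<Longrightarrow> \<exists>r>0. \<exists>\<epsilon>>0. cball z r \<subseteq> D \<and> (\<forall>s\<in>cball z r. \<forall>v. \<epsilon> * (norm v)\<^sup>2 \<le> qform (map_matrix Re (A s)) v)"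
    and summable: "\<And>\<epsilon>. \<epsilon> > 0 \<Longrightarrow> (\<lambda>v. exp (- (pi * \<epsilon> * (norm (y v))\<^sup>2))) summable_on UNIV"
  shows "(\<lambda>z. \<Sum>\<^sub>\<infinity>v. exp (- (of_real pi * iform (A z) (y v))) * c v) holomorphic_on D"
proof -
  define t where "t v z = exp (- (of_real pi * iform (A z) (y v))) * c v" for v z
  have t: "t v holomorphic_on D" for v
    unfolding t_def iform_def by (intro holomorphic_intros hol)
  have "\<exists>r>0. (\<lambda>z. \<Sum>\<^sub>\<infinity>v. t v z) holomorphic_on ball z r" if "z \<in> D" for z
  proof -
    from bound[OF that] obtain r \<epsilon> where r: "r > 0" "\<epsilon> > 0" "cball z r \<subseteq> D"
      "\<And>s v. s \<in> cball z r \<Longrightarrow> \<epsilon> * (norm v)\<^sup>2 \<le> qform (map_matrix Re (A s)) v" by blast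
    have ul: "uniform_limit (cball z r) (\<lambda>X z. \<Sum>v\<in>X. t v z) (\<lambda>z. \<Sum>\<^sub>\<infinity>v. t v z) (finite_subsets_at_top UNIV)"
    proof (rule Weierstrass_m_test_general)
      fix v s assume s: "s \<in> cball z r"
      have "\<epsilon> * (norm (y v))\<^sup>2 \<le> Re (iform (A s) (y v))"
        by (rule Re_iform_lower_bound) (rule r(4)[OF s])
      then have "pi * \<epsilon> * (norm (y v))\<^sup>2 \<le> pi * Re (iform (A s) (y v))"
        by (simp add: mult.assoc)
      then have "cmod (exp (- (of_real pi * iform (A s) (y v)))) \<le> exp (- (pi * \<epsilon> * (norm (y v))\<^sup>2))"
        by (simp add: norm_exp_eq_Re)
      then show "cmod (t v s) \<le> exp (- (pi * \<epsilon> * (norm (y v))\<^sup>2))"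
        unfolding t_def norm_mult using mult_mono[OF _ c[of v]] by fastforce
    qed (rule summable[OF r(2)])
    have ev: "\<forall>\<^sub>F X in finite_subsets_at_top UNIV. continuous_on (cball z r) (\<lambda>z. \<Sum>v\<in>X. t v z) \<and> (\<lambda>z. \<Sum>v\<in>X. t v z) holomorphic_on ball z r"
    proof (intro always_eventually allI)
      fix X
      have "(\<lambda>z. \<Sum>v\<in>X. t v z) holomorphic_on D" by (intro holomorphic_intros t)
      then show "continuous_on (cball z r) (\<lambda>z. \<Sum>v\<in>X. t v z) \<and> (\<lambda>z. \<Sum>v\<in>X. t v z) holomorphic_on ball z r"
        using r(3) ball_subset_cball[of z r]
        by (meson continuous_on_subset holomorphic_on_imp_continuous_on holomorphic_on_subset subset_trans)
    qed
    have "(\<lambda>z. \<Sum>\<^sub>\<infinity>v. t v z) holomorphic_on ball z r"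
      by (rule holomorphic_uniform_limit[OF ev ul]) simp_all
    then show ?thesis using r(1) by blast
  qed
  then have "(\<lambda>z. \<Sum>\<^sub>\<infinity>v. t v z) analytic_on D"
    unfolding analytic_on_def by blast
  then show ?thesis unfolding t_def by (rule analytic_imp_holomorphic)
qed

section \<open>Dual bases and flattened coordinates of tuples\<close>

definition dual_basis :: "real^'m^'m \<Rightarrow> real^'m^'m" where
  "dual_basis B = transpose (matrix_inv B)"

lemma gram_eq: "gram B = B ** transpose B"
  by (simp add: gram_def matrix_matrix_mult_def transpose_def inner_vec_def vec_eq_iff)

lemma transpose_gram: "transpose (gram B) = gram B"
  by (simp add: gram_def transpose_def inner_commute vec_eq_iff)

lemma inner_dual_basis:
  assumes "det B \<noteq> 0"
  shows "B $ \<mu> \<bullet> dual_basis B $ \<nu> = of_bool (\<mu> = \<nu>)"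
proof -
  have "B $ \<mu> \<bullet> dual_basis B $ \<nu> = (B ** matrix_inv B) $ \<mu> $ \<nu>"
    by (simp add: dual_basis_def matrix_matrix_mult_def transpose_def inner_vec_def)
  also have "\<dots> = of_bool (\<mu> = \<nu>)"
    using assms by (simp add: matrix_inv_right invertible_det_nz mat_def)
  finally show ?thesis .
qed

lemma det_dual_basis: "det B \<noteq> 0 \<Longrightarrow> det (dual_basis B) \<noteq> 0"
  by (metis det_I det_mul det_transpose dual_basis_def invertible_det_nz matrix_inv_right mult_zero_right zero_neq_one)

lemma gram_mult_dual:
  assumes "det B \<noteq> 0"
  shows "gram B ** gram (dual_basis B) = mat 1"
proof -
  have inv: "invertible B" using assms by (simp add: invertible_det_nz)
  have "transpose B ** transpose (matrix_inv B) = mat 1"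
    using matrix_inv_left[OF inv] by (simp add: transpose_mat flip: matrix_transpose_mul)
  then have "gram B ** gram (dual_basis B) = B ** matrix_inv B"
    unfolding gram_eq dual_basis_def transpose_transpose
    by (metis matrix_mul_assoc matrix_mul_lid)
  then show ?thesis using matrix_inv_right[OF inv] by simp
qed

lemma matrix_inv_gram: "det B \<noteq> 0 \<Longrightarrow> matrix_inv (gram B) = gram (dual_basis B)"
  by (intro matrix_inv_eqI gram_mult_dual)

definition lat :: "real^'m^'m \<Rightarrow> real^('m::finite \<times> 'n::finite) \<Rightarrow> real^'m^'n" where
  "lat B x = (\<chi> i. \<Sum>\<mu>\<in>UNIV. x $ (\<mu>, i) *\<^sub>R B $ \<mu>)"

lemma linear_lat: "linear (lat B)"
  by (rule linearI) (simp_all add: lat_def vec_eq_iff scaleR_add_left sum.distrib sum_distrib_left algebra_simps)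

lemma iform_lat:
  "iform (map_matrix of_real Y) (lat B x) = of_real (qform (kron (gram B) Y) x)"
proof -
  have "lat B x $ i \<bullet> lat B x $ j = (\<Sum>\<mu>\<in>UNIV. \<Sum>\<nu>\<in>UNIV. gram B $ \<mu> $ \<nu> * (x $ (\<mu>, i) * x $ (\<nu>, j)))" for i j
    by (subst sum.swap) (simp add: lat_def inner_sum_left inner_sum_right gram_def sum_distrib_left mult_ac)
  then have "(\<Sum>i\<in>UNIV. \<Sum>j\<in>UNIV. Y $ i $ j * (lat B x $ i \<bullet> lat B x $ j))
     = (\<Sum>i\<in>UNIV. \<Sum>j\<in>UNIV. \<Sum>\<mu>\<in>UNIV. \<Sum>\<nu>\<in>UNIV. gram B $ \<mu> $ \<nu> * Y $ i $ j * (x $ (\<mu>, i) * x $ (\<nu>, j)))"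
    by (simp add: sum_distrib_left mult_ac)
  also have "\<dots> = (\<Sum>i\<in>UNIV. \<Sum>\<mu>\<in>UNIV. \<Sum>j\<in>UNIV. \<Sum>\<nu>\<in>UNIV. gram B $ \<mu> $ \<nu> * Y $ i $ j * (x $ (\<mu>, i) * x $ (\<nu>, j)))"
    by (intro sum.cong refl sum.swap)
  also have "\<dots> = (\<Sum>\<mu>\<in>UNIV. \<Sum>i\<in>UNIV. \<Sum>\<nu>\<in>UNIV. \<Sum>j\<in>UNIV. gram B $ \<mu> $ \<nu> * Y $ i $ j * (x $ (\<mu>, i) * x $ (\<nu>, j)))"
    by (subst sum.swap) (intro sum.cong refl sum.swap)
  also have "\<dots> = qform (kron (gram B) Y) x"
    unfolding qform_sum sum_UNIV_prod kron_nth ..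
  finally show ?thesis
    unfolding iform_def map_matrix_def by (simp flip: of_real_mult of_real_sum)
qed

text \<open>Pairing with the dual basis recovers the coordinates, so \<open>lat B\<close> is
  injective, and an injective linear map is bounded below.\<close>

lemma lat_lower_bound:
  assumes "det B \<noteq> 0"
  obtains \<delta> where "\<delta> > 0" "\<And>x. \<delta> * (norm x)\<^sup>2 \<le> (norm (lat B x :: real^'m^'n))\<^sup>2"
proof -
  have "inj (lat B :: real^('m \<times> 'n) \<Rightarrow> real^'m^'n)"
  proof (subst linear_injective_0[OF linear_lat], intro allI impI)
    fix x :: "real^('m \<times> 'n)" assume x: "lat B x = 0"
    have "x $ (\<nu>, i) = lat B x $ i \<bullet> dual_basis B $ \<nu>" for \<nu> i
      by (simp add: lat_def inner_sum_left inner_dual_basis[OF assms] of_bool_def if_distrib cong: if_cong)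
    then show "x = 0" by (simp add: x vec_eq_iff)
  qed
  from linear_inj_bounded_below_pos[OF linear_lat this] obtain e where e: "e > 0" "\<And>x. e * norm x \<le> norm (lat B x :: real^'m^'n)"
    by blast
  show ?thesis
  proof (rule that)
    show "e\<^sup>2 > 0" using e by simp
    show "e\<^sup>2 * (norm x)\<^sup>2 \<le> (norm (lat B x :: real^'m^'n))\<^sup>2" for x
      using power_mono[OF e(2)[of x], of 2] e(1) by (simp add: power_mult_distrib)
  qed
qed

lemma summable_on_gauss_lat:
  fixes u :: "real^('m::finite \<times> 'n::finite)"
  assumes "det B \<noteq> 0" "\<epsilon> > 0"
  shows "(\<lambda>v. exp (- (pi * \<epsilon> * (norm (lat B (ivec v + u)))\<^sup>2))) summable_on UNIV"
proof -
  obtain \<delta> where \<delta>: "\<delta> > 0" "\<And>x. \<delta> * (norm x)\<^sup>2 \<le> (norm (lat B x :: real^'m^'n))\<^sup>2"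
    using lat_lower_bound[OF assms(1)] by metis
  have "pi * \<epsilon> * \<delta> > 0" using assms \<delta> by simp
  from summable_on_gauss_norm[OF this] show ?thesis
  proof (rule summable_on_comparison_test)
    fix v :: "'m \<times> 'n \<Rightarrow> int"
    have "pi * \<epsilon> * (\<delta> * (norm (ivec v + u))\<^sup>2) \<le> pi * \<epsilon> * (norm (lat B (ivec v + u)))\<^sup>2"
      using assms by (intro mult_left_mono \<delta>) auto
    then show "exp (- (pi * \<epsilon> * (norm (lat B (ivec v + u)))\<^sup>2)) \<le> exp (- (pi * \<epsilon> * \<delta> * (norm (ivec v + u))\<^sup>2))"
      by (simp add: mult.assoc)
  qed auto
qed

lemma map_matrix_Re_of_real [simp]: "map_matrix Re (map_matrix of_real Y) = Y"
  by (simp add: map_matrix_def vec_eq_iff)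

lemma qform_kron_gram_pos:
  fixes Y :: "real^'n^'n" and x :: "real^('m::finite \<times> 'n::finite)"
  assumes "det B \<noteq> 0" "\<And>v. v \<noteq> 0 \<Longrightarrow> qform Y v > 0" "x \<noteq> 0"
  shows "qform (kron (gram B) Y) x > 0"
proof -
  obtain \<epsilon> where \<epsilon>: "\<epsilon> > 0" "\<And>v. \<epsilon> * (norm v)\<^sup>2 \<le> qform Y v"
    using qform_lower_bound[of UNIV Y] assms(2) by auto
  obtain \<delta> where \<delta>: "\<delta> > 0" "\<And>x. \<delta> * (norm x)\<^sup>2 \<le> (norm (lat B x :: real^'m^'n))\<^sup>2"
    using lat_lower_bound[OF assms(1)] by metis
  have "0 < \<epsilon> * (\<delta> * (norm x)\<^sup>2)" using \<epsilon> \<delta> assms(3) by simp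
  also have "\<dots> \<le> \<epsilon> * (norm (lat B x))\<^sup>2" using \<epsilon> \<delta> by (intro mult_left_mono) auto
  also have "\<dots> \<le> Re (iform (map_matrix of_real Y) (lat B x))"
    by (rule Re_iform_lower_bound) (simp add: \<epsilon>)
  finally show ?thesis by (simp add: iform_lat)
qed

text \<open>The general formula for the form \<open>kron (gram B) (matrix_inv Y)\<close>, whose
  inverse is \<open>kron (gram (dual_basis B)) Y\<close>. The determinant of the factor with
  \<open>gram B\<close> is left unevaluated, as it only enters the constant.\<close>

lemma poisson_theta_real:
  fixes B :: "real^'m^'m" and Y :: "real^'n^'n"
  assumes m: "CARD('m) = 2 * k" and B: "det B \<noteq> 0"
    and sym: "transpose Y = Y" and pos: "\<And>v. v \<noteq> 0 \<Longrightarrow> qform Y v > 0"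
  shows "(\<Sum>\<^sub>\<infinity>v. exp (- (of_real pi * iform (matrix_inv (map_matrix of_real Y)) (lat B (ivec v + u))))) =
    of_real (1 / sqrt \<bar>det (kron (gram B) (mat 1 :: real^'n^'n))\<bar>) * det (map_matrix of_real Y) ^ k *
    (\<Sum>\<^sub>\<infinity>w. exp (- (of_real pi * iform (map_matrix of_real Y) (lat (dual_basis B) (ivec w)))) * cis (2 * pi * (ivec w \<bullet> u)))"
proof -
  obtain Yi where Yi: "Y ** Yi = mat 1" "transpose Yi = Yi" "\<And>x. x \<noteq> 0 \<Longrightarrow> qform Yi x > 0" and dY: "det Y > 0"
    by (rule poisson_gauss[OF sym pos]) blast+
  define W where "W = kron (gram B) Yi"
  have W: "transpose W = W" "\<And>x. x \<noteq> 0 \<Longrightarrow> qform W x > 0"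
    by (auto simp: W_def transpose_kron transpose_gram Yi intro!: qform_kron_gram_pos[OF B Yi(3)])
  obtain H where H: "W ** H = mat 1" "det W > 0" and P: "\<And>u. gauss_sum W UNIV u =
      of_real (1 / sqrt (det W)) * dual_sum H UNIV u"
    by (rule poisson_gauss[OF W]) blast+
  have YiY: "Yi ** Y = mat 1" using Yi(1) by (simp add: matrix_left_right_inverse)
  have "W ** kron (gram (dual_basis B)) Y = mat 1"
    unfolding W_def kron_mult gram_mult_dual[OF B] YiY by (rule kron_mat_1)
  then have Heq: "H = kron (gram (dual_basis B)) Y"
    using matrix_inv_eqI[OF H(1)] by (simp add: matrix_inv_eqI)
  have mm: "map_matrix of_real (A ** A') = (map_matrix of_real A ** map_matrix of_real A' :: complex^'n^'n)" for A A' :: "real^'n^'n"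
    by (simp add: map_matrix_def matrix_matrix_mult_def vec_eq_iff)
  have m1: "map_matrix of_real (mat 1 :: real^'n^'n) = (mat 1 :: complex^'n^'n)"
    by (simp add: map_matrix_def mat_def vec_eq_iff)
  have inv: "matrix_inv (map_matrix of_real Y :: complex^'n^'n) = map_matrix of_real Yi"
    by (rule matrix_inv_eqI) (simp add: Yi(1) m1 flip: mm)
  have detc: "det (map_matrix of_real Y :: complex^'n^'n) = of_real (det Y)"
    unfolding det_def map_matrix_def by simp
  have dYi: "det Yi = 1 / det Y"
    using arg_cong[OF Yi(1), of det] dY by (simp add: det_mul field_simps)
  have "W = kron (gram B) (mat 1) ** kron (mat 1) Yi" by (simp add: W_def kron_mult)
  then have "\<bar>det W\<bar> = \<bar>det (kron (gram B) (mat 1 :: real^'n^'n))\<bar> * (1 / det Y) ^ (2 * k)"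
    using dY by (simp add: det_mul abs_mult abs_det_kron_1 m dYi)
  \<comment> \<open>Positivity of \<open>det W\<close> removes the absolute value, and since the
    rank is even the power of \<open>det Y\<close> is a square; its root is the integral power
    wanted.\<close>
  then have "det W = \<bar>det (kron (gram B) (mat 1 :: real^'n^'n))\<bar> * ((1 / det Y) ^ k)\<^sup>2"
    using H(2) by (simp add: power_mult mult.commute[of 2])
  then have "1 / sqrt (det W) = 1 / sqrt \<bar>det (kron (gram B) (mat 1 :: real^'n^'n))\<bar> * det Y ^ k"
    using dY by (simp add: real_sqrt_divide power_one_over)
  then show ?thesis
    using P[of u] unfolding inv iform_lat Heq detc W_def
    by (simp flip: of_real_power of_real_mult of_real_minus exp_of_real)
qed

lemma abs_qform_le:
  fixes X :: "real^'n^'n"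
  shows "\<bar>qform X v\<bar> \<le> (\<Sum>i\<in>UNIV. \<Sum>j\<in>UNIV. \<bar>X $ i $ j\<bar>) * (norm v)\<^sup>2"
proof -
  have "\<bar>qform X v\<bar> \<le> (\<Sum>i\<in>UNIV. \<Sum>j\<in>UNIV. \<bar>X $ i $ j * (v $ i * v $ j)\<bar>)"
    unfolding qform_sum by (intro order_trans[OF sum_abs] sum_mono sum_abs)
  also have "\<dots> \<le> (\<Sum>i\<in>UNIV. \<Sum>j\<in>UNIV. \<bar>X $ i $ j\<bar> * (norm v)\<^sup>2)"
  proof (intro sum_mono)
    fix i j
    have "\<bar>v $ i\<bar> * \<bar>v $ j\<bar> \<le> norm v * norm v" by (intro mult_mono component_le_norm_cart) auto
    then show "\<bar>X $ i $ j * (v $ i * v $ j)\<bar> \<le> \<bar>X $ i $ j\<bar> * (norm v)\<^sup>2"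
      by (simp add: abs_mult mult_left_mono power2_eq_square)
  qed
  finally show ?thesis by (simp add: sum_distrib_right)
qed

text \<open>Both sides are holomorphic on a strip of matrices \<open>Y - \<i> z X\<close> containing the given matrix
  at \<open>z = 1\<close>, and for imaginary \<open>z\<close> they agree by the real case.\<close>

theorem poisson_theta:
  fixes B :: "real^'m^'m" and \<Omega> :: "complex^'n^'n"
  assumes m: "CARD('m) = 2 * k" and B: "det B \<noteq> 0"
    and sym: "transpose \<Omega> = \<Omega>" and pos: "\<And>v. v \<noteq> 0 \<Longrightarrow> qform (map_matrix Re \<Omega>) v > 0"
  shows "(\<Sum>\<^sub>\<infinity>v. exp (- (of_real pi * iform (matrix_inv \<Omega>) (lat B (ivec v + u))))) =
    of_real (1 / sqrt \<bar>det (kron (gram B) (mat 1 :: real^'n^'n))\<bar>) * det \<Omega> ^ k *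
    (\<Sum>\<^sub>\<infinity>w. exp (- (of_real pi * iform \<Omega> (lat (dual_basis B) (ivec w)))) * cis (2 * pi * (ivec w \<bullet> u)))"
proof -
  define Y where "Y = map_matrix Re \<Omega>"
  define X where "X = - map_matrix Im \<Omega>"
  define A :: "complex \<Rightarrow> complex^'n^'n" where "A z = (\<chi> i j. of_real (Y $ i $ j) - \<i> * z * of_real (X $ i $ j))" for z
  have swap: "\<Omega> $ i $ j = \<Omega> $ j $ i" for i j
    using sym unfolding transpose_def by (metis vec_lambda_beta)
  have Asym: "transpose (A z) = A z" for z
    by (simp add: A_def Y_def X_def transpose_def map_matrix_def vec_eq_iff swap[of _ _])
  have A1: "A 1 = \<Omega>" by (simp add: A_def Y_def X_def map_matrix_def vec_eq_iff complex_eq_iff)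
  have ReA: "qform (map_matrix Re (A z)) v = qform Y v + Im z * qform X v" for z v
    unfolding qform_sum A_def map_matrix_def
    by (simp add: algebra_simps sum.distrib sum_distrib_left)
  obtain e where e: "e > 0" "\<And>v. e * (norm v)\<^sup>2 \<le> qform Y v"
    using qform_lower_bound[of UNIV Y] pos unfolding Y_def by auto
  define M where "M = (\<Sum>i\<in>UNIV. \<Sum>j\<in>UNIV. \<bar>X $ i $ j\<bar>)"
  have M: "M \<ge> 0" by (simp add: M_def sum_nonneg)
  \<comment> \<open>This width makes \<open>Im z * qform X v\<close> at most half of the lower bound
    for \<open>Y\<close>; the summand 1 covers \<open>X = 0\<close>.\<close>
  define r where "r = e / (2 * (M + 1))"
  have r: "r > 0" "r * M \<le> e / 2" using e M by (auto simp: r_def field_simps)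
  define D where "D = {z. \<bar>Im z\<bar> < r}"
  have lower: "e / 2 * (norm v)\<^sup>2 \<le> qform (map_matrix Re (A z)) v" if "z \<in> D" for z v
  proof -
    have "\<bar>Im z * qform X v\<bar> \<le> r * (M * (norm v)\<^sup>2)"
      unfolding abs_mult using that abs_qform_le[of X v] r M by (intro mult_mono) (auto simp: D_def M_def)
    also have "\<dots> \<le> e / 2 * (norm v)\<^sup>2"
      using mult_right_mono[OF r(2), of "(norm v)\<^sup>2"] by (simp add: mult.assoc)
    finally show ?thesis unfolding ReA using e(2)[of v] by (simp add: abs_le_iff)
  qed
  have pos': "qform (map_matrix Re (A z)) v > 0" if "z \<in> D" "v \<noteq> 0" for z v
    using less_le_trans[OF _ lower[OF that(1), of v]] e(1) that(2) by simp
  have detA: "det (A z) \<noteq> 0" if "z \<in> D" for z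
    using det_nonzero_if_Re_pos[OF Asym pos'[OF that]] by blast
  have D: "open D" "connected D"
  proof -
    have D_eq: "D = {z. Im z < r} \<inter> {z. Im z > - r}" by (auto simp: D_def)
    show "open D" unfolding D_eq by (intro open_Int open_halfspace_Im_lt open_halfspace_Im_gt)
    have "convex D" unfolding D_eq by (intro convex_Int convex_halfspace_Im_lt convex_halfspace_Im_gt)
    then show "connected D" by (rule convex_connected)
  qed
  have Ahol: "(\<lambda>z. A z $ i $ j) holomorphic_on D" for i j
    unfolding A_def by (simp, intro holomorphic_intros)
  have Aihol: "(\<lambda>z. matrix_inv (A z) $ i $ j) holomorphic_on D" for i j
  proof -
    have "(\<lambda>z. (if b = i then of_bool (a = j) else A z $ a $ b)) holomorphic_on D" for a b
      by (cases "b = i") (simp_all add: Ahol)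
    then have "(\<lambda>z. det (\<chi> a b. if b = i then of_bool (a = j) else A z $ a $ b)) holomorphic_on D"
      by (intro holomorphic_on_det) simp
    then have "(\<lambda>z. det (\<chi> a b. if b = i then of_bool (a = j) else A z $ a $ b) / det (A z)) holomorphic_on D"
      by (rule holomorphic_on_divide) (intro holomorphic_on_det Ahol, rule detA)
    then show ?thesis
      by (rule holomorphic_transform) (simp add: matrix_inv_nth_det[OF detA])
  qed
  \<comment> \<open>The factor 1 here and the summand 0 in \<open>G\<close> bring both series into
    the form of \<open>holomorphic_on_theta_series\<close> and
    \<open>summable_on_gauss_lat\<close>.\<close>
  define F where "F z = (\<Sum>\<^sub>\<infinity>v. exp (- (of_real pi * iform (matrix_inv (A z)) (lat B (ivec v + u)))) * 1)" for z
  define G where "G z = (\<Sum>\<^sub>\<infinity>w. exp (- (of_real pi * iform (A z) (lat (dual_basis B) (ivec w + 0)))) * cis (2 * pi * (ivec w \<bullet> u)))" for z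
  define q where "q = complex_of_real (1 / sqrt \<bar>det (kron (gram B) (mat 1 :: real^'n^'n))\<bar>)"
  have "F holomorphic_on D" unfolding F_def
  proof (rule holomorphic_on_theta_series[OF D(1) Aihol])
    fix z assume z: "z \<in> D"
    obtain \<rho> where \<rho>: "\<rho> > 0" "cball z \<rho> \<subseteq> D" using D(1) z by (auto simp: open_contains_cball)
    \<comment> \<open>\<open>C\<close> bounds the sum of the moduli of the entries of
      \<open>A s\<close> for all \<open>s\<close> in the ball, as needed for a uniform bound on the
      inverses; the summand 1 keeps it positive.\<close>
    define C where "C = 1 + (\<Sum>i\<in>UNIV. \<Sum>j\<in>UNIV. \<bar>Y $ i $ j\<bar> + (cmod z + \<rho>) * \<bar>X $ i $ j\<bar>)"
    have C: "C > 0" unfolding C_def using \<rho>(1) by (intro add_pos_nonneg sum_nonneg add_nonneg_nonneg mult_nonneg_nonneg) auto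
    have "e / 2 / C\<^sup>2 * (norm v)\<^sup>2 \<le> qform (map_matrix Re (matrix_inv (A s))) v" if s: "s \<in> cball z \<rho>" for s v
    proof (rule Re_matrix_inv_lower_bound[OF Asym _ _ C])
      have sn: "cmod s \<le> cmod z + \<rho>"
        using s norm_triangle_sub[of s z] by (simp add: dist_norm norm_minus_commute)
      have "cmod (A s $ i $ j) \<le> \<bar>Y $ i $ j\<bar> + (cmod z + \<rho>) * \<bar>X $ i $ j\<bar>" for i j
      proof -
        have "cmod (A s $ i $ j) \<le> \<bar>Y $ i $ j\<bar> + cmod s * \<bar>X $ i $ j\<bar>"
          unfolding A_def using norm_triangle_ineq4[of "complex_of_real (Y $ i $ j)" "\<i> * s * of_real (X $ i $ j)"] by (simp add: norm_mult)
        also have "\<dots> \<le> \<bar>Y $ i $ j\<bar> + (cmod z + \<rho>) * \<bar>X $ i $ j\<bar>"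
          by (intro add_left_mono mult_right_mono sn) simp
        finally show ?thesis .
      qed
      then have "(\<Sum>i\<in>UNIV. \<Sum>j\<in>UNIV. cmod (A s $ i $ j)) \<le> (\<Sum>i\<in>UNIV. \<Sum>j\<in>UNIV. \<bar>Y $ i $ j\<bar> + (cmod z + \<rho>) * \<bar>X $ i $ j\<bar>)"
        by (intro sum_mono)
      then show "(\<Sum>i\<in>UNIV. \<Sum>j\<in>UNIV. cmod (A s $ i $ j)) \<le> C" by (simp add: C_def)
    qed (use e lower s \<rho>(2) in auto)
    moreover have "e / 2 / C\<^sup>2 > 0" using e C by simp
    ultimately show "\<exists>\<rho>>0. \<exists>\<epsilon>>0. cball z \<rho> \<subseteq> D \<and> (\<forall>s\<in>cball z \<rho>. \<forall>v. \<epsilon> * (norm v)\<^sup>2 \<le> qform (map_matrix Re (matrix_inv (A s))) v)"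
      using \<rho> by blast
  qed (auto intro: summable_on_gauss_lat[OF B])
  moreover have "G holomorphic_on D" unfolding G_def
  proof (rule holomorphic_on_theta_series[OF D(1) Ahol])
    fix z assume z: "z \<in> D"
    obtain \<rho> where \<rho>: "\<rho> > 0" "cball z \<rho> \<subseteq> D" using D(1) z by (auto simp: open_contains_cball)
    moreover have "\<forall>s\<in>cball z \<rho>. \<forall>v. e / 2 * (norm v)\<^sup>2 \<le> qform (map_matrix Re (A s)) v"
      using lower \<rho>(2) by blast
    moreover have "e / 2 > 0" using e by simp
    ultimately show "\<exists>\<rho>>0. \<exists>\<epsilon>>0. cball z \<rho> \<subseteq> D \<and> (\<forall>s\<in>cball z \<rho>. \<forall>v. \<epsilon> * (norm v)\<^sup>2 \<le> qform (map_matrix Re (A s)) v)"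
      by blast
  qed (auto intro: summable_on_gauss_lat[OF det_dual_basis[OF B]] simp del: add_0_right)
  ultimately have hol: "(\<lambda>z. F z - q * det (A z) ^ k * G z) holomorphic_on D"
    by (intro holomorphic_intros holomorphic_on_det Ahol)
  define U where "U = (\<lambda>t. \<i> * complex_of_real t) ` {-r<..<r}"
  have "F 1 - q * det (A 1) ^ k * G 1 = 0"
  proof (rule analytic_continuation[OF hol D])
    show "U \<subseteq> D" by (auto simp: U_def D_def)
    show "0 \<in> D" "1 \<in> D" using r by (auto simp: D_def)
    show "0 islimpt U"
      unfolding islimpt_approachable
    proof (intro allI impI)
      fix d :: real assume d: "d > 0"
      have "\<i> * complex_of_real (min r d / 2) \<in> U" unfolding U_def using r d by (intro imageI) auto
      moreover have "dist (\<i> * complex_of_real (min r d / 2)) 0 < d" using r d by (simp add: norm_mult)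
      moreover have "\<i> * complex_of_real (min r d / 2) \<noteq> 0" using r d by simp
      ultimately show "\<exists>x'\<in>U. x' \<noteq> 0 \<and> dist x' 0 < d" by blast
    qed
    fix z assume "z \<in> U"
    then obtain t where t: "z = \<i> * complex_of_real t" "-r < t" "t < r" by (auto simp: U_def)
    then have zD: "z \<in> D" by (simp add: D_def)
    define Y' where "Y' = Y + t *\<^sub>R X"
    have Az: "A z = map_matrix of_real Y'"
      by (simp add: A_def t Y'_def map_matrix_def vec_eq_iff algebra_simps)
    have "transpose Y' = Y'"
      by (simp add: Y'_def Y_def X_def transpose_def map_matrix_def vec_eq_iff swap[of _ _])
    moreover have "qform Y' v > 0" if "v \<noteq> 0" for v
      using pos'[OF zD that] by (simp add: Az)
    ultimately have "F z = q * det (A z) ^ k * G z"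
      unfolding F_def G_def q_def Az using poisson_theta_real[OF m B, of Y' u] by simp
    then show "F z - q * det (A z) ^ k * G z = 0" by simp
  qed
  then show ?thesis unfolding A1 F_def G_def q_def by simp
qed

section \<open>The p-adic numbers\<close>

text \<open>Frees the absolute value from the reduced fraction of its definition: cross-multiplying
  two fractions for the same number equates the differences of multiplicities.\<close>

lemma padic_abs_divide:
  assumes p: "prime p" and ab: "a \<noteq> 0" "b \<noteq> 0"
  shows "padic_abs p (of_int a / of_int b) = real p powi (int (multiplicity (int p) b) - int (multiplicity (int p) a))"
proof -
  obtain n d where q: "quotient_of (of_int a / of_int b) = (n, d)" by fastforce
  have d: "d > 0" using quotient_of_denom_pos[OF q] .
  have eq: "(of_int a / of_int b :: rat) = of_int n / of_int d" using quotient_of_div[OF q] .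
  have n: "n \<noteq> 0" using eq ab d by auto
  have "(of_int (a * d) :: rat) = of_int (n * b)"
    using eq ab d by (simp add: field_simps)
  then have "a * d = n * b" by (simp only: of_int_eq_iff)
  then have "multiplicity (int p) a + multiplicity (int p) d = multiplicity (int p) n + multiplicity (int p) b"
    using p ab d n by (metis less_irrefl prime_elem_multiplicity_mult_distrib prime_imp_prime_elem prime_int_nat_transfer nat_int prime_nat_int_transfer)
  then have "int (multiplicity (int p) d) - int (multiplicity (int p) n) = int (multiplicity (int p) b) - int (multiplicity (int p) a)"
    by linarith
  then show ?thesis unfolding padic_abs_def using ab by (simp add: q)
qed

lemma rat_divide_cases:
  obtains a b where "r = (of_int a / of_int b :: rat)" "b \<noteq> 0" "coprime a b"
  by (metis less_irrefl quotient_of_coprime quotient_of_denom_pos quotient_of_div surj_pair)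

lemma padic_abs_0 [simp]: "padic_abs p 0 = 0"
  by (simp add: padic_abs_def)

lemma padic_abs_nonneg [simp]: "padic_abs p r \<ge> 0"
  by (simp add: padic_abs_def)

lemma padic_abs_1 [simp]: "padic_abs p 1 = 1"
  by (simp add: padic_abs_def)

lemma padic_abs_mult:
  assumes p: "prime p"
  shows "padic_abs p (r * s) = padic_abs p r * padic_abs p s"
proof (cases "r = 0 \<or> s = 0")
  case False
  obtain a b where r: "r = of_int a / of_int b" "b \<noteq> 0" by (rule rat_divide_cases)
  obtain c d where s: "s = of_int c / of_int d" "d \<noteq> 0" by (rule rat_divide_cases)
  have ac: "a \<noteq> 0" "c \<noteq> 0" using False r s by auto
  have "r * s = of_int (a * c) / of_int (b * d)" by (simp add: r s)
  moreover have p0: "real p \<noteq> 0" using p prime_gt_0_nat by fastforce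
  moreover have "prime_elem (int p)" using p by simp
  ultimately show ?thesis
    using r(2) s(2) ac
    by (simp add: padic_abs_divide[OF p] r(1) s(1) prime_elem_multiplicity_mult_distrib power_int_add[symmetric] del: of_int_mult)
       (simp add: algebra_simps)
qed auto

lemma padic_abs_minus [simp]: "padic_abs p (- r) = padic_abs p r"
  using multiplicity_cong[of "int p" "- fst (quotient_of r)" "fst (quotient_of r)"]
  by (cases "r = 0") (auto simp: padic_abs_def rat_uminus_code case_prod_unfold Let_def)

text \<open>Only divisibility of the numerator is used, so a vanishing numerator is covered; the
  ultrametric inequality needs this for sums that cancel.\<close>

lemma padic_abs_le_powi:
  assumes p: "prime p" and "b \<noteq> 0" and "int p ^ k dvd a"
  shows "padic_abs p (of_int a / of_int b) \<le> real p powi (int (multiplicity (int p) b) - int k)"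
proof (cases "a = 0")
  case False
  then have "multiplicity (int p) a \<ge> k"
    using assms p by (intro multiplicity_geI) (auto dest: prime_gt_1_nat)
  then show ?thesis
    using False assms prime_gt_1_nat[OF p] by (auto simp: padic_abs_divide[OF p] intro!: power_int_increasing)
qed simp

lemma padic_abs_add:
  assumes p: "prime p"
  shows "padic_abs p (r + s) \<le> max (padic_abs p r) (padic_abs p s)"
proof (cases "r = 0 \<or> s = 0")
  case False
  obtain a b where r: "r = of_int a / of_int b" "b \<noteq> 0" by (rule rat_divide_cases)
  obtain c d where s: "s = of_int c / of_int d" "d \<noteq> 0" by (rule rat_divide_cases)
  have ac: "a \<noteq> 0" "c \<noteq> 0" using False r s by auto
  define x y z where "x = a * d" and "y = c * b" and "z = b * d"
  have xyz: "x \<noteq> 0" "y \<noteq> 0" "z \<noteq> 0" using r s ac by (auto simp: x_def y_def z_def)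
  have eqs: "r = of_int x / of_int z" "s = of_int y / of_int z" "r + s = of_int (x + y) / of_int z"
    using r s by (simp_all add: x_def y_def z_def field_simps)
  define k where "k = min (multiplicity (int p) x) (multiplicity (int p) y)"
  have "int p ^ k dvd x" "int p ^ k dvd y"
    by (auto simp: k_def intro!: multiplicity_dvd')
  then have "padic_abs p (r + s) \<le> real p powi (int (multiplicity (int p) z) - int k)"
    unfolding eqs(3) by (intro padic_abs_le_powi p xyz dvd_add)
  also have "\<dots> \<le> max (padic_abs p r) (padic_abs p s)"
    unfolding eqs(1,2) padic_abs_divide[OF p xyz(1,3)] padic_abs_divide[OF p xyz(2,3)] k_def by (auto simp: min_def)
  finally show ?thesis .
qed auto

lemma padic_abs_diff:
  assumes "prime p"
  shows "padic_abs p (r - s) \<le> max (padic_abs p r) (padic_abs p s)"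
  using padic_abs_add[OF assms, of r "- s"] by simp

lemma padic_abs_le_1_iff:
  assumes p: "prime p"
  shows "padic_abs p r \<le> 1 \<longleftrightarrow> (\<exists>a b. \<not> int p dvd b \<and> r = of_int a / of_int b)"
proof
  assume le: "padic_abs p r \<le> 1"
  obtain a b where r: "r = of_int a / of_int b" "b \<noteq> 0" "coprime a b" by (rule rat_divide_cases)
  show "\<exists>a b. \<not> int p dvd b \<and> r = of_int a / of_int b"
  proof (cases "int p dvd b")
    case True
    then have na: "\<not> int p dvd a" using r(3) p
      by (metis coprime_common_divisor not_prime_unit prime_nat_int_transfer)
    then have "a \<noteq> 0" by auto
    have "multiplicity (int p) b \<ge> 1"
      using True r(2) prime_gt_1_nat[OF p] by (intro multiplicity_geI) auto
    then have "multiplicity (int p) b > 0" by simp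
    have "multiplicity (int p) a = 0" by (rule not_dvd_imp_multiplicity_0) (rule na)
    then have "padic_abs p r = real p ^ multiplicity (int p) b"
      by (simp add: r(1) padic_abs_divide[OF p \<open>a \<noteq> 0\<close> r(2)])
    also have "\<dots> > 1" using prime_gt_1_nat[OF p] \<open>multiplicity (int p) b > 0\<close> by (intro one_less_power) auto
    finally show ?thesis using le by simp
  qed (use r in blast)
next
  assume "\<exists>a b. \<not> int p dvd b \<and> r = of_int a / of_int b"
  then obtain a b where ab: "\<not> int p dvd b" "r = of_int a / of_int b" by blast
  then have "b \<noteq> 0" by auto
  have "padic_abs p r \<le> real p powi (int (multiplicity (int p) b) - int 0)"
    unfolding ab by (rule padic_abs_le_powi) (use p \<open>b \<noteq> 0\<close> in auto)
  also have "multiplicity (int p) b = 0" by (rule not_dvd_imp_multiplicity_0) (rule ab)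
  finally show "padic_abs p r \<le> 1" by simp
qed

lemma padic_abs_of_int_le_1:
  assumes "prime p"
  shows "padic_abs p (of_int z) \<le> 1"
  using padic_abs_le_1_iff[OF assms, of "of_int z"] assms not_prime_unit[of "int p"]
  by (metis div_by_1 of_int_1 prime_nat_int_transfer)

text \<open>A prime dividing the reduced denominator would make the number non-integral at that
  prime. This local-global principle yields the uniqueness of L'.\<close>

lemma rat_int_if_padic_integral:
  assumes "\<And>p. prime p \<Longrightarrow> padic_abs p r \<le> 1"
  shows "r \<in> \<int>"
proof -
  obtain a b where r: "r = of_int a / of_int b" "b \<noteq> 0" "coprime a b" by (rule rat_divide_cases)
  have "is_unit b"
  proof (rule ccontr)
    assume "\<not> is_unit b"
    then obtain q where q: "prime q" "q dvd b" using r(2) prime_divisor_exists by blast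
    define p where "p = nat q"
    have p: "prime p" "int p = q" using q(1) prime_ge_0_int[OF q(1)] by (auto simp: p_def)
    obtain a' b' where ab': "\<not> q dvd b'" "r = of_int a' / of_int b'"
      using assms[OF p(1)] padic_abs_le_1_iff[OF p(1), of r] p(2) by auto
    have "b' \<noteq> 0" using ab'(1) by auto
    then have "(of_int (a * b') :: rat) = of_int (a' * b)"
      using r ab' by (simp add: field_simps)
    then have "a * b' = a' * b" by (simp only: of_int_eq_iff)
    then have "q dvd a * b'" using q(2) by simp
    then have "q dvd a" using q(1) ab'(1) prime_dvd_mult_iff by blast
    then show False using q r(3) by (metis coprime_common_divisor not_prime_unit)
  qed
  then have "\<bar>b\<bar> = 1" by (simp add: zdvd1_eq)
  then have "b = 1 \<or> b = - 1" by arith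
  then show ?thesis using r(1) by auto
qed

text \<open>The product of the individual denominators, each prime to \<open>p\<close>. With it a
  condition at one prime becomes integrality of a global vector.\<close>

lemma padic_integral_common_denominator:
  fixes t :: "'i \<Rightarrow> rat"
  assumes p: "prime p" and "finite A" and "\<And>j. j \<in> A \<Longrightarrow> padic_abs p (t j) \<le> 1"
  shows "\<exists>s. \<not> int p dvd s \<and> (\<forall>j\<in>A. of_int s * t j \<in> \<int>)"
  using assms(2,3)
proof (induction A rule: finite_induct)
  case empty
  then show ?case using not_prime_unit[of "int p"] p by (intro exI[of _ 1]) auto
next
  case (insert j A)
  then obtain s where s: "\<not> int p dvd s" "\<forall>j\<in>A. of_int s * t j \<in> \<int>" by auto
  obtain a b where ab: "\<not> int p dvd b" "t j = of_int a / of_int b"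
    using insert.prems[of j] padic_abs_le_1_iff[OF p] by auto
  have "\<not> int p dvd b * s" using ab s p by (simp add: prime_dvd_mult_iff)
  moreover have "of_int (b * s) * t i \<in> \<int>" if "i \<in> insert j A" for i
  proof (cases "i = j")
    case True
    have "b \<noteq> 0" using ab(1) by auto
    then have "of_int (b * s) * t i = of_int (s * a)" by (simp add: True ab(2))
    then show ?thesis by (simp only: Ints_of_int)
  next
    case False
    then have "of_int s * t i \<in> \<int>" using s(2) that by auto
    then have "of_int b * (of_int s * t i) \<in> \<int>" by (rule Ints_mult[OF Ints_of_int])
    then show ?thesis by (simp only: of_int_mult mult.assoc)
  qed
  ultimately show ?case by blast
qed

section \<open>Cauchy sequences modulo null sequences\<close>

context
  fixes p :: nat
  assumes p: "prime p"
begin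

lemma padic_cauchyD:
  assumes "f \<in> padic_cauchy p" "e > 0"
  shows "\<exists>n0. \<forall>m\<ge>n0. \<forall>n\<ge>n0. padic_abs p (f m - f n) < e"
  using assms by (simp add: padic_cauchy_def)

lemma padic_cauchy_bounded:
  assumes "f \<in> padic_cauchy p"
  obtains C n0 where "C > 0" "\<And>n. n \<ge> n0 \<Longrightarrow> padic_abs p (f n) \<le> C"
proof -
  obtain n0 where n0: "\<And>m n. m \<ge> n0 \<Longrightarrow> n \<ge> n0 \<Longrightarrow> padic_abs p (f m - f n) < 1"
    using padic_cauchyD[OF assms, of 1] by auto
  show ?thesis
  proof (rule that[of "max 1 (padic_abs p (f n0))" n0])
    fix n assume "n \<ge> n0"
    have "padic_abs p ((f n - f n0) + f n0) \<le> max (padic_abs p (f n - f n0)) (padic_abs p (f n0))"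
      by (rule padic_abs_add[OF p])
    then show "padic_abs p (f n) \<le> max 1 (padic_abs p (f n0))"
      using n0[OF \<open>n \<ge> n0\<close> order_refl] by (auto simp: max_def split: if_splits)
  qed simp
qed

lemma padic_cauchy_add:
  assumes "f \<in> padic_cauchy p" "g \<in> padic_cauchy p"
  shows "(\<lambda>n. f n + g n) \<in> padic_cauchy p"
  unfolding padic_cauchy_def
proof (intro CollectI allI impI)
  fix e :: real assume "e > 0"
  then obtain n1 n2 where n: "\<And>m n. m \<ge> n1 \<Longrightarrow> n \<ge> n1 \<Longrightarrow> padic_abs p (f m - f n) < e"
     "\<And>m n. m \<ge> n2 \<Longrightarrow> n \<ge> n2 \<Longrightarrow> padic_abs p (g m - g n) < e"
    using assms unfolding padic_cauchy_def by (auto, meson)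
  show "\<exists>n0. \<forall>m\<ge>n0. \<forall>n\<ge>n0. padic_abs p (f m + g m - (f n + g n)) < e"
  proof (intro exI allI impI)
    fix m k assume "m \<ge> max n1 n2" "k \<ge> max n1 n2"
    then have "max (padic_abs p (f m - f k)) (padic_abs p (g m - g k)) < e" using n by auto
    moreover have "f m + g m - (f k + g k) = (f m - f k) + (g m - g k)" by simp
    ultimately show "padic_abs p (f m + g m - (f k + g k)) < e"
      using le_less_trans[OF padic_abs_add[OF p, of "f m - f k" "g m - g k"]] by metis
  qed
qed

lemma padic_cauchy_mult:
  assumes "f \<in> padic_cauchy p" "g \<in> padic_cauchy p"
  shows "(\<lambda>n. f n * g n) \<in> padic_cauchy p"
  unfolding padic_cauchy_def
proof (intro CollectI allI impI)
  fix e :: real assume e: "e > 0"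
  obtain C n3 where C: "C > 0" "\<And>n. n \<ge> n3 \<Longrightarrow> padic_abs p (f n) \<le> C" using padic_cauchy_bounded[OF assms(1)] by blast
  obtain C' n4 where C': "C' > 0" "\<And>n. n \<ge> n4 \<Longrightarrow> padic_abs p (g n) \<le> C'" using padic_cauchy_bounded[OF assms(2)] by blast
  obtain n1 where n1: "\<And>m n. m \<ge> n1 \<Longrightarrow> n \<ge> n1 \<Longrightarrow> padic_abs p (f m - f n) < e / C'"
    using assms(1) e C'(1) unfolding padic_cauchy_def by (auto, meson divide_pos_pos)
  obtain n2 where n2: "\<And>m n. m \<ge> n2 \<Longrightarrow> n \<ge> n2 \<Longrightarrow> padic_abs p (g m - g n) < e / C"
    using assms(2) e C(1) unfolding padic_cauchy_def by (auto, meson divide_pos_pos)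
  show "\<exists>n0. \<forall>m\<ge>n0. \<forall>n\<ge>n0. padic_abs p (f m * g m - f n * g n) < e"
  proof (intro exI allI impI)
    fix m k assume mk: "m \<ge> max (max n1 n2) (max n3 n4)" "k \<ge> max (max n1 n2) (max n3 n4)"
    have "f m * g m - f k * g k = f m * (g m - g k) + (f m - f k) * g k" by (simp add: algebra_simps)
    then have "padic_abs p (f m * g m - f k * g k) \<le> max (padic_abs p (f m) * padic_abs p (g m - g k)) (padic_abs p (f m - f k) * padic_abs p (g k))"
      using padic_abs_add[OF p, of "f m * (g m - g k)" "(f m - f k) * g k"] by (simp add: padic_abs_mult[OF p])
    moreover have "padic_abs p (f m) * padic_abs p (g m - g k) \<le> C * padic_abs p (g m - g k)"
      using C mk by (intro mult_right_mono) auto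
    moreover have "C * padic_abs p (g m - g k) < e" using n2[of m k] mk C(1) by (simp add: field_simps)
    moreover have "padic_abs p (f m - f k) * padic_abs p (g k) \<le> padic_abs p (f m - f k) * C'"
      using C' mk by (intro mult_left_mono) auto
    moreover have "padic_abs p (f m - f k) * C' < e" using n1[of m k] mk C'(1) by (simp add: field_simps)
    ultimately show "padic_abs p (f m * g m - f k * g k) < e" by linarith
  qed
qed

lemma padic_cauchy_const [simp]: "(\<lambda>n. r) \<in> padic_cauchy p"
  by (simp add: padic_cauchy_def)

lemma padic_cauchy_minus:
  assumes "f \<in> padic_cauchy p"
  shows "(\<lambda>n. - f n) \<in> padic_cauchy p"
  using padic_cauchy_mult[OF padic_cauchy_const[of "-1"] assms] by simp

lemma padic_nullI:
  assumes "\<And>e. e > 0 \<Longrightarrow> \<exists>n0. \<forall>n\<ge>n0. padic_abs p (f n) < e"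
  shows "f \<in> padic_null p"
  unfolding padic_null_def mem_Collect_eq LIMSEQ_def using assms by simp

lemma padic_nullD:
  assumes "f \<in> padic_null p" "e > 0"
  shows "\<exists>n0. \<forall>n\<ge>n0. padic_abs p (f n) < e"
  using assms unfolding padic_null_def mem_Collect_eq LIMSEQ_def by simp

lemma padic_null_subset: "padic_null p \<subseteq> padic_cauchy p"
proof
  fix f assume f: "f \<in> padic_null p"
  show "f \<in> padic_cauchy p"
    unfolding padic_cauchy_def
  proof (intro CollectI allI impI)
    fix e :: real assume "e > 0"
    then obtain n0 where "\<And>n. n \<ge> n0 \<Longrightarrow> padic_abs p (f n) < e" using padic_nullD[OF f] by blast
    then show "\<exists>n0. \<forall>m\<ge>n0. \<forall>n\<ge>n0. padic_abs p (f m - f n) < e"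
      by (meson le_less_trans max_less_iff_conj padic_abs_diff[OF p])
  qed
qed

lemma padic_null_add:
  assumes "f \<in> padic_null p" "g \<in> padic_null p"
  shows "(\<lambda>n. f n + g n) \<in> padic_null p"
proof (rule padic_nullI)
  fix e :: real assume "e > 0"
  then obtain n1 n2 where "\<And>n. n \<ge> n1 \<Longrightarrow> padic_abs p (f n) < e" "\<And>n. n \<ge> n2 \<Longrightarrow> padic_abs p (g n) < e"
    using padic_nullD[OF assms(1)] padic_nullD[OF assms(2)] by metis
  then have "padic_abs p (f n + g n) < e" if "n \<ge> max n1 n2" for n
    using that padic_abs_add[OF p, of "f n" "g n"] by (metis le_less_trans max.bounded_iff max_less_iff_conj)
  then show "\<exists>n0. \<forall>n\<ge>n0. padic_abs p (f n + g n) < e" by blast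
qed

lemma padic_null_mult:
  assumes "f \<in> padic_null p" "g \<in> padic_cauchy p"
  shows "(\<lambda>n. g n * f n) \<in> padic_null p"
proof (rule padic_nullI)
  fix e :: real assume e: "e > 0"
  obtain C n1 where C: "C > 0" "\<And>n. n \<ge> n1 \<Longrightarrow> padic_abs p (g n) \<le> C" using padic_cauchy_bounded[OF assms(2)] by blast
  obtain n2 where n2: "\<And>n. n \<ge> n2 \<Longrightarrow> padic_abs p (f n) < e / C"
    using padic_nullD[OF assms(1), of "e / C"] e C(1) by auto
  have "padic_abs p (g n * f n) < e" if "n \<ge> max n1 n2" for n
  proof -
    have "padic_abs p (g n * f n) \<le> C * padic_abs p (f n)"
      unfolding padic_abs_mult[OF p] using C(2)[of n] that by (intro mult_right_mono) auto
    also have "\<dots> < e" using n2[of n] that C(1) by (simp add: field_simps)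
    finally show ?thesis .
  qed
  then show "\<exists>n0. \<forall>n\<ge>n0. padic_abs p (g n * f n) < e" by blast
qed

lemma padic_null_minus:
  assumes "f \<in> padic_null p"
  shows "(\<lambda>n. - f n) \<in> padic_null p"
  using padic_null_mult[OF assms padic_cauchy_const[of "-1"]] by simp

lemma padic_null_0: "(\<lambda>n. 0) \<in> padic_null p"
  by (simp add: padic_null_def)

lemma cring_padic_cauchy_ring: "cring (padic_cauchy_ring p)"
proof (rule cringI)
  show "abelian_group (padic_cauchy_ring p)"
  proof (rule abelian_groupI)
    show "\<exists>y\<in>carrier (padic_cauchy_ring p). y \<oplus>\<^bsub>padic_cauchy_ring p\<^esub> f = \<zero>\<^bsub>padic_cauchy_ring p\<^esub>"
      if "f \<in> carrier (padic_cauchy_ring p)" for f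
      using that by (intro bexI[of _ "\<lambda>n. - f n"]) (auto simp: padic_cauchy_ring_def padic_cauchy_minus)
  qed (auto simp: padic_cauchy_ring_def padic_cauchy_add algebra_simps)
  show "Group.comm_monoid (padic_cauchy_ring p)"
    by (rule comm_monoidI) (auto simp: padic_cauchy_ring_def padic_cauchy_mult algebra_simps)
qed (auto simp: padic_cauchy_ring_def algebra_simps)

lemma ideal_padic_null: "ideal (padic_null p) (padic_cauchy_ring p)"
proof (rule idealI)
  interpret cring "padic_cauchy_ring p" by (rule cring_padic_cauchy_ring)
  show "ring (padic_cauchy_ring p)" by (rule ring_axioms)
  show "subgroup (padic_null p) (add_monoid (padic_cauchy_ring p))"
  proof (rule group.subgroupI)
    show "group (add_monoid (padic_cauchy_ring p))" by (rule a_group)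
    show "padic_null p \<noteq> {}" using padic_null_0 by blast
    fix f assume f: "f \<in> padic_null p"
    have "inv\<^bsub>add_monoid (padic_cauchy_ring p)\<^esub> f = (\<lambda>n. - f n)"
    proof -
      have "\<ominus>\<^bsub>padic_cauchy_ring p\<^esub> f = (\<lambda>n. - f n)"
        using f padic_null_subset
        by (intro minus_equality) (auto simp: padic_cauchy_ring_def padic_cauchy_minus)
      then show ?thesis by (simp add: a_inv_def)
    qed
    then show "inv\<^bsub>add_monoid (padic_cauchy_ring p)\<^esub> f \<in> padic_null p"
      using padic_null_minus[OF f] by simp
  qed (use padic_null_subset padic_null_add in \<open>auto simp: padic_cauchy_ring_def\<close>)
  show "x \<otimes>\<^bsub>padic_cauchy_ring p\<^esub> a \<in> padic_null p"
    if "a \<in> padic_null p" "x \<in> carrier (padic_cauchy_ring p)" for a x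
    using padic_null_mult[of a x] that by (simp add: padic_cauchy_ring_def)
  show "a \<otimes>\<^bsub>padic_cauchy_ring p\<^esub> x \<in> padic_null p"
    if "a \<in> padic_null p" "x \<in> carrier (padic_cauchy_ring p)" for a x
    using padic_null_mult[of a x] that by (simp add: padic_cauchy_ring_def mult.commute)
qed

lemma cring_Qp: "cring (Qp p)"
  unfolding Qp_def by (rule ideal.quotient_is_cring[OF ideal_padic_null cring_padic_cauchy_ring])

definition padic_class :: "(nat \<Rightarrow> rat) \<Rightarrow> padic" where
  "padic_class f = padic_null p +>\<^bsub>padic_cauchy_ring p\<^esub> f"

lemma padic_class_eq: "padic_class f = {\<lambda>n. h n + f n |h. h \<in> padic_null p}"
  by (auto simp: padic_class_def a_r_coset_def r_coset_def padic_cauchy_ring_def)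

lemma padic_class_self: "f \<in> padic_class f"
  unfolding padic_class_eq using padic_null_0 by force

lemma carrier_Qp: "carrier (Qp p) = padic_class ` padic_cauchy p"
  by (auto simp: Qp_def FactRing_def A_RCOSETS_def' padic_class_def padic_cauchy_ring_def)

lemma padic_class_cong:
  assumes "f \<in> padic_cauchy p" "g \<in> padic_class f"
  shows "padic_class g = padic_class f"
proof -
  interpret ideal "padic_null p" "padic_cauchy_ring p" by (rule ideal_padic_null)
  show ?thesis
    using a_repr_independence'[of g f] assms unfolding padic_class_def by (simp add: padic_cauchy_ring_def)
qed

lemma padic_class_hom: "padic_class \<in> ring_hom (padic_cauchy_ring p) (Qp p)"
proof -
  have "padic_class = (+>\<^bsub>padic_cauchy_ring p\<^esub>) (padic_null p)" by (simp add: padic_class_def fun_eq_iff)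
  then show ?thesis
    unfolding Qp_def using ideal.rcos_ring_hom[OF ideal_padic_null] by simp
qed

lemma padic_class_add:
  assumes "f \<in> padic_cauchy p" "g \<in> padic_cauchy p"
  shows "padic_class f \<oplus>\<^bsub>Qp p\<^esub> padic_class g = padic_class (\<lambda>n. f n + g n)"
  using ring_hom_add[OF padic_class_hom, of f g] assms by (simp add: padic_cauchy_ring_def)

lemma padic_class_mult:
  assumes "f \<in> padic_cauchy p" "g \<in> padic_cauchy p"
  shows "padic_class f \<otimes>\<^bsub>Qp p\<^esub> padic_class g = padic_class (\<lambda>n. f n * g n)"
  using ring_hom_mult[OF padic_class_hom, of f g] assms by (simp add: padic_cauchy_ring_def)

lemma padic_of_rat_class: "padic_of_rat p r = padic_class (\<lambda>n. r)"
  by (simp add: padic_of_rat_def padic_class_def)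

lemma padic_of_rat_closed [simp]: "padic_of_rat p r \<in> carrier (Qp p)"
  by (auto simp: carrier_Qp padic_of_rat_class)

lemma padic_of_rat_add: "padic_of_rat p (r + s) = padic_of_rat p r \<oplus>\<^bsub>Qp p\<^esub> padic_of_rat p s"
  by (simp add: padic_of_rat_class padic_class_add)

lemma padic_of_rat_mult: "padic_of_rat p (r * s) = padic_of_rat p r \<otimes>\<^bsub>Qp p\<^esub> padic_of_rat p s"
  by (simp add: padic_of_rat_class padic_class_mult)

lemma padic_of_rat_1: "padic_of_rat p 1 = \<one>\<^bsub>Qp p\<^esub>"
  using ring_hom_one[OF padic_class_hom] by (simp add: padic_of_rat_class padic_cauchy_ring_def)

lemma padic_of_rat_0: "padic_of_rat p 0 = \<zero>\<^bsub>Qp p\<^esub>"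
proof -
  interpret cring "Qp p" by (rule cring_Qp)
  have "padic_of_rat p 0 \<oplus>\<^bsub>Qp p\<^esub> padic_of_rat p 0 = padic_of_rat p 0"
    using padic_of_rat_add[of 0 0] by simp
  then show ?thesis using add.l_cancel_one[of "padic_of_rat p 0" "padic_of_rat p 0"] by simp
qed

text \<open>An integral sequence found in a coset is itself Cauchy, since it differs from a Cauchy
  sequence by a null sequence, and it represents the same coset.\<close>

lemma Zp_iff: "x \<in> Zp p \<longleftrightarrow> (\<exists>f\<in>padic_cauchy p. x = padic_class f \<and> (\<forall>n. padic_abs p (f n) \<le> 1))"
proof
  assume "x \<in> Zp p"
  then obtain f' f where f: "f' \<in> padic_cauchy p" "x = padic_class f'" "f \<in> x" "\<forall>n. padic_abs p (f n) \<le> 1"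
    unfolding Zp_def carrier_Qp by auto
  have "f \<in> padic_cauchy p"
    using f padic_null_subset padic_cauchy_add by (auto simp: padic_class_eq)
  then show "\<exists>f\<in>padic_cauchy p. x = padic_class f \<and> (\<forall>n. padic_abs p (f n) \<le> 1)"
    using f padic_class_cong by blast
qed (auto simp: Zp_def carrier_Qp intro: padic_class_self)

lemma Zp_closed: "x \<in> Zp p \<Longrightarrow> x \<in> carrier (Qp p)"
  by (simp add: Zp_def)

lemma Zp_add:
  assumes "x \<in> Zp p" "y \<in> Zp p"
  shows "x \<oplus>\<^bsub>Qp p\<^esub> y \<in> Zp p"
proof -
  obtain f g where "f \<in> padic_cauchy p" "x = padic_class f" "\<forall>n. padic_abs p (f n) \<le> 1"
    "g \<in> padic_cauchy p" "y = padic_class g" "\<forall>n. padic_abs p (g n) \<le> 1"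
    using assms unfolding Zp_iff by blast
  then show ?thesis
    unfolding Zp_iff by (intro bexI[of _ "\<lambda>n. f n + g n"])
      (auto simp: padic_class_add padic_cauchy_add intro: order_trans[OF padic_abs_add[OF p]])
qed

lemma Zp_mult:
  assumes "x \<in> Zp p" "y \<in> Zp p"
  shows "x \<otimes>\<^bsub>Qp p\<^esub> y \<in> Zp p"
proof -
  obtain f g where "f \<in> padic_cauchy p" "x = padic_class f" "\<forall>n. padic_abs p (f n) \<le> 1"
    "g \<in> padic_cauchy p" "y = padic_class g" "\<forall>n. padic_abs p (g n) \<le> 1"
    using assms unfolding Zp_iff by blast
  then show ?thesis
    unfolding Zp_iff by (intro bexI[of _ "\<lambda>n. f n * g n"])
      (auto simp: padic_class_mult padic_cauchy_mult padic_abs_mult[OF p] intro: mult_le_one)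
qed

text \<open>An integral representative has the form \<open>h n + r\<close> with \<open>h\<close>
  null; at an index where \<open>h\<close> is small the ultrametric inequality bounds
  \<open>r\<close>.\<close>

lemma padic_of_rat_Zp_iff: "padic_of_rat p r \<in> Zp p \<longleftrightarrow> padic_abs p r \<le> 1"
proof
  assume "padic_of_rat p r \<in> Zp p"
  then obtain f where "f \<in> padic_class (\<lambda>n. r)" "\<forall>n. padic_abs p (f n) \<le> 1"
    by (auto simp: Zp_def padic_of_rat_class)
  then obtain h where h: "h \<in> padic_null p" "\<And>n. padic_abs p (h n + r) \<le> 1"
    by (auto simp: padic_class_eq)
  then obtain n where "padic_abs p (h n) < 1" using padic_nullD[OF h(1), of 1] by auto
  then show "padic_abs p r \<le> 1"
    using padic_abs_diff[OF p, of "h n + r" "h n"] h(2)[of n] by simp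
qed (auto simp: Zp_iff padic_of_rat_class)

text \<open>Rational numbers are dense: a late term of a Cauchy sequence differs from the limit by a
  p-adic integer.\<close>

lemma Qp_decompose:
  assumes "x \<in> carrier (Qp p)"
  obtains z r where "z \<in> Zp p" "x = z \<oplus>\<^bsub>Qp p\<^esub> padic_of_rat p r"
proof -
  obtain f where f: "f \<in> padic_cauchy p" "x = padic_class f" using assms by (auto simp: carrier_Qp)
  obtain n0 where n0: "\<And>m n. m \<ge> n0 \<Longrightarrow> n \<ge> n0 \<Longrightarrow> padic_abs p (f m - f n) < 1"
    using padic_cauchyD[OF f(1), of 1] by auto
  \<comment> \<open>The sequence \<open>f m - f n0\<close> is integral only from \<open>n0\<close>
    on. Its initial part is moved into the null sequence \<open>h\<close>, because \<open>Zp\<close>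
    asks for integrality of every term.\<close>
  define g where "g m = (if m \<ge> n0 then f m - f n0 else 0)" for m
  define h where "h m = (if m \<ge> n0 then 0 else f m - f n0)" for m
  have h: "h \<in> padic_null p"
    by (rule padic_nullI) (auto simp: h_def intro!: exI[of _ n0])
  have geq: "g = (\<lambda>n. f n + (- (h n) + - f n0))" by (auto simp: g_def h_def)
  have g: "g \<in> padic_cauchy p"
    unfolding geq using f(1) h padic_null_subset
    by (intro padic_cauchy_add padic_cauchy_minus padic_cauchy_const) auto
  have g1: "padic_abs p (g n) \<le> 1" for n
    using n0[of n n0] by (auto simp: g_def less_imp_le)
  have gf: "(\<lambda>n. g n + f n0) \<in> padic_cauchy p" using g by (intro padic_cauchy_add padic_cauchy_const)
  have "f = (\<lambda>n. h n + (g n + f n0))" by (auto simp: g_def h_def)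
  then have "f \<in> padic_class (\<lambda>n. g n + f n0)" using h unfolding padic_class_eq by blast
  then have "x = padic_class (\<lambda>n. g n + f n0)" using padic_class_cong[OF gf] f(2) by simp
  also have "\<dots> = padic_class g \<oplus>\<^bsub>Qp p\<^esub> padic_of_rat p (f n0)"
    using g by (simp add: padic_of_rat_class padic_class_add)
  finally show ?thesis using that[of "padic_class g" "f n0"] g g1 unfolding Zp_iff by blast
qed

end

section \<open>Even lattices and their level\<close>

lemma lattice_basis_det:
  assumes "lattice_basis B L"
  shows "det B \<noteq> 0"
proof -
  have inj: "inj (\<lambda>i. B $ i)" and ind: "independent (range (\<lambda>i. B $ i))"
    using assms by (auto simp: lattice_basis_def)
  have "\<forall>i. c i = 0" if c: "(\<Sum>i\<in>UNIV. c i *s row i B) = 0" for c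
  proof
    fix i
    have "(\<Sum>v\<in>range (\<lambda>i. B $ i). c (inv_into UNIV (\<lambda>i. B $ i) v) *\<^sub>R v) = (\<Sum>i\<in>UNIV. c i *\<^sub>R B $ i)"
      by (subst sum.reindex[OF inj]) (simp add: inv_f_f[OF inj])
    also have "\<dots> = 0" using c by (simp add: row_def scalar_mult_eq_scaleR)
    finally have "c (inv_into UNIV (\<lambda>i. B $ i) (B $ i)) = 0"
      by (intro independentD[OF ind, of "range (\<lambda>i. B $ i)" "\<lambda>v. c (inv_into UNIV (\<lambda>i. B $ i) v)"]) auto
    then show "c i = 0" by (simp add: inv_f_f[OF inj])
  qed
  then obtain B' where "B ** B' = mat 1" using matrix_right_invertible_independent_rows[of B] by blast
  then show ?thesis by (metis det_I det_mul mult_zero_left zero_neq_one)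
qed

lemma lattice_basisI:
  assumes "det B \<noteq> 0"
  shows "lattice_basis B (range (\<lambda>z :: int^'m. \<Sum>i\<in>UNIV. of_int (z $ i) *\<^sub>R B $ i))"
  unfolding lattice_basis_def
proof (intro conjI refl)
  have "row i B \<noteq> row j B" if "i \<noteq> j" for i j using det_identical_rows[OF that, of B] assms by blast
  then show inj: "inj (\<lambda>i. B $ i)" by (auto simp: inj_def row_def)
  have inv: "invertible B" using assms by (simp add: invertible_det_nz)
  show "independent (range (\<lambda>i. B $ i))"
  proof (rule independent_if_scalars_zero)
    fix f x assume f: "(\<Sum>x\<in>range (\<lambda>i. B $ i). f x *\<^sub>R x) = 0" and x: "x \<in> range (\<lambda>i. B $ i)"
    define c where "c = (\<chi> i. f (B $ i))"
    have "c v* B = (\<Sum>i\<in>UNIV. f (B $ i) *\<^sub>R B $ i)"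
      by (simp add: c_def vector_matrix_mult_def vec_eq_iff mult.commute)
    also have "\<dots> = 0" using f by (subst (asm) sum.reindex[OF inj]) simp
    finally have "c v* (B ** matrix_inv B) = 0"
      by (simp flip: vector_matrix_mul_assoc)
    then have "c = 0" by (simp add: matrix_inv_right[OF inv])
    then show "f x = 0" using x by (auto simp: c_def vec_eq_iff)
  qed simp
qed

lemma vec_combination_solve:
  fixes B :: "'a::field^'m^'m"
  assumes "det B \<noteq> 0"
  shows "(\<Sum>i\<in>UNIV. (y v* matrix_inv B) $ i *s B $ i) = y"
proof -
  have "(y v* matrix_inv B) v* B = y"
    using assms by (simp add: vector_matrix_mul_assoc matrix_inv_left invertible_det_nz)
  moreover have "x v* B = (\<Sum>i\<in>UNIV. x $ i *s B $ i)" for x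
    by (simp add: vector_matrix_mult_def vec_eq_iff mult.commute)
  ultimately show ?thesis by simp
qed

lemma det_in_Ints:
  fixes A :: "'a::comm_ring_1^'n^'n"
  assumes "\<And>i j. A $ i $ j \<in> \<int>"
  shows "det A \<in> \<int>"
  unfolding det_def by (intro Ints_sum Ints_mult Ints_prod Ints_of_int assms)

lemma sum_in_subgroup:
  fixes \<Lambda> :: "'a::real_vector set"
  assumes 0: "0 \<in> \<Lambda>" and diff: "\<And>x y. x \<in> \<Lambda> \<Longrightarrow> y \<in> \<Lambda> \<Longrightarrow> x - y \<in> \<Lambda>"
  shows add_in_subgroup: "x \<in> \<Lambda> \<Longrightarrow> y \<in> \<Lambda> \<Longrightarrow> x + y \<in> \<Lambda>"
    and scale_int_in_subgroup: "x \<in> \<Lambda> \<Longrightarrow> of_int k *\<^sub>R x \<in> \<Lambda>"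
    and sum_int_in_subgroup: "(\<And>i. i \<in> I \<Longrightarrow> f i \<in> \<Lambda>) \<Longrightarrow> (\<Sum>i\<in>I. of_int (z i) *\<^sub>R f i) \<in> \<Lambda>"
proof -
  have neg: "- x \<in> \<Lambda>" if "x \<in> \<Lambda>" for x using diff[OF 0 that] by simp
  show add: "x + y \<in> \<Lambda>" if "x \<in> \<Lambda>" "y \<in> \<Lambda>" for x y using diff[OF that(1) neg[OF that(2)]] by simp
  have nat: "real n *\<^sub>R x \<in> \<Lambda>" if "x \<in> \<Lambda>" for x n
    by (induction n) (auto simp: 0 scaleR_add_left intro: add that)
  show scale: "of_int k *\<^sub>R x \<in> \<Lambda>" if "x \<in> \<Lambda>" for x k
  proof (cases "k \<ge> 0")
    case True
    then show ?thesis using nat[OF that, of "nat k"] by simp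
  next
    case False
    then show ?thesis using neg[OF nat[OF that, of "nat (- k)"]] by simp
  qed
  show "(\<Sum>i\<in>I. of_int (z i) *\<^sub>R f i) \<in> \<Lambda>" if "\<And>i. i \<in> I \<Longrightarrow> f i \<in> \<Lambda>"
    using that by (induction I rule: infinite_finite_induct) (auto simp: 0 intro: add scale)
qed

text \<open>Among all systems of \<open>m\<close> independent vectors of the group, one with minimal determinant is
  a basis: a non-integral coordinate of an element would give a system with smaller determinant.\<close>

lemma is_lattice_between:
  fixes B :: "real^'m^'m" and \<Lambda> :: "(real^'m) set"
  assumes L: "lattice_basis B L" and sub: "L \<subseteq> \<Lambda>" and d: "d > 0" and dL: "\<And>x. x \<in> \<Lambda> \<Longrightarrow> real d *\<^sub>R x \<in> L"
    and diff: "\<And>x y. x \<in> \<Lambda> \<Longrightarrow> y \<in> \<Lambda> \<Longrightarrow> x - y \<in> \<Lambda>"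
  shows "is_lattice \<Lambda>"
proof -
  have dB: "det B \<noteq> 0" by (rule lattice_basis_det[OF L])
  have Leq: "L = range (\<lambda>z :: int^'m. \<Sum>i\<in>UNIV. of_int (z $ i) *\<^sub>R B $ i)"
    using L by (simp add: lattice_basis_def)
  have BL: "B $ i \<in> L" for i
    unfolding Leq by (rule range_eqI[of _ _ "axis i 1"]) (simp add: axis_def if_distrib if_distribR cong: if_cong)
  have 0: "0 \<in> \<Lambda>" using diff[of "B $ undefined" "B $ undefined"] BL sub by auto
  define S where "S = {C :: real^'m^'m. (\<forall>i. C $ i \<in> \<Lambda>) \<and> det C \<noteq> 0}"
  \<comment> \<open>A minimal determinant exists because this multiple is an integer:
    \<open>d\<close> times the rows of \<open>C\<close> lie in \<open>L\<close> and have integral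
    coordinates in \<open>B\<close>.\<close>
  define q where "q C = real d ^ CARD('m) * \<bar>det C\<bar> / \<bar>det B\<bar>" for C :: "real^'m^'m"
  have q: "q C \<in> \<int>" if "C \<in> S" for C
  proof -
    have "\<forall>i. \<exists>z :: int^'m. real d *\<^sub>R C $ i = (\<Sum>j\<in>UNIV. of_int (z $ j) *\<^sub>R B $ j)"
      using dL that unfolding S_def Leq by (auto simp: image_iff)
    then obtain z where z: "\<And>i. real d *\<^sub>R C $ i = (\<Sum>j\<in>UNIV. of_int (z i $ j) *\<^sub>R B $ j)" by metis
    define M :: "real^'m^'m" where "M = (\<chi> i j. of_int (z i $ j))"
    have "real d *\<^sub>R C = M ** B"
      by (rule vec_eq_iff[THEN iffD2]) (simp add: z M_def matrix_matrix_mult_def vec_eq_iff)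
    then have "det (real d *\<^sub>R C) = det M * det B" by (simp add: det_mul)
    moreover have "det (real d *\<^sub>R C) = real d ^ CARD('m) * det C"
    proof -
      have "real d *\<^sub>R C = (\<chi> i. real d *s C $ i)" by (simp add: vec_eq_iff)
      then show ?thesis using det_rows_mul[of "\<lambda>_. real d" "\<lambda>i. C $ i"] by simp
    qed
    ultimately have "real d ^ CARD('m) * \<bar>det C\<bar> = \<bar>det M\<bar> * \<bar>det B\<bar>"
      by (metis abs_mult abs_of_nat power_abs)
    then have "q C = \<bar>det M\<bar>" using dB by (simp add: q_def)
    moreover have "det M \<in> \<int>" by (rule det_in_Ints) (simp add: M_def)
    ultimately show ?thesis by (simp add: Ints_abs)
  qed
  have "B \<in> S" using BL sub dB by (auto simp: S_def)
  then obtain C where C: "C \<in> S" "\<And>C'. C' \<in> S \<Longrightarrow> nat \<lfloor>q C\<rfloor> \<le> nat \<lfloor>q C'\<rfloor>"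
    using ex_has_least_nat[of "\<lambda>C. C \<in> S" B "\<lambda>C. nat \<lfloor>q C\<rfloor>"] by auto
  have dC: "det C \<noteq> 0" and C\<Lambda>: "\<And>i. C $ i \<in> \<Lambda>" using C(1) by (auto simp: S_def)
  have min: "\<bar>det C\<bar> \<le> \<bar>det C'\<bar>" if C': "C' \<in> S" for C'
  proof -
    obtain a a' :: int where a: "q C = of_int a" "q C' = of_int a'" using q[OF C(1)] q[OF C'] by (auto elim!: Ints_cases)
    have "q C' \<ge> 0" "q C \<ge> 0" by (simp_all add: q_def)
    then have "q C \<le> q C'" using C(2)[OF C'] unfolding a by simp
    then show ?thesis using dB d by (simp add: q_def divide_le_cancel mult_le_cancel_left)
  qed
  have "\<Lambda> = range (\<lambda>z :: int^'m. \<Sum>i\<in>UNIV. of_int (z $ i) *\<^sub>R C $ i)"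
  proof (intro equalityI subsetI)
    fix y assume "y \<in> range (\<lambda>z :: int^'m. \<Sum>i\<in>UNIV. of_int (z $ i) *\<^sub>R C $ i)"
    then show "y \<in> \<Lambda>" using sum_int_in_subgroup[OF 0 diff, where I = UNIV and f = "\<lambda>i. C $ i"] C\<Lambda> by auto
  next
    fix y assume y: "y \<in> \<Lambda>"
    define s where "s = y v* matrix_inv C"
    have ys: "y = (\<Sum>i\<in>UNIV. s $ i *\<^sub>R C $ i)"
      using vec_combination_solve[OF dC, of y] by (simp add: s_def scalar_mult_eq_scaleR)
    define y' where "y' = y - (\<Sum>i\<in>UNIV. of_int \<lfloor>s $ i\<rfloor> *\<^sub>R C $ i)"
    have y': "y' \<in> \<Lambda>" unfolding y'_def
      by (intro diff y sum_int_in_subgroup[OF 0 diff]) (use C\<Lambda> in auto)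
    have y'eq: "y' = (\<Sum>i\<in>UNIV. frac (s $ i) *\<^sub>R C $ i)"
      by (simp add: y'_def ys frac_def scaleR_diff_left sum_subtractf)
    have "frac (s $ k) = 0" for k
    proof (rule ccontr)
      assume k: "frac (s $ k) \<noteq> 0"
      \<comment> \<open>Replacing row \<open>k\<close> by the fractional remainder multiplies the
        determinant by \<open>frac (s $ k)\<close>, which is less than 1; this contradicts
        minimality.\<close>
      define C' where "C' = (\<chi> i. if i = k then y' else C $ i)"
      have "det C' = frac (s $ k) * det C"
        using cramer_lemma_transpose[where x = "\<chi> i. frac (s $ i)" and k = k and A = C]
        by (simp add: C'_def y'eq row_def scalar_mult_eq_scaleR cong: if_cong)
      moreover from this have "C' \<in> S" using k dC y' C\<Lambda> by (auto simp: S_def C'_def)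
      ultimately have "\<bar>det C\<bar> \<le> frac (s $ k) * \<bar>det C\<bar>" using min[of C'] by (simp add: abs_mult)
      then show False using frac_lt_1[of "s $ k"] dC by simp
    qed
    then have "s $ i = of_int \<lfloor>s $ i\<rfloor>" for i by (simp add: frac_def)
    then have "y = (\<Sum>i\<in>UNIV. of_int ((\<chi> i. \<lfloor>s $ i\<rfloor>) $ i) *\<^sub>R C $ i)" using ys by simp
    then show "y \<in> range (\<lambda>z :: int^'m. \<Sum>i\<in>UNIV. of_int (z $ i) *\<^sub>R C $ i)" by blast
  qed
  then show ?thesis unfolding is_lattice_def using lattice_basisI[OF dC] by metis
qed

text \<open>The off-diagonal terms occur in equal pairs by symmetry, and the diagonal terms are even
  by assumption.\<close>

lemma even_quadratic_form:
  fixes M :: "'i \<Rightarrow> 'i \<Rightarrow> int"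
  assumes "finite A" "\<And>i j. M i j = M j i" "\<And>i. even (M i i)"
  shows "even (\<Sum>i\<in>A. \<Sum>j\<in>A. k i * k j * M i j)"
  using assms(1)
proof (induction A rule: finite_induct)
  case (insert a A)
  have "(\<Sum>i\<in>insert a A. \<Sum>j\<in>insert a A. k i * k j * M i j)
     = k a * k a * M a a + (\<Sum>j\<in>A. k a * k j * M a j) + (\<Sum>i\<in>A. k i * k a * M i a) + (\<Sum>i\<in>A. \<Sum>j\<in>A. k i * k j * M i j)"
    using insert.hyps by (simp add: sum.distrib)
  also have "(\<Sum>i\<in>A. k i * k a * M i a) = (\<Sum>j\<in>A. k a * k j * M a j)"
    using assms(2) by (intro sum.cong refl) (simp add: mult.commute mult.left_commute)
  finally show ?case using insert.IH assms(3)[of a] by simp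
qed simp

locale even_lattice =
  fixes L :: "(real^'m) set" and B :: "real^'m^'m"
  assumes basis: "lattice_basis B L" and even: "even_integral L"
begin

definition dual :: "(real^'m) set" where
  "dual = {x. \<forall>y\<in>L. x \<bullet> y \<in> \<int>}"

lemma det_B: "det B \<noteq> 0" using basis by (rule lattice_basis_det)

lemma L_eq: "L = range (\<lambda>z :: int^'m. \<Sum>i\<in>UNIV. of_int (z $ i) *\<^sub>R B $ i)"
  using basis by (simp add: lattice_basis_def)

lemma B_in_L: "B $ i \<in> L"
  unfolding L_eq by (rule range_eqI[of _ _ "axis i 1"]) (simp add: axis_def if_distrib if_distribR cong: if_cong)

lemma L_diff: "x \<in> L \<Longrightarrow> y \<in> L \<Longrightarrow> x - y \<in> L"
  unfolding L_eq by (auto simp: sum_subtractf[symmetric] scaleR_diff_left[symmetric] simp flip: of_int_diff vector_minus_component)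

lemma L_0: "0 \<in> L" using L_diff[OF B_in_L[of undefined] B_in_L[of undefined]] by simp

lemma L_add: "x \<in> L \<Longrightarrow> y \<in> L \<Longrightarrow> x + y \<in> L"
  by (rule add_in_subgroup[OF L_0 L_diff])

lemma L_scale: "x \<in> L \<Longrightarrow> of_int k *\<^sub>R x \<in> L"
  by (rule scale_int_in_subgroup[OF L_0 L_diff])

lemma L_sum: "(\<And>i. i \<in> I \<Longrightarrow> f i \<in> L) \<Longrightarrow> (\<Sum>i\<in>I. of_int (z i) *\<^sub>R f i) \<in> L"
  by (rule sum_int_in_subgroup[OF L_0 L_diff])

lemma L_norm: assumes "x \<in> L" obtains z :: int where "x \<bullet> x = 2 * of_int z"
  using even assms by (auto simp: even_integral_def)

lemma L_inner: assumes "x \<in> L" "y \<in> L" shows "x \<bullet> y \<in> \<int>"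
proof -
  obtain a b c :: int where "x \<bullet> x = 2 * of_int a" "y \<bullet> y = 2 * of_int b" "(x + y) \<bullet> (x + y) = 2 * of_int c"
    using L_norm assms L_add by metis
  then have "x \<bullet> y = of_int (c - a - b)"
    by (simp add: inner_add_left inner_add_right inner_commute)
  then show ?thesis by simp
qed

lemma gram_Ints: "gram B $ i $ j \<in> \<int>"
  by (simp add: gram_def L_inner B_in_L)

lemma L_subset_dual: "L \<subseteq> dual" by (auto simp: dual_def L_inner)

lemma dual_diff: "x \<in> dual \<Longrightarrow> y \<in> dual \<Longrightarrow> x - y \<in> dual"
  by (auto simp: dual_def inner_diff_left intro: Ints_diff)

lemma dual_0: "0 \<in> dual" by (simp add: dual_def)

lemma dual_scale: "x \<in> dual \<Longrightarrow> of_int k *\<^sub>R x \<in> dual"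
  by (rule scale_int_in_subgroup[OF dual_0 dual_diff])

lemma dualI: assumes "\<And>i. x \<bullet> B $ i \<in> \<int>" shows "x \<in> dual"
proof -
  have "x \<bullet> y \<in> \<int>" if y: "y \<in> L" for y
  proof -
    obtain z :: "int^'m" where "y = (\<Sum>i\<in>UNIV. of_int (z $ i) *\<^sub>R B $ i)" using y by (subst (asm) L_eq) blast
    then show ?thesis using assms by (simp add: inner_sum_right Ints_sum Ints_mult)
  qed
  then show ?thesis by (simp add: dual_def)
qed

lemma det_gram: "det (gram B) \<noteq> 0" using det_B by (simp add: gram_eq det_mul)

text \<open>Needed to extract any property from the \<open>LEAST\<close> in
  \<open>lattice_level\<close>. Twice the absolute Gram determinant is a witness: by Cramer's rule
  the determinant clears all denominators, and the factor 2 makes all entries even.\<close>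

lemma level_exists:
  "\<exists>N\<ge>1. (\<forall>i j. (real N *\<^sub>R matrix_inv (gram B)) $ i $ j \<in> \<int>) \<and>
        (\<forall>i. \<exists>z::int. (real N *\<^sub>R matrix_inv (gram B)) $ i $ i = 2 * of_int z)"
proof -
  obtain D :: int where D: "det (gram B) = of_int D" using det_in_Ints[OF gram_Ints] by (auto elim: Ints_cases)
  have D0: "D \<noteq> 0" using det_gram D by auto
  define N where "N = nat (2 * \<bar>D\<bar>)"
  have N: "N \<ge> 1" "real N = 2 * \<bar>of_int D\<bar>" using D0 by (auto simp: N_def)
  have ent: "\<exists>z::int. (real N *\<^sub>R matrix_inv (gram B)) $ i $ j = 2 * of_int z" for i j
  proof -
    have "det (\<chi> a b. if b = i then of_bool (a = j) else gram B $ a $ b) \<in> \<int>"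
      by (rule det_in_Ints) (auto simp: gram_Ints)
    then obtain w :: int where w: "det (\<chi> a b. if b = i then of_bool (a = j) else gram B $ a $ b) = of_int w"
      by (auto elim: Ints_cases)
    have "(real N *\<^sub>R matrix_inv (gram B)) $ i $ j = 2 * of_int (sgn D * w)"
      using D0 by (simp add: matrix_inv_nth_det[OF det_gram] w D N(2) sgn_if abs_if)
    then show ?thesis by blast
  qed
  have "(real N *\<^sub>R matrix_inv (gram B)) $ i $ j \<in> \<int>" for i j
    using ent[of i j] by (metis Ints_of_int of_int_mult of_int_numeral)
  with ent N(1) show ?thesis by blast
qed

lemma level:
  shows level_ge_1: "lattice_level B \<ge> 1"
    and level_Ints: "real (lattice_level B) * gram (dual_basis B) $ i $ j \<in> \<int>"
    and level_even: "\<exists>z::int. real (lattice_level B) * gram (dual_basis B) $ i $ i = 2 * of_int z"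
  using LeastI_ex[OF level_exists, folded lattice_level_def] unfolding matrix_inv_gram[OF det_B] by auto

lemma level_matrix:
  obtains M :: "'m \<Rightarrow> 'm \<Rightarrow> int" where "\<And>i j. real (lattice_level B) * gram (dual_basis B) $ i $ j = of_int (M i j)"
proof -
  have "\<exists>k :: int. real (lattice_level B) * gram (dual_basis B) $ i $ j = of_int k" for i j
    by (rule Ints_cases[OF level_Ints[of i j]]) blast
  then have "\<exists>M. \<forall>i j. real (lattice_level B) * gram (dual_basis B) $ i $ j = of_int (M i j)"
    by (intro choice allI)
  then show ?thesis using that by blast
qed

lemma dual_basis_expand: "dual_basis B $ \<mu> = (\<Sum>\<nu>\<in>UNIV. gram (dual_basis B) $ \<mu> $ \<nu> *\<^sub>R B $ \<nu>)"
proof -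
  have "gram (dual_basis B) ** B = dual_basis B"
    unfolding gram_eq dual_basis_def transpose_transpose
    by (simp add: matrix_mul_assoc[symmetric] matrix_inv_left invertible_det_nz det_B)
  then have "dual_basis B $ \<mu> = (gram (dual_basis B) ** B) $ \<mu>" by simp
  also have "\<dots> = (\<Sum>\<nu>\<in>UNIV. gram (dual_basis B) $ \<mu> $ \<nu> *\<^sub>R B $ \<nu>)"
    by (simp add: matrix_matrix_mult_def vec_eq_iff)
  finally show ?thesis .
qed

lemma expand_dual_basis: "y = (\<Sum>\<mu>\<in>UNIV. (y \<bullet> B $ \<mu>) *\<^sub>R dual_basis B $ \<mu>)"
proof -
  have "y v* transpose B = (\<chi> \<mu>. y \<bullet> B $ \<mu>)"
    by (simp add: vector_matrix_mult_def transpose_def inner_vec_def vec_eq_iff mult.commute)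
  moreover have "y = (y v* transpose B) v* dual_basis B"
  proof -
    have "transpose B ** dual_basis B = transpose (matrix_inv B ** B)"
      by (simp add: dual_basis_def matrix_transpose_mul)
    then show ?thesis
      by (simp only: vector_matrix_mul_assoc) (simp add: matrix_inv_left invertible_det_nz det_B transpose_mat)
  qed
  ultimately have "y = (\<chi> \<mu>. y \<bullet> B $ \<mu>) v* dual_basis B" by simp
  also have "\<dots> = (\<Sum>\<mu>\<in>UNIV. (y \<bullet> B $ \<mu>) *\<^sub>R dual_basis B $ \<mu>)"
    by (simp add: vector_matrix_mult_def vec_eq_iff mult.commute)
  finally show ?thesis .
qed

lemma dual_eq: "dual = range (\<lambda>z :: int^'m. \<Sum>i\<in>UNIV. of_int (z $ i) *\<^sub>R dual_basis B $ i)"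
proof (intro equalityI subsetI)
  fix y assume "y \<in> dual"
  then have "\<forall>\<mu>. \<exists>z. y \<bullet> B $ \<mu> = of_int z" using B_in_L by (auto simp: dual_def elim!: Ints_cases)
  then obtain z where "\<And>\<mu>. y \<bullet> B $ \<mu> = of_int (z \<mu>)" by metis
  then show "y \<in> range (\<lambda>z :: int^'m. \<Sum>i\<in>UNIV. of_int (z $ i) *\<^sub>R dual_basis B $ i)"
    using expand_dual_basis[of y] by (intro range_eqI[of _ _ "\<chi> \<mu>. z \<mu>"]) simp
next
  fix y assume "y \<in> range (\<lambda>z :: int^'m. \<Sum>i\<in>UNIV. of_int (z $ i) *\<^sub>R dual_basis B $ i)"
  then obtain z :: "int^'m" where z: "y = (\<Sum>i\<in>UNIV. of_int (z $ i) *\<^sub>R dual_basis B $ i)" by blast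
  have db: "dual_basis B $ i \<bullet> B $ j = of_bool (j = i)" for i j
    by (subst inner_commute) (rule inner_dual_basis[OF det_B])
  have "y \<bullet> B $ j = of_int (z $ j)" for j
    by (simp add: z inner_sum_left db of_bool_def if_distrib cong: if_cong)
  then show "y \<in> dual" by (intro dualI) simp
qed

text \<open>The entries of the inverse Gram matrix are the coordinates of the dual basis in
  \<open>B\<close>, and the level makes them integral.\<close>

lemma level_dual_in_L:
  assumes "y \<in> dual"
  shows "real (lattice_level B) *\<^sub>R y \<in> L"
proof -
  obtain z :: "int^'m" where z: "y = (\<Sum>i\<in>UNIV. of_int (z $ i) *\<^sub>R dual_basis B $ i)"
    using assms unfolding dual_eq by blast
  obtain M :: "'m \<Rightarrow> 'm \<Rightarrow> int" where M: "\<And>i j. real (lattice_level B) * gram (dual_basis B) $ i $ j = of_int (M i j)"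
    by (rule level_matrix) blast
  have "real (lattice_level B) *\<^sub>R dual_basis B $ i = (\<Sum>j\<in>UNIV. of_int (M i j) *\<^sub>R B $ j)" for i
    unfolding M[symmetric] by (subst dual_basis_expand) (simp add: scaleR_sum_right)
  then have "real (lattice_level B) *\<^sub>R dual_basis B $ i \<in> L" for i
    by (simp only:) (intro L_sum B_in_L)
  then have "(\<Sum>i\<in>UNIV. of_int (z $ i) *\<^sub>R (real (lattice_level B) *\<^sub>R dual_basis B $ i)) \<in> L"
    by (intro L_sum)
  then show ?thesis by (simp add: z scaleR_sum_right mult.commute)
qed

text \<open>The point where the even diagonal in the definition of the level enters.\<close>

lemma level_dual_norm:
  assumes "y \<in> dual"
  shows "\<exists>w::int. real (lattice_level B) * (y \<bullet> y) = 2 * of_int w"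
proof -
  obtain z :: "int^'m" where z: "y = (\<Sum>i\<in>UNIV. of_int (z $ i) *\<^sub>R dual_basis B $ i)"
    using assms unfolding dual_eq by blast
  obtain M :: "'m \<Rightarrow> 'm \<Rightarrow> int" where M: "\<And>i j. real (lattice_level B) * gram (dual_basis B) $ i $ j = of_int (M i j)"
    by (rule level_matrix) blast
  have sym: "M i j = M j i" for i j
  proof -
    have "gram (dual_basis B) $ i $ j = gram (dual_basis B) $ j $ i" by (simp add: gram_def inner_commute)
    then show ?thesis using M[of i j] M[of j i] by simp
  qed
  have ev: "even (M i i)" for i
  proof -
    obtain w :: int where "of_int (M i i) = (2 * of_int w :: real)" using level_even[of i] M[of i i] by auto
    then have "of_int (M i i) = (of_int (2 * w) :: real)" by simp
    then show ?thesis by (simp only: of_int_eq_iff) simp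
  qed
  have "real (lattice_level B) * (y \<bullet> y) = (\<Sum>i\<in>UNIV. \<Sum>j\<in>UNIV. of_int (z $ i) * of_int (z $ j) * (real (lattice_level B) * gram (dual_basis B) $ i $ j))"
    by (subst sum.swap) (simp add: z inner_sum_left inner_sum_right gram_def sum_distrib_left mult_ac)
  also have "\<dots> = of_int (\<Sum>i\<in>UNIV. \<Sum>j\<in>UNIV. z $ i * z $ j * M i j)" unfolding M by simp
  finally have "real (lattice_level B) * (y \<bullet> y) = of_int (\<Sum>i\<in>UNIV. \<Sum>j\<in>UNIV. z $ i * z $ j * M i j)" .
  moreover obtain w where "(\<Sum>i\<in>UNIV. \<Sum>j\<in>UNIV. z $ i * z $ j * M i j) = 2 * w"
    using even_quadratic_form[of UNIV M "\<lambda>i. z $ i", OF finite sym ev] by (rule evenE)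
  ultimately show ?thesis by (metis of_int_mult of_int_numeral)
qed

end

section \<open>The partial dual lattice\<close>

lemma rat_vector_scale: "rat_vector B (c *s x) = of_rat c *\<^sub>R rat_vector B x"
  by (simp add: rat_vector_def of_rat_mult scaleR_sum_right)

lemma rat_vector_of_int: "rat_vector B (\<chi> i. of_int (z $ i)) = (\<Sum>i\<in>UNIV. of_int (z $ i) *\<^sub>R B $ i)"
  by (simp add: rat_vector_def)

lemma of_rat_in_Ints_iff: "(of_rat r :: real) \<in> \<int> \<longleftrightarrow> r \<in> \<int>"
proof
  assume "(of_rat r :: real) \<in> \<int>"
  then obtain n :: int where "of_rat r = (of_rat (of_int n) :: real)" by (auto elim!: Ints_cases)
  then show "r \<in> \<int>" by (simp only: of_rat_eq_iff Ints_of_int)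
qed (auto elim!: Ints_cases)

lemma inj_rat_vector:
  assumes "det B \<noteq> 0" "rat_vector B x = rat_vector B y"
  shows "x = y"
proof -
  have "rat_vector B x = (\<chi> i. of_rat (x $ i)) v* B" for x
    by (simp add: rat_vector_def vector_matrix_mult_def vec_eq_iff mult.commute)
  then have "(\<chi> i. of_rat (x $ i)) v* B = (\<chi> i. of_rat (y $ i)) v* B" using assms(2) by simp
  then have "(\<chi> i. of_rat (x $ i)) v* B v* matrix_inv B = (\<chi> i. of_rat (y $ i)) v* B v* matrix_inv B" by simp
  then have "(\<chi> i. (of_rat (x $ i) :: real)) = (\<chi> i. of_rat (y $ i))"
    using assms(1) by (simp add: vector_matrix_mul_assoc matrix_inv_right invertible_det_nz)
  then show ?thesis by (simp add: vec_eq_iff)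
qed

section \<open>Completions of lattices at a prime\<close>

locale padic_field =
  fixes p :: nat
  assumes p: "prime p"
begin

sublocale Qp: cring "Qp p" by (rule cring_Qp[OF p])

abbreviation emb :: "rat \<Rightarrow> padic" where "emb \<equiv> padic_of_rat p"

lemmas emb_closed [simp] = padic_of_rat_closed[OF p]
  and emb_add = padic_of_rat_add[OF p] and emb_mult = padic_of_rat_mult[OF p]
  and emb_0 = padic_of_rat_0[OF p] and emb_1 = padic_of_rat_1[OF p]
  and emb_Zp_iff = padic_of_rat_Zp_iff[OF p]
  and Zp_add = Zp_add[OF p] and Zp_mult = Zp_mult[OF p] and Zp_closed [simp] = Zp_closed[OF p]

lemma emb_int_Zp: "r \<in> \<int> \<Longrightarrow> emb r \<in> Zp p"
  by (auto simp: emb_Zp_iff padic_abs_of_int_le_1[OF p] elim!: Ints_cases)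

lemma Zp_zero: "\<zero>\<^bsub>Qp p\<^esub> \<in> Zp p" and Zp_one: "\<one>\<^bsub>Qp p\<^esub> \<in> Zp p"
  using emb_int_Zp[of 0] emb_int_Zp[of 1] by (simp_all add: emb_0 emb_1)

lemma Zp_minus:
  assumes "x \<in> Zp p"
  shows "\<ominus>\<^bsub>Qp p\<^esub> x \<in> Zp p"
proof -
  have "emb (-1) \<oplus>\<^bsub>Qp p\<^esub> emb 1 = \<zero>\<^bsub>Qp p\<^esub>" by (simp add: emb_0 flip: emb_add)
  then have "\<ominus>\<^bsub>Qp p\<^esub> \<one>\<^bsub>Qp p\<^esub> = emb (-1)"
    using Qp.minus_equality[of "emb (-1)" "\<one>\<^bsub>Qp p\<^esub>"] by (simp add: emb_1)
  then have "\<ominus>\<^bsub>Qp p\<^esub> x = emb (-1) \<otimes>\<^bsub>Qp p\<^esub> x"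
    using Qp.l_minus[of "\<one>\<^bsub>Qp p\<^esub>" x] assms by simp
  then show ?thesis using Zp_mult[OF emb_int_Zp[of "-1"] assms] by simp
qed

lemma emb_sum: "finite A \<Longrightarrow> emb (\<Sum>i\<in>A. f i) = (\<Oplus>\<^bsub>Qp p\<^esub>i\<in>A. emb (f i))"
  by (induction A rule: finite_induct) (simp_all add: emb_0 emb_add)

lemma Zp_finsum:
  assumes "finite A" "\<And>i. i \<in> A \<Longrightarrow> f i \<in> Zp p"
  shows "(\<Oplus>\<^bsub>Qp p\<^esub>i\<in>A. f i) \<in> Zp p"
  using assms
proof (induction A rule: finite_induct)
  case (insert a A)
  then show ?case by (subst Qp.finsum_insert) (auto intro: Zp_add)
qed (simp add: Zp_zero)

lemma finsum_swap:
  assumes "finite A" "finite C" "\<And>i j. f i j \<in> carrier (Qp p)"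
  shows "(\<Oplus>\<^bsub>Qp p\<^esub>i\<in>A. \<Oplus>\<^bsub>Qp p\<^esub>j\<in>C. f i j) = (\<Oplus>\<^bsub>Qp p\<^esub>j\<in>C. \<Oplus>\<^bsub>Qp p\<^esub>i\<in>A. f i j)"
  using assms(1)
proof (induction A rule: finite_induct)
  case (insert a A)
  have "(\<Oplus>\<^bsub>Qp p\<^esub>j\<in>C. \<Oplus>\<^bsub>Qp p\<^esub>i\<in>insert a A. f i j) = (\<Oplus>\<^bsub>Qp p\<^esub>j\<in>C. f a j \<oplus>\<^bsub>Qp p\<^esub> (\<Oplus>\<^bsub>Qp p\<^esub>i\<in>A. f i j))"
    using insert.hyps assms(3) by (intro Qp.finsum_cong') (auto simp: Qp.finsum_insert)
  also have "\<dots> = (\<Oplus>\<^bsub>Qp p\<^esub>j\<in>C. f a j) \<oplus>\<^bsub>Qp p\<^esub> (\<Oplus>\<^bsub>Qp p\<^esub>j\<in>C. \<Oplus>\<^bsub>Qp p\<^esub>i\<in>A. f i j)"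
    by (rule Qp.finsum_addf) (use assms(3) in auto)
  finally show ?case using insert assms(3) by (simp add: Qp.finsum_insert)
qed simp

text \<open>Forms with rational coefficients express all local conditions below: pairings with basis
  vectors of \<open>L\<close>, and coordinates with respect to a lattice.\<close>

definition lform :: "('i::finite \<Rightarrow> rat) \<Rightarrow> padic^'i \<Rightarrow> padic" where
  "lform R x = (\<Oplus>\<^bsub>Qp p\<^esub>i\<in>UNIV. x $ i \<otimes>\<^bsub>Qp p\<^esub> emb (R i))"

lemma lform_closed: "(\<And>i. x $ i \<in> carrier (Qp p)) \<Longrightarrow> lform R x \<in> carrier (Qp p)"
  unfolding lform_def by (intro Qp.finsum_closed) auto

lemma lform_add:
  assumes "\<And>i. x $ i \<in> carrier (Qp p)" "\<And>i. y $ i \<in> carrier (Qp p)"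
  shows "lform R (\<chi> i. x $ i \<oplus>\<^bsub>Qp p\<^esub> y $ i) = lform R x \<oplus>\<^bsub>Qp p\<^esub> lform R y"
proof -
  have "lform R (\<chi> i. x $ i \<oplus>\<^bsub>Qp p\<^esub> y $ i) = (\<Oplus>\<^bsub>Qp p\<^esub>i\<in>UNIV. x $ i \<otimes>\<^bsub>Qp p\<^esub> emb (R i) \<oplus>\<^bsub>Qp p\<^esub> y $ i \<otimes>\<^bsub>Qp p\<^esub> emb (R i))"
    unfolding lform_def using assms by (intro Qp.finsum_cong') (auto simp: Qp.l_distr)
  also have "\<dots> = lform R x \<oplus>\<^bsub>Qp p\<^esub> lform R y"
    unfolding lform_def using assms by (intro Qp.finsum_addf) auto
  finally show ?thesis .
qed

lemma lform_emb: "lform R (\<chi> i. emb (q $ i)) = emb (\<Sum>i\<in>UNIV. q $ i * R i)"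
  by (simp add: lform_def emb_sum emb_mult)

lemma lform_smult_emb:
  assumes z: "z \<in> carrier (Qp p)"
  shows "lform R (\<chi> i. z \<otimes>\<^bsub>Qp p\<^esub> emb (q $ i)) = z \<otimes>\<^bsub>Qp p\<^esub> emb (\<Sum>i\<in>UNIV. q $ i * R i)"
proof -
  have "lform R (\<chi> i. z \<otimes>\<^bsub>Qp p\<^esub> emb (q $ i)) = (\<Oplus>\<^bsub>Qp p\<^esub>i\<in>UNIV. z \<otimes>\<^bsub>Qp p\<^esub> emb (q $ i * R i))"
    unfolding lform_def using z by (intro Qp.finsum_cong') (auto simp: Qp.m_assoc emb_mult)
  also have "\<dots> = z \<otimes>\<^bsub>Qp p\<^esub> (\<Oplus>\<^bsub>Qp p\<^esub>i\<in>UNIV. emb (q $ i * R i))"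
    using z by (intro Qp.finsum_rdistr[symmetric]) auto
  finally show ?thesis by (simp add: emb_sum)
qed

lemma tensor_closed:
  assumes "x \<in> tensor_Zp B p K"
  shows "x $ i \<in> carrier (Qp p)"
  using assms by (induction rule: tensor_Zp.induct) auto

text \<open>The integrality test for completions: a form that is integral on the generators
  \<open>K\<close> has p-adic integral values on their span.\<close>

lemma tensor_lform_Zp:
  assumes "x \<in> tensor_Zp B p K" and R: "\<And>q. rat_vector B q \<in> K \<Longrightarrow> (\<Sum>i\<in>UNIV. q $ i * R i) \<in> \<int>"
  shows "lform R x \<in> Zp p"
  using assms(1)
proof (induction rule: tensor_Zp.induct)
  case zero
  have "lform R (\<chi> i. emb ((0 :: rat^'a) $ i)) = emb 0" by (simp only: lform_emb) simp
  then show ?case using Zp_zero by (simp add: emb_0)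
next
  case (add x z q)
  have "lform R (\<chi> i. x $ i \<oplus>\<^bsub>Qp p\<^esub> (\<chi> i. z \<otimes>\<^bsub>Qp p\<^esub> emb (q $ i)) $ i) = lform R x \<oplus>\<^bsub>Qp p\<^esub> lform R (\<chi> i. z \<otimes>\<^bsub>Qp p\<^esub> emb (q $ i))"
    by (rule lform_add) (use tensor_closed[OF add.hyps(1)] add.hyps(2) in auto)
  then show ?case
    using add by (simp add: lform_smult_emb) (intro Zp_add Zp_mult emb_int_Zp R add)
qed

lemma tensor_add:
  assumes "x \<in> tensor_Zp B p K" "y \<in> tensor_Zp B p K"
  shows "(\<chi> i. x $ i \<oplus>\<^bsub>Qp p\<^esub> y $ i) \<in> tensor_Zp B p K"
  using assms(2)
proof (induction rule: tensor_Zp.induct)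
  case zero
  have "(\<chi> i. x $ i \<oplus>\<^bsub>Qp p\<^esub> (\<chi> i. \<zero>\<^bsub>Qp p\<^esub>) $ i) = x"
    using tensor_closed[OF assms(1)] by (simp add: vec_eq_iff)
  then show ?case using assms(1) by simp
next
  case (add y z q)
  have "(\<chi> i. x $ i \<oplus>\<^bsub>Qp p\<^esub> (\<chi> i. y $ i \<oplus>\<^bsub>Qp p\<^esub> z \<otimes>\<^bsub>Qp p\<^esub> emb (q $ i)) $ i) =
    (\<chi> i. (\<chi> i. x $ i \<oplus>\<^bsub>Qp p\<^esub> y $ i) $ i \<oplus>\<^bsub>Qp p\<^esub> z \<otimes>\<^bsub>Qp p\<^esub> emb (q $ i))"
    using tensor_closed[OF assms(1)] tensor_closed[OF add.hyps(1)] add.hyps(2) by (simp add: vec_eq_iff Qp.a_assoc)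
  then show ?case using tensor_Zp.add[OF add.IH add.hyps(2,3)] by simp
qed

lemma tensor_gen:
  assumes "z \<in> Zp p" "rat_vector B q \<in> K"
  shows "(\<chi> i. z \<otimes>\<^bsub>Qp p\<^esub> emb (q $ i)) \<in> tensor_Zp B p K"
  using tensor_Zp.add[OF tensor_Zp.zero assms] assms(1) by simp

text \<open>Inclusions between completions need to be checked on generators only.\<close>

lemma tensor_mono:
  assumes "x \<in> tensor_Zp B p K" and "\<And>z q. z \<in> Zp p \<Longrightarrow> rat_vector B q \<in> K \<Longrightarrow> (\<chi> i. z \<otimes>\<^bsub>Qp p\<^esub> emb (q $ i)) \<in> tensor_Zp B p K'"
  shows "x \<in> tensor_Zp B p K'"
  using assms(1)
proof (induction rule: tensor_Zp.induct)
  case zero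
  show ?case by (rule tensor_Zp.zero)
next
  case (add x z q)
  have "(\<chi> i. x $ i \<oplus>\<^bsub>Qp p\<^esub> (\<chi> i. z \<otimes>\<^bsub>Qp p\<^esub> emb (q $ i)) $ i) \<in> tensor_Zp B p K'"
    by (intro tensor_add add assms)
  then show ?case by simp
qed

text \<open>The vector is built up one coordinate at a time, each time adding a multiple of a basis
  vector.\<close>

lemma Zp_vectors_in_tensor:
  assumes x: "\<And>i. x $ i \<in> Zp p" and K: "\<And>i. B $ i \<in> K"
  shows "x \<in> tensor_Zp B p K"
proof -
  have "(\<chi> i. if i \<in> J then x $ i else \<zero>\<^bsub>Qp p\<^esub>) \<in> tensor_Zp B p K" for J
    using finite[of J]
  proof (induction J rule: finite_induct)
    case empty
    then show ?case using tensor_Zp.zero by simp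
  next
    case (insert j J)
    have "rat_vector B (axis j 1) = B $ j"
      by (simp add: rat_vector_def axis_def if_distrib if_distribR cong: if_cong)
    then have "rat_vector B (axis j 1) \<in> K" using K by simp
    from tensor_Zp.add[OF insert.IH x[of j] this]
    have "(\<chi> i. (\<chi> i. if i \<in> J then x $ i else \<zero>\<^bsub>Qp p\<^esub>) $ i \<oplus>\<^bsub>Qp p\<^esub> x $ j \<otimes>\<^bsub>Qp p\<^esub> emb (axis j 1 $ i)) \<in> tensor_Zp B p K" .
    also have "(\<chi> i. (\<chi> i. if i \<in> J then x $ i else \<zero>\<^bsub>Qp p\<^esub>) $ i \<oplus>\<^bsub>Qp p\<^esub> x $ j \<otimes>\<^bsub>Qp p\<^esub> emb (axis j 1 $ i)) =
      (\<chi> i. if i \<in> insert j J then x $ i else \<zero>\<^bsub>Qp p\<^esub>)"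
      using insert.hyps x by (auto simp: vec_eq_iff axis_def emb_0 emb_1)
    finally show ?case .
  qed
  from this[of UNIV] show ?thesis by simp
qed

end

context even_lattice
begin

text \<open>The indices are ordered so that \<open>gram_rat j\<close> is the coefficient function of
  the pairing with the \<open>j\<close>-th basis vector, ready for \<open>lform\<close>; the floor
  matches \<open>inner_Qp\<close>.\<close>

definition gram_rat :: "'m \<Rightarrow> 'm \<Rightarrow> rat" where
  "gram_rat j i = of_int \<lfloor>gram B $ i $ j\<rfloor>"

lemma of_rat_gram_rat: "of_rat (gram_rat j i) = gram B $ i $ j"
  using gram_Ints[of i j] by (auto simp: gram_rat_def elim!: Ints_cases)

lemma rat_vector_inner_B: "rat_vector B q \<bullet> B $ j = of_rat (\<Sum>i\<in>UNIV. q $ i * gram_rat j i)"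
  by (simp add: rat_vector_def inner_sum_left of_rat_sum of_rat_mult of_rat_gram_rat gram_def)

lemma L_rat: "L \<subseteq> range (rat_vector B)"
  unfolding L_eq by (auto simp: rat_vector_of_int[symmetric])

lemma rat_vector_in_L: "rat_vector B q \<in> L \<Longrightarrow> q $ i \<in> \<int>"
proof -
  assume "rat_vector B q \<in> L"
  then obtain z :: "int^'m" where "rat_vector B q = rat_vector B (\<chi> i. of_int (z $ i))"
    unfolding L_eq rat_vector_of_int by blast
  from inj_rat_vector[OF det_B this] show ?thesis by simp
qed

text \<open>Pairing with the completion of \<open>L\<close> is integral as soon as the pairings with
  the basis vectors are, since the completion consists of vectors with p-adic integral
  coordinates.\<close>

lemma dual_Zp_tensor:
  assumes p: "prime p"
  shows "x \<in> dual_Zp B p (tensor_Zp B p L) \<longleftrightarrow>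
    (\<forall>i. x $ i \<in> carrier (Qp p)) \<and> (\<forall>j. padic_field.lform p (gram_rat j) x \<in> Zp p)"
proof -
  interpret padic_field p by unfold_locales (rule p)
  have inner: "inner_Qp B p x y = (\<Oplus>\<^bsub>Qp p\<^esub>j\<in>UNIV. lform (gram_rat j) x \<otimes>\<^bsub>Qp p\<^esub> y $ j)"
    if x: "\<And>i. x $ i \<in> carrier (Qp p)" and y: "\<And>i. y $ i \<in> carrier (Qp p)" for y
  proof -
    have "inner_Qp B p x y = (\<Oplus>\<^bsub>Qp p\<^esub>j\<in>UNIV. \<Oplus>\<^bsub>Qp p\<^esub>i\<in>UNIV. x $ i \<otimes>\<^bsub>Qp p\<^esub> emb (gram_rat j i) \<otimes>\<^bsub>Qp p\<^esub> y $ j)"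
      unfolding inner_Qp_def gram_rat_def[symmetric] by (rule finsum_swap) (use x y in auto)
    also have "\<dots> = (\<Oplus>\<^bsub>Qp p\<^esub>j\<in>UNIV. lform (gram_rat j) x \<otimes>\<^bsub>Qp p\<^esub> y $ j)"
      unfolding lform_def using x y
      by (intro Qp.finsum_cong') (auto simp: Qp.finsum_ldistr intro!: Qp.finsum_closed)
    finally show ?thesis .
  qed
  show ?thesis
  proof
    assume xd: "x \<in> dual_Zp B p (tensor_Zp B p L)"
    then have xc: "\<And>i. x $ i \<in> carrier (Qp p)" by (simp add: dual_Zp_def)
    have "lform (gram_rat j) x \<in> Zp p" for j
    proof -
      \<comment> \<open>Testing against the \<open>j\<close>-th unit vector isolates the
        \<open>j\<close>-th form.\<close>
      define e where "e = (\<chi> i. if i = j then \<one>\<^bsub>Qp p\<^esub> else \<zero>\<^bsub>Qp p\<^esub>)"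
      have "e \<in> tensor_Zp B p L" by (rule Zp_vectors_in_tensor) (auto simp: e_def Zp_zero Zp_one B_in_L)
      then have "inner_Qp B p x e \<in> Zp p" using xd by (simp add: dual_Zp_def)
      also have "inner_Qp B p x e = (\<Oplus>\<^bsub>Qp p\<^esub>l\<in>UNIV. lform (gram_rat l) x \<otimes>\<^bsub>Qp p\<^esub> e $ l)"
        by (rule inner[OF xc]) (simp add: e_def)
      also have "\<dots> = (\<Oplus>\<^bsub>Qp p\<^esub>l\<in>UNIV. if j = l then lform (gram_rat l) x else \<zero>\<^bsub>Qp p\<^esub>)"
        by (rule Qp.finsum_cong') (use lform_closed[OF xc] in \<open>auto simp: e_def\<close>)
      also have "\<dots> = lform (gram_rat j) x"
        by (rule Qp.finsum_singleton) (use lform_closed[OF xc] in auto)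
      finally show ?thesis .
    qed
    with xc show "(\<forall>i. x $ i \<in> carrier (Qp p)) \<and> (\<forall>j. lform (gram_rat j) x \<in> Zp p)" by blast
  next
    assume x: "(\<forall>i. x $ i \<in> carrier (Qp p)) \<and> (\<forall>j. lform (gram_rat j) x \<in> Zp p)"
    have "inner_Qp B p x y \<in> Zp p" if y: "y \<in> tensor_Zp B p L" for y
    proof -
      have "y $ j \<in> Zp p" for j
      proof -
        \<comment> \<open>The projection to coordinate \<open>j\<close>, written as a form that is
          integral on \<open>L\<close>.\<close>
        have "lform (\<lambda>i. if j = i then 1 else 0) y \<in> Zp p"
        proof (rule tensor_lform_Zp[OF y])
          fix q assume "rat_vector B q \<in> L"
          then show "(\<Sum>i\<in>UNIV. q $ i * (if j = i then 1 else 0)) \<in> \<int>"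
            using rat_vector_in_L[of q j] by (simp add: if_distrib cong: if_cong)
        qed
        also have "lform (\<lambda>i. if j = i then 1 else 0) y = (\<Oplus>\<^bsub>Qp p\<^esub>i\<in>UNIV. if j = i then y $ i else \<zero>\<^bsub>Qp p\<^esub>)"
          unfolding lform_def using tensor_closed[OF y] by (intro Qp.finsum_cong') (auto simp: emb_0 emb_1)
        also have "\<dots> = y $ j"
          by (rule Qp.finsum_singleton) (use tensor_closed[OF y] in auto)
        finally show ?thesis .
      qed
      then show ?thesis using x tensor_closed[OF y] by (subst inner) (auto intro!: Zp_finsum Zp_mult)
    qed
    with x show "x \<in> dual_Zp B p (tensor_Zp B p L)" by (simp add: dual_Zp_def)
  qed
qed

end

section \<open>The global lattice L' and its completions\<close>

locale lattice_divisor = even_lattice L B for L :: "(real^'m) set" and B :: "real^'m^'m" +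
  fixes d c :: nat
  assumes level_dc: "lattice_level B = d * c" and cop: "coprime d c"
begin

definition pdual :: "(real^'m) set" where
  "pdual = {y \<in> dual. real d *\<^sub>R y \<in> L}"

lemma dc_pos: "d > 0" "c > 0"
  using level_ge_1 unfolding level_dc by (simp_all add: Suc_le_eq)

lemma L_subset_pdual: "L \<subseteq> pdual"
  using L_subset_dual L_scale[of _ "int d"] by (auto simp: pdual_def)

lemma is_lattice_pdual: "is_lattice pdual"
proof (rule is_lattice_between[OF basis L_subset_pdual dc_pos(1)])
  fix x y assume "x \<in> pdual" "y \<in> pdual"
  then show "x - y \<in> pdual" by (auto simp: pdual_def scaleR_diff_right intro: dual_diff L_diff)
qed (auto simp: pdual_def)

lemma pdual_rat: "pdual \<subseteq> range (rat_vector B)"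
proof
  fix y assume "y \<in> pdual"
  then obtain q where "real d *\<^sub>R y = rat_vector B q" using L_rat by (auto simp: pdual_def)
  then have "rat_vector B ((1 / of_nat d) *s q) = (1 / real d) *\<^sub>R (real d *\<^sub>R y)"
    by (simp add: rat_vector_scale of_rat_divide)
  also have "\<dots> = y" using dc_pos by simp
  finally show "y \<in> range (rat_vector B)" by (metis rangeI)
qed

text \<open>Here \<open>d\<close> is a p-adic unit, and \<open>d\<close> times \<open>pdual\<close>
  lies in \<open>L\<close>.\<close>

lemma tensor_pdual_not_dvd:
  assumes p: "prime p" and pd: "\<not> p dvd d"
  shows "tensor_Zp B p pdual = tensor_Zp B p L"
proof (intro equalityI subsetI)
  interpret padic_field p by unfold_locales (rule p)
  fix x assume x: "x \<in> tensor_Zp B p pdual"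
  show "x \<in> tensor_Zp B p L"
  proof (rule tensor_mono[OF x])
    fix z q assume z: "z \<in> Zp p" and q: "rat_vector B q \<in> pdual"
    have d: "emb (1 / of_nat d) \<in> Zp p"
      unfolding emb_Zp_iff padic_abs_le_1_iff[OF p] using pd
      by (intro exI[of _ 1] exI[of _ "int d"]) simp
    have "rat_vector B (of_nat d *s q) \<in> L" using q by (simp add: pdual_def rat_vector_scale)
    from tensor_gen[OF Zp_mult[OF z d] this]
    have "(\<chi> i. z \<otimes>\<^bsub>Qp p\<^esub> emb (1 / of_nat d) \<otimes>\<^bsub>Qp p\<^esub> emb ((of_nat d *s q) $ i)) \<in> tensor_Zp B p L" .
    moreover have "z \<otimes>\<^bsub>Qp p\<^esub> emb (1 / of_nat d) \<otimes>\<^bsub>Qp p\<^esub> emb ((of_nat d *s q) $ i) = z \<otimes>\<^bsub>Qp p\<^esub> emb (q $ i)" for i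
      using z dc_pos by (simp add: Qp.m_assoc flip: emb_mult)
    ultimately show "(\<chi> i. z \<otimes>\<^bsub>Qp p\<^esub> emb (q $ i)) \<in> tensor_Zp B p L" by simp
  qed
next
  interpret padic_field p by unfold_locales (rule p)
  fix x assume x: "x \<in> tensor_Zp B p L"
  show "x \<in> tensor_Zp B p pdual"
    by (rule tensor_mono[OF x]) (use L_subset_pdual in \<open>auto intro: tensor_gen\<close>)
qed

text \<open>Here \<open>c\<close> is a p-adic unit by coprimality, and \<open>c\<close> times the
  global dual lies in \<open>pdual\<close>. To reach the global dual from a local vector, the vector
  is written as an integral one plus a rational one, and the denominators prime to \<open>p\<close>
  are cleared from the pairings of the latter.\<close>

lemma tensor_pdual_dvd:
  assumes p: "prime p" and pd: "p dvd d"
  shows "tensor_Zp B p pdual = dual_Zp B p (tensor_Zp B p L)"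
proof (intro equalityI subsetI)
  interpret padic_field p by unfold_locales (rule p)
  fix x assume x: "x \<in> tensor_Zp B p pdual"
  show "x \<in> dual_Zp B p (tensor_Zp B p L)"
    unfolding dual_Zp_tensor[OF p]
  proof (intro conjI allI)
    show "x $ i \<in> carrier (Qp p)" for i by (rule tensor_closed[OF x])
    show "lform (gram_rat j) x \<in> Zp p" for j
    proof (rule tensor_lform_Zp[OF x])
      fix q assume "rat_vector B q \<in> pdual"
      then have "rat_vector B q \<bullet> B $ j \<in> \<int>" using B_in_L by (auto simp: pdual_def dual_def)
      then show "(\<Sum>i\<in>UNIV. q $ i * gram_rat j i) \<in> \<int>"
        unfolding rat_vector_inner_B of_rat_in_Ints_iff .
    qed
  qed
next
  interpret padic_field p by unfold_locales (rule p)
  fix x assume "x \<in> dual_Zp B p (tensor_Zp B p L)"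
  then have xc: "\<And>i. x $ i \<in> carrier (Qp p)" and xd: "\<And>j. lform (gram_rat j) x \<in> Zp p"
    unfolding dual_Zp_tensor[OF p] by auto
  have "\<forall>i. \<exists>z r. z \<in> Zp p \<and> x $ i = z \<oplus>\<^bsub>Qp p\<^esub> emb r"
    using Qp_decompose[OF p xc] by metis
  then obtain z r where zr: "\<And>i. z i \<in> Zp p" "\<And>i. x $ i = z i \<oplus>\<^bsub>Qp p\<^esub> emb (r i)" by metis
  define zv where "zv = (\<chi> i. z i)"
  define rv where "rv = (\<chi> i. r i)"
  have x_eq: "x = (\<chi> i. zv $ i \<oplus>\<^bsub>Qp p\<^esub> (\<chi> i. emb (rv $ i)) $ i)" by (simp add: vec_eq_iff zr zv_def rv_def)
  have zT: "zv \<in> tensor_Zp B p K" if "\<And>i. B $ i \<in> K" for K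
    by (rule Zp_vectors_in_tensor) (use zr that in \<open>auto simp: zv_def\<close>)
  have "padic_abs p (\<Sum>i\<in>UNIV. rv $ i * gram_rat j i) \<le> 1" for j
  proof -
    have z1: "lform (gram_rat j) zv \<in> Zp p"
    proof (rule tensor_lform_Zp[OF zT[OF B_in_L]])
      fix q assume "rat_vector B q \<in> L"
      then show "(\<Sum>i\<in>UNIV. q $ i * gram_rat j i) \<in> \<int>"
        by (intro Ints_sum Ints_mult rat_vector_in_L) (auto simp: gram_rat_def)
    qed
    have "lform (gram_rat j) x = lform (gram_rat j) zv \<oplus>\<^bsub>Qp p\<^esub> emb (\<Sum>i\<in>UNIV. rv $ i * gram_rat j i)"
      by (subst x_eq, subst lform_add) (use zr in \<open>auto simp: lform_emb zv_def\<close>)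
    then have "emb (\<Sum>i\<in>UNIV. rv $ i * gram_rat j i) = \<ominus>\<^bsub>Qp p\<^esub> lform (gram_rat j) zv \<oplus>\<^bsub>Qp p\<^esub> lform (gram_rat j) x"
      using z1 by (simp add: Qp.r_neg1)
    then have "emb (\<Sum>i\<in>UNIV. rv $ i * gram_rat j i) \<in> Zp p"
      using z1 xd by (simp add: Zp_add Zp_minus)
    then show ?thesis by (simp only: emb_Zp_iff)
  qed
  \<comment> \<open>One integer prime to \<open>p\<close> makes all pairings of the rational part
    with the basis integral, so \<open>s\<close> times that part lies in the global dual.\<close>
  then obtain s where s: "\<not> int p dvd s" "\<And>j. of_int s * (\<Sum>i\<in>UNIV. rv $ i * gram_rat j i) \<in> \<int>"
    using padic_integral_common_denominator[OF p, of UNIV "\<lambda>j. \<Sum>i\<in>UNIV. rv $ i * gram_rat j i"] by auto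
  define y where "y = rat_vector B (of_int s *s rv)"
  have "y \<in> dual"
  proof (rule dualI)
    fix j
    have "(\<Sum>i\<in>UNIV. (of_int s *s rv) $ i * gram_rat j i) \<in> \<int>"
      using s(2)[of j] by (simp add: sum_distrib_left mult.assoc)
    then show "y \<bullet> B $ j \<in> \<int>" unfolding y_def rat_vector_inner_B of_rat_in_Ints_iff .
  qed
  \<comment> \<open>Multiplication by \<open>c\<close> suffices because \<open>d * c\<close> is the
    level; the total factor \<open>c * s\<close> stays prime to \<open>p\<close> and is inverted
    below.\<close>
  then have "real c *\<^sub>R y \<in> pdual"
    using dual_scale[of y "int c"] level_dual_in_L[of y] by (simp add: pdual_def level_dc)
  then have cs: "rat_vector B (of_int (int c * s) *s rv) \<in> pdual"
    by (simp add: y_def rat_vector_scale of_rat_mult)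
  have pcs: "\<not> int p dvd int c * s"
  proof -
    have "\<not> p dvd c" using pd cop p by (metis coprime_common_divisor_nat not_prime_1)
    then show ?thesis using s(1) p by (simp add: prime_dvd_mult_iff)
  qed
  then have cs0: "int c * s \<noteq> 0" by (metis dvd_0_right)
  have "emb (1 / of_int (int c * s)) \<in> Zp p"
    unfolding emb_Zp_iff padic_abs_le_1_iff[OF p] using pcs
    by (intro exI[of _ 1] exI[of _ "int c * s"]) simp
  from tensor_gen[OF this cs]
  have "(\<chi> i. emb (1 / of_int (int c * s)) \<otimes>\<^bsub>Qp p\<^esub> emb ((of_int (int c * s) *s rv) $ i)) \<in> tensor_Zp B p pdual" .
  moreover have "emb (1 / of_int (int c * s)) \<otimes>\<^bsub>Qp p\<^esub> emb ((of_int (int c * s) *s rv) $ i) = emb (rv $ i)" for i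
    using cs0 by (simp flip: emb_mult)
  ultimately have "(\<chi> i. emb (rv $ i)) \<in> tensor_Zp B p pdual" by simp
  then show "x \<in> tensor_Zp B p pdual"
    by (subst x_eq) (intro tensor_add zT, use B_in_L L_subset_pdual in auto)
qed

lemma partial_dual_pdual: "partial_dual B L d pdual"
  unfolding partial_dual_def by (simp add: is_lattice_pdual pdual_rat tensor_pdual_dvd tensor_pdual_not_dvd)

end

text \<open>The coordinates of an element of \<open>K1\<close> with respect to a basis of \<open>K2\<close> are rational numbers that
  are \<open>p\<close>-integral for every \<open>p\<close>.\<close>

lemma lattice_subset_if_tensor_eq:
  fixes B :: "real^'m^'m"
  assumes det: "det B \<noteq> 0" and K1: "K1 \<subseteq> range (rat_vector B)" and K2: "is_lattice K2" "K2 \<subseteq> range (rat_vector B)"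
    and eq: "\<And>p. prime p \<Longrightarrow> tensor_Zp B p K1 = tensor_Zp B p K2"
  shows "K1 \<subseteq> K2"
proof
  obtain C where C: "lattice_basis C K2" using K2(1) by (auto simp: is_lattice_def)
  have K2_eq: "K2 = range (\<lambda>z :: int^'m. \<Sum>i\<in>UNIV. of_int (z $ i) *\<^sub>R C $ i)"
    using C by (simp add: lattice_basis_def)
  have "C $ i \<in> K2" for i
    unfolding K2_eq by (rule range_eqI[of _ _ "axis i 1"]) (simp add: axis_def if_distrib if_distribR cong: if_cong)
  then have "\<forall>i. \<exists>q. C $ i = rat_vector B q" using K2(2) by blast
  then obtain P' where P': "\<And>i. C $ i = rat_vector B (P' i)" by metis
  \<comment> \<open>The rows are the coordinates in \<open>B\<close> of the basis \<open>C\<close>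
    of \<open>K2\<close>; they are rational as \<open>K2\<close> lies in the rational span of
    \<open>B\<close>.\<close>
  define P :: "rat^'m^'m" where "P = (\<chi> i. P' i)"
  have comb: "rat_vector B (t v* P) = (\<Sum>j\<in>UNIV. of_rat (t $ j) *\<^sub>R C $ j)" for t
  proof -
    have "rat_vector B (t v* P) = (\<Sum>i\<in>UNIV. \<Sum>j\<in>UNIV. (of_rat (t $ j) * of_rat (P $ j $ i)) *\<^sub>R B $ i)"
      by (simp add: rat_vector_def vector_matrix_mult_def of_rat_sum of_rat_mult scaleR_sum_left mult.commute)
    also have "\<dots> = (\<Sum>j\<in>UNIV. \<Sum>i\<in>UNIV. (of_rat (t $ j) * of_rat (P $ j $ i)) *\<^sub>R B $ i)"
      by (rule sum.swap)
    also have "\<dots> = (\<Sum>j\<in>UNIV. of_rat (t $ j) *\<^sub>R C $ j)"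
      by (simp add: P' P_def rat_vector_def scaleR_sum_right)
    finally show ?thesis .
  qed
  have "det P \<noteq> 0"
  proof
    assume "det P = 0"
    moreover have "det (map_matrix of_rat P :: real^'m^'m) = of_rat (det P)"
      unfolding det_def map_matrix_def by (simp add: of_rat_sum of_rat_mult of_rat_prod)
    moreover have "C = map_matrix of_rat P ** B"
      by (simp add: vec_eq_iff map_matrix_def matrix_matrix_mult_def P' P_def rat_vector_def)
    ultimately have "det C = 0" by (simp add: det_mul)
    then show False using lattice_basis_det[OF C] by simp
  qed
  then have inv: "invertible P" by (simp add: invertible_det_nz)
  \<comment> \<open>\<open>q v* R\<close> consists of the coordinates in \<open>C\<close> of the
    vector with coordinates \<open>q\<close> in \<open>B\<close>.\<close>
  define R where "R = matrix_inv P"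
  have R: "(\<Sum>i\<in>UNIV. q $ i * R $ i $ j) = (q v* R) $ j" for q j
    by (simp add: vector_matrix_mult_def)
  have K2_int: "(q v* R) $ j \<in> \<int>" if q: "rat_vector B q \<in> K2" for q j
  proof -
    obtain z :: "int^'m" where "rat_vector B q = (\<Sum>i\<in>UNIV. of_int (z $ i) *\<^sub>R C $ i)"
      using q unfolding K2_eq by blast
    also have "\<dots> = rat_vector B ((\<chi> i. of_int (z $ i)) v* P)" by (simp add: comb)
    finally have "q = (\<chi> i. of_int (z $ i)) v* P" by (rule inj_rat_vector[OF det])
    then have "q v* R = (\<chi> i. of_int (z $ i))"
      by (simp only: R_def vector_matrix_mul_assoc) (simp add: matrix_inv_right[OF inv])
    then show ?thesis by simp
  qed
  fix y assume y: "y \<in> K1"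
  then obtain q where q: "y = rat_vector B q" using K1 by blast
  have "(q v* R) $ j \<in> \<int>" for j
  proof (rule rat_int_if_padic_integral)
    fix p :: nat assume p: "prime p"
    interpret padic_field p by unfold_locales (rule p)
    have "(\<chi> i. \<one>\<^bsub>Qp p\<^esub> \<otimes>\<^bsub>Qp p\<^esub> emb (q $ i)) \<in> tensor_Zp B p K1"
      by (rule tensor_gen) (use y q Zp_one in auto)
    then have "(\<chi> i. emb (q $ i)) \<in> tensor_Zp B p K2" by (simp add: eq[OF p])
    \<comment> \<open>Column \<open>j\<close> of \<open>R\<close> is a rational form that is
      integral on \<open>K2\<close>, so the integrality test applies to \<open>y\<close>, viewed in
      the completion of \<open>K2\<close>.\<close>
    then have "lform (\<lambda>i. R $ i $ j) (\<chi> i. emb (q $ i)) \<in> Zp p"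
      by (rule tensor_lform_Zp) (simp add: R K2_int)
    then show "padic_abs p ((q v* R) $ j) \<le> 1" by (simp add: lform_emb R emb_Zp_iff)
  qed
  then have "\<forall>j. \<exists>z. (q v* R) $ j = of_int z" by (auto elim!: Ints_cases)
  then obtain z where z: "\<And>j. (q v* R) $ j = of_int (z j)" by metis
  have "q = (q v* R) v* P"
    by (simp only: R_def vector_matrix_mul_assoc) (simp add: matrix_inv_left[OF inv])
  then have "y = (\<Sum>j\<in>UNIV. of_rat ((q v* R) $ j) *\<^sub>R C $ j)" unfolding q using comb by metis
  also have "\<dots> = (\<Sum>j\<in>UNIV. of_int ((\<chi> j. z j) $ j) *\<^sub>R C $ j)" by (simp add: z)
  also have "\<dots> \<in> K2" unfolding K2_eq by blast
  finally show "y \<in> K2" .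
qed

lemma partial_dual_unique:
  assumes "det B \<noteq> 0" "partial_dual B L d K1" "partial_dual B L d K2"
  shows "K1 = K2"
proof (rule equalityI)
  show "K1 \<subseteq> K2" "K2 \<subseteq> K1"
    by (rule lattice_subset_if_tensor_eq[OF assms(1)]; use assms(2,3) in \<open>simp add: partial_dual_def\<close>)+
qed

section \<open>Gauss sums and the transformation of theta series\<close>

lemma cis_pi_add_even: "cis (pi * (x + 2 * of_int z)) = cis (pi * x)"
proof -
  have "cis (pi * (x + 2 * of_int z)) = cis (pi * x) * cis (2 * pi * of_int z)"
    by (simp add: cis_mult algebra_simps)
  then show ?thesis by (simp add: cis_multiple_2pi)
qed

lemma bij_betw_lat:
  fixes C :: "real^'m^'m"
  assumes "det C \<noteq> 0"
  shows "bij_betw (\<lambda>v :: 'm \<times> 'n \<Rightarrow> int. lat C (ivec v)) UNIV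
    {x :: real^'m^'n. \<forall>i. x $ i \<in> range (\<lambda>z :: int^'m. \<Sum>\<mu>\<in>UNIV. of_int (z $ \<mu>) *\<^sub>R C $ \<mu>)}"
  unfolding bij_betw_def
proof (intro conjI equalityI subsetI)
  show "inj (\<lambda>v :: 'm \<times> 'n \<Rightarrow> int. lat C (ivec v) :: real^'m^'n)"
  proof (rule injI)
    fix v w :: "'m \<times> 'n \<Rightarrow> int" assume eq: "lat C (ivec v) = lat C (ivec w)"
    obtain \<delta> where \<delta>: "\<delta> > 0" "\<And>x. \<delta> * (norm x)\<^sup>2 \<le> (norm (lat C x :: real^'m^'n))\<^sup>2"
      using lat_lower_bound[OF assms] by blast
    have "lat C (ivec v - ivec w) = 0" using eq by (simp add: linear_diff[OF linear_lat])
    then have "\<delta> * (norm (ivec v - ivec w))\<^sup>2 \<le> 0" using \<delta>(2)[of "ivec v - ivec w"] by simp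
    then have "ivec v = ivec w" using \<delta>(1) by (simp add: mult_le_0_iff)
    then show "v = w" by (simp add: vec_eq_iff fun_eq_iff)
  qed
next
  fix x assume "x \<in> range (\<lambda>v :: 'm \<times> 'n \<Rightarrow> int. lat C (ivec v) :: real^'m^'n)"
  then obtain v :: "'m \<times> 'n \<Rightarrow> int" where x: "x = lat C (ivec v)" by blast
  have "x $ i = (\<Sum>\<mu>\<in>UNIV. of_int ((\<chi> \<mu>. v (\<mu>, i)) $ \<mu>) *\<^sub>R C $ \<mu>)" for i
    by (simp add: x lat_def)
  then show "x \<in> {x. \<forall>i. x $ i \<in> range (\<lambda>z :: int^'m. \<Sum>\<mu>\<in>UNIV. of_int (z $ \<mu>) *\<^sub>R C $ \<mu>)}" by blast
next
  fix x :: "real^'m^'n" assume "x \<in> {x. \<forall>i. x $ i \<in> range (\<lambda>z :: int^'m. \<Sum>\<mu>\<in>UNIV. of_int (z $ \<mu>) *\<^sub>R C $ \<mu>)}"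
  then have "\<forall>i. \<exists>z :: int^'m. x $ i = (\<Sum>\<mu>\<in>UNIV. of_int (z $ \<mu>) *\<^sub>R C $ \<mu>)" by blast
  then obtain z where z: "\<And>i. x $ i = (\<Sum>\<mu>\<in>UNIV. of_int (z i $ \<mu>) *\<^sub>R C $ \<mu>)" by metis
  have "x = lat C (ivec (\<lambda>(\<mu>, i). z i $ \<mu>))" by (simp add: lat_def vec_eq_iff z)
  then show "x \<in> range (\<lambda>v :: 'm \<times> 'n \<Rightarrow> int. lat C (ivec v))" by blast
qed

lemma inner_lat_dual:
  assumes "det B \<noteq> 0"
  shows "lat B x \<bullet> (lat (dual_basis B) y :: real^'m^'n) = x \<bullet> y"
proof -
  have "lat B x $ i \<bullet> (lat (dual_basis B) y :: real^'m^'n) $ i = (\<Sum>\<mu>\<in>UNIV. x $ (\<mu>, i) * y $ (\<mu>, i))" for i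
    by (simp add: lat_def inner_sum_left inner_sum_right inner_dual_basis[OF assms] of_bool_def if_distrib mult.commute cong: if_cong)
  then have "lat B x \<bullet> (lat (dual_basis B) y :: real^'m^'n) = (\<Sum>i\<in>UNIV. \<Sum>\<mu>\<in>UNIV. x $ (\<mu>, i) * y $ (\<mu>, i))"
    by (simp add: inner_vec_def[of "lat B x"])
  also have "\<dots> = (\<Sum>\<mu>\<in>UNIV. \<Sum>i\<in>UNIV. x $ (\<mu>, i) * y $ (\<mu>, i))" by (rule sum.swap)
  finally show ?thesis by (simp add: inner_vec_def sum_UNIV_prod)
qed

lemma ivec_add: "ivec (\<lambda>i. v i + w i) = ivec v + ivec w"
  by (simp add: vec_eq_iff)

lemma ivec_mult: "ivec (\<lambda>i. z * w i) = of_int z *\<^sub>R ivec w"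
  by (simp add: vec_eq_iff)

text \<open>In the coordinates given by \<open>lat B\<close>, representatives of the tuples of
  \<open>L\<close> modulo \<open>c\<close>.\<close>

definition residues :: "nat \<Rightarrow> ('i::finite \<Rightarrow> int) set" where
  "residues c = {v. \<forall>i. v i \<in> {0..<int c}}"

lemma finite_residues: "finite (residues c :: ('i::finite \<Rightarrow> int) set)"
proof -
  have "residues c = (UNIV :: 'i set) \<rightarrow>\<^sub>E {0..<int c}" by (auto simp: residues_def PiE_def extensional_def)
  then show ?thesis by (simp add: finite_PiE)
qed

lemma sum_residues_shift:
  fixes f :: "('i::finite \<Rightarrow> int) \<Rightarrow> complex"
  assumes c: "c > 0" and per: "\<And>v w. f (\<lambda>i. v i + int c * w i) = f v"
  shows "(\<Sum>v\<in>residues c. f (\<lambda>i. v i + t i)) = (\<Sum>v\<in>residues c. f v)"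
proof -
  have red: "f (\<lambda>i. v i mod int c) = f v" for v
    using per[of "\<lambda>i. v i mod int c" "\<lambda>i. v i div int c"] by simp
  have "bij_betw (\<lambda>v i. (v i + t i) mod int c) (residues c) (residues c)"
    by (rule bij_betw_byWitness[of _ "\<lambda>v i. (v i - t i) mod int c"])
      (use c in \<open>auto simp: residues_def fun_eq_iff mod_simps\<close>)
  from sum.reindex_bij_betw[OF this, of f] show ?thesis
    by (simp add: red)
qed

lemma bij_betw_residues:
  assumes "c > 0"
  shows "bij_betw (\<lambda>(v, w) i. v i + int c * w i) (residues c \<times> UNIV) (UNIV :: ('i::finite \<Rightarrow> int) set)"
  by (rule bij_betw_byWitness[of _ "\<lambda>v. (\<lambda>i. v i mod int c, \<lambda>i. v i div int c)"])
    (use assms in \<open>auto simp: residues_def fun_eq_iff\<close>)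

lemma theta_eq:
  fixes Z :: "complex^'n^'n"
  shows "theta K Z = (\<Sum>\<^sub>\<infinity>x\<in>{x :: (real^'m)^'n. \<forall>i. x $ i \<in> K}. exp (of_real pi * \<i> * iform Z x))"
proof -
  have "trace ((\<chi> i j. of_real (x $ i \<bullet> x $ j)) ** Z) = iform Z x" for x :: "(real^'m)^'n"
    unfolding trace_def matrix_matrix_mult_def iform_def vec_lambda_beta
    by (subst sum.swap) (simp add: inner_commute mult.commute)
  then show ?thesis unfolding theta_def by simp
qed

lemma iform_add: "iform (A + A') x = iform A x + iform A' x"
  by (simp add: iform_def distrib_right sum.distrib)

lemma iform_scale: "iform (\<chi> i j. c * A $ i $ j) x = c * iform A x"
  by (simp add: iform_def sum_distrib_left mult.assoc)

lemma iform_mat: "iform (mat c) x = c * of_real (x \<bullet> x)"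
  by (simp add: iform_def mat_def inner_vec_def[of x] if_distrib if_distribR sum_distrib_left cong: if_cong)

lemma iform_scaleR: "iform A (r *\<^sub>R x) = of_real (r\<^sup>2) * iform A x"
  by (simp add: iform_def sum_distrib_left power2_eq_square mult_ac)

context lattice_divisor
begin

text \<open>The term with \<open>y \<bullet> y\<close> does not depend on \<open>v\<close>. It is
  kept inside because, by \<open>a d = 1 + b c\<close>, the numerator is the square
  \<open>a (x + d y, x + d y)\<close> up to a multiple of \<open>c\<close>, with
  \<open>x = lat B (ivec v)\<close>.\<close>

definition gsum_term :: "int \<Rightarrow> real^'m^'n \<Rightarrow> ('m \<times> 'n \<Rightarrow> int) \<Rightarrow> complex" where
  "gsum_term a y v = cis (pi * ((of_int a * (lat B (ivec v) \<bullet> lat B (ivec v)) + 2 * (lat B (ivec v) \<bullet> y) + real d * (y \<bullet> y)) / real c))"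

definition gsum :: "int \<Rightarrow> real^'m^'n \<Rightarrow> complex" where
  "gsum a y = (\<Sum>v\<in>residues c. gsum_term a y v)"

lemma lat_in_L: "lat B (ivec v) $ i \<in> L"
  using L_sum[of UNIV "\<lambda>\<mu>. B $ \<mu>"] B_in_L by (simp add: lat_def)

lemma L_tuple:
  fixes x :: "real^'m^'n"
  assumes "\<And>i. x $ i \<in> L"
  obtains v where "x = lat B (ivec v)"
  using bij_betw_imp_surj_on[OF bij_betw_lat[OF det_B, where 'n = 'n]] assms unfolding L_eq by blast

lemma inner_tuple_Ints:
  fixes x y :: "real^'m^'n"
  assumes "\<And>i. x $ i \<in> L" "\<And>i. y $ i \<in> dual"
  shows "x \<bullet> y \<in> \<int>"
  using assms by (subst inner_vec_def, intro Ints_sum) (auto simp: dual_def inner_commute)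

lemma norm_tuple_even:
  fixes x :: "real^'m^'n"
  assumes "\<And>i. x $ i \<in> L"
  obtains z :: int where "x \<bullet> x = 2 * of_int z"
proof -
  have "\<forall>i. \<exists>z::int. x $ i \<bullet> x $ i = 2 * of_int z" using assms L_norm by metis
  then obtain z :: "'n \<Rightarrow> int" where "\<And>i. x $ i \<bullet> x $ i = 2 * of_int (z i)" by metis
  then have "x \<bullet> x = 2 * of_int (\<Sum>i\<in>UNIV. z i)" by (simp add: inner_vec_def[of x] sum_distrib_left)
  then show ?thesis by (rule that)
qed

text \<open>The number \<open>d (y, y)\<close> is an integer. Times \<open>c\<close> it is even by
  the level condition, times \<open>d\<close> it is the norm of \<open>d y\<close> in
  \<open>L\<close> and again even; one of \<open>c\<close> and \<open>d\<close> is odd.\<close>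

lemma pdual_norm_even:
  assumes "y \<in> pdual"
  shows "\<exists>z::int. real d * (y \<bullet> y) = 2 * of_int z"
proof -
  have yd: "y \<in> dual" and dy: "real d *\<^sub>R y \<in> L" using assms by (auto simp: pdual_def)
  have "y \<bullet> (real d *\<^sub>R y) \<in> \<int>" using yd dy by (auto simp: dual_def)
  then obtain s :: int where s: "real d * (y \<bullet> y) = of_int s" by (auto elim: Ints_cases)
  obtain w1 :: int where "real (d * c) * (y \<bullet> y) = 2 * of_int w1"
    using level_dual_norm[OF yd] by (auto simp: level_dc)
  then have "(of_int (int c * s) :: real) = of_int (2 * w1)" by (simp add: s[symmetric] mult_ac)
  then have e1: "even (int c * s)" by (simp only: of_int_eq_iff) simp
  obtain w2 :: int where "(real d *\<^sub>R y) \<bullet> (real d *\<^sub>R y) = 2 * of_int w2" using L_norm[OF dy] by blast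
  then have "(of_int (int d * s) :: real) = of_int (2 * w2)" by (simp add: s[symmetric] mult_ac)
  then have e2: "even (int d * s)" by (simp only: of_int_eq_iff) simp
  have "\<not> (even d \<and> even c)" using cop by (auto dest: coprime_common_divisor[of d c 2])
  then have "even s" using e1 e2 by auto
  then show ?thesis using s by (auto elim!: evenE)
qed

text \<open>The pairings with the dual basis are the coordinates of \<open>x\<close> in
  \<open>B\<close>.\<close>

lemma bidual:
  assumes "\<And>v. v \<in> dual \<Longrightarrow> x \<bullet> v \<in> \<int>"
  shows "x \<in> L"
proof -
  have "dual_basis B $ \<mu> \<in> dual" for \<mu>
    by (rule dualI) (simp add: inner_commute[of _ "B $ _"] inner_dual_basis[OF det_B])
  then have "x \<bullet> dual_basis B $ \<mu> \<in> \<int>" for \<mu> by (rule assms)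
  then have "\<forall>\<mu>. \<exists>z::int. x \<bullet> dual_basis B $ \<mu> = of_int z" by (auto elim!: Ints_cases)
  then obtain z where z: "\<And>\<mu>. x \<bullet> dual_basis B $ \<mu> = of_int (z \<mu>)" by metis
  have "x = (\<Sum>i\<in>UNIV. (x v* matrix_inv B) $ i *\<^sub>R B $ i)"
    using vec_combination_solve[OF det_B, of x] by (simp add: scalar_mult_eq_scaleR)
  moreover have "(x v* matrix_inv B) $ i = x \<bullet> dual_basis B $ i" for i
    by (simp add: vector_matrix_mult_def dual_basis_def transpose_def inner_vec_def mult.commute)
  ultimately have "x = (\<Sum>i\<in>UNIV. of_int (z i) *\<^sub>R B $ i)" by (simp add: z)
  then show ?thesis using L_sum[of UNIV "\<lambda>\<mu>. B $ \<mu>" z] B_in_L by simp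
qed

lemma gsum_term_shift:
  fixes y :: "real^'m^'n"
  shows "gsum_term a y (\<lambda>i. v i + t i) = cis (pi * ((of_int a * (lat B (ivec v) \<bullet> lat B (ivec v)) + 2 * (lat B (ivec v) \<bullet> y) + real d * (y \<bullet> y)) / real c
    + (2 * of_int a * (lat B (ivec v) \<bullet> lat B (ivec t)) + of_int a * (lat B (ivec t) \<bullet> lat B (ivec t)) + 2 * (lat B (ivec t) \<bullet> y)) / real c))"
  unfolding gsum_term_def ivec_add linear_add[OF linear_lat]
  by (intro arg_cong[where f = cis] arg_cong[where f = "(*) pi"])
    (simp add: inner_add_left inner_add_right inner_commute add_divide_distrib[symmetric] algebra_simps)

text \<open>Adding \<open>c t\<close> to \<open>x\<close> changes the argument, divided by
  \<open>pi\<close>, by \<open>2 a (x, t) + a c (t, t) + 2 (t, y)\<close>, an even integer by the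
  even norms of \<open>L\<close> and since \<open>y\<close> consists of dual vectors.\<close>

lemma gsum_term_periodic:
  fixes y :: "real^'m^'n"
  assumes y: "\<And>i. y $ i \<in> dual"
  shows "gsum_term a y (\<lambda>i. v i + int c * w i) = gsum_term a y v"
proof -
  let ?x = "lat B (ivec v) :: real^'m^'n" and ?t = "lat B (ivec w) :: real^'m^'n"
  have t: "lat B (ivec (\<lambda>i. int c * w i)) = real c *\<^sub>R ?t" by (simp add: ivec_mult linear_scale[OF linear_lat])
  obtain z1 :: int where z1: "?x \<bullet> ?t = of_int z1"
    using inner_tuple_Ints[of ?x ?t] lat_in_L L_subset_dual by (meson Ints_cases subsetD)
  obtain z2 :: int where z2: "?t \<bullet> ?t = 2 * of_int z2" using norm_tuple_even[of ?t] lat_in_L by blast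
  obtain z3 :: int where z3: "?t \<bullet> y = of_int z3"
    using inner_tuple_Ints[of ?t y] lat_in_L y by (meson Ints_cases)
  have "(2 * of_int a * (?x \<bullet> (real c *\<^sub>R ?t)) + of_int a * ((real c *\<^sub>R ?t) \<bullet> (real c *\<^sub>R ?t)) + 2 * ((real c *\<^sub>R ?t) \<bullet> y)) / real c
    = 2 * of_int (a * z1 + a * int c * z2 + z3)"
    using dc_pos by (simp add: z1 z2 z3 field_simps)
  then show ?thesis unfolding gsum_term_shift t by (simp only: cis_pi_add_even) (simp add: gsum_term_def)
qed

lemma gsum_shift:
  fixes y :: "real^'m^'n"
  assumes y: "\<And>i. y $ i \<in> dual"
  shows "(\<Sum>v\<in>residues c. gsum_term a y (\<lambda>i. v i + t i)) = gsum a y"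
  unfolding gsum_def by (rule sum_residues_shift[OF dc_pos(2)]) (rule gsum_term_periodic[OF y])

lemma gsum_pdual:
  fixes y :: "real^'m^'n"
  assumes abcd: "a * int d - b * int c = 1" and y: "\<And>i. y $ i \<in> pdual"
  shows "gsum a y = gsum a (0 :: real^'m^'n)"
proof -
  have "\<And>i. (real d *\<^sub>R y) $ i \<in> L" using y by (simp add: pdual_def)
  from L_tuple[OF this] obtain t where t: "real d *\<^sub>R y = lat B (ivec t)" by blast
  have "\<forall>i. \<exists>z::int. real d * (y $ i \<bullet> y $ i) = 2 * of_int z" using pdual_norm_even y by blast
  then obtain z where "\<And>i. real d * (y $ i \<bullet> y $ i) = 2 * of_int (z i)" by metis
  then have yy: "real d * (y \<bullet> y) = 2 * of_int (\<Sum>i\<in>UNIV. z i)" by (simp add: inner_vec_def[of y] sum_distrib_left)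
  have yd: "\<And>i. y $ i \<in> dual" using y by (simp add: pdual_def)
  have abcd': "of_int a * real d = 1 + of_int b * real c"
  proof -
    have "(of_int (a * int d) :: real) = of_int (1 + b * int c)" using abcd by (intro arg_cong[where f = of_int]) linarith
    then show ?thesis by simp
  qed
  have "gsum_term a 0 (\<lambda>i. v i + t i) = gsum_term a y v" for v
  proof -
    let ?x = "lat B (ivec v) :: real^'m^'n"
    obtain z1 :: int where z1: "?x \<bullet> y = of_int z1"
      using inner_tuple_Ints[of ?x y] lat_in_L yd by (meson Ints_cases)
    have "of_int a * (?x \<bullet> ?x) / real c + (2 * of_int a * (?x \<bullet> (real d *\<^sub>R y)) + of_int a * ((real d *\<^sub>R y) \<bullet> (real d *\<^sub>R y))) / real c
      = of_int a * (?x \<bullet> ?x) / real c + (2 * (of_int a * real d) * (?x \<bullet> y) + (of_int a * real d) * (real d * (y \<bullet> y))) / real c"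
      by (simp add: mult_ac)
    \<comment> \<open>In \<open>a d = 1 + b c\<close> the summand 1 rebuilds the term for
      \<open>y\<close>, while \<open>b c\<close> cancels the denominator; what it leaves is even by
      \<open>yy\<close> and integrality of \<open>?x \<bullet> y\<close>.\<close>
    also have "\<dots> = (of_int a * (?x \<bullet> ?x) + 2 * (?x \<bullet> y) + real d * (y \<bullet> y)) / real c + (2 * of_int b * (?x \<bullet> y) + of_int b * (real d * (y \<bullet> y)))"
      unfolding abcd' using dc_pos by (simp add: field_simps)
    also have "2 * of_int b * (?x \<bullet> y) + of_int b * (real d * (y \<bullet> y)) = 2 * of_int (b * z1 + b * (\<Sum>i\<in>UNIV. z i))"
      unfolding yy z1 by (simp add: algebra_simps)
    finally show ?thesis
      unfolding gsum_term_shift t[symmetric] gsum_term_def by (simp only: inner_zero_right mult_zero_right add_0_right cis_pi_add_even)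
  qed
  then have "gsum a y = (\<Sum>v\<in>residues c. gsum_term a 0 (\<lambda>i. v i + t i))" by (simp add: gsum_def)
  also have "\<dots> = gsum a (0 :: real^'m^'n)" by (rule gsum_shift[where t = t]) (simp add: dual_0)
  finally show ?thesis .
qed

lemma gsum_not_pdual:
  fixes y :: "real^'m^'n"
  assumes y: "\<And>i. y $ i \<in> dual" and i0: "y $ i0 \<notin> pdual"
  shows "gsum a y = 0"
proof -
  have "real d *\<^sub>R y $ i0 \<notin> L" using i0 y by (simp add: pdual_def)
  then obtain v where v: "v \<in> dual" "(real d *\<^sub>R y $ i0) \<bullet> v \<notin> \<int>" using bidual by blast
  \<comment> \<open>Moving \<open>d\<close> from \<open>y\<close> to \<open>v\<close> gives a vector
    for which \<open>c u\<close> is the level times \<open>v\<close>, hence in \<open>L\<close>,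
    while its pairing with \<open>y $ i0\<close> is not integral.\<close>
  define u where "u = real d *\<^sub>R v"
  have cu: "real c *\<^sub>R u \<in> L" using level_dual_in_L[OF v(1)] by (simp add: u_def level_dc mult.commute)
  have ud: "u \<in> dual" using dual_scale[OF v(1), of "int d"] by (simp add: u_def)
  have uy: "u \<bullet> y $ i0 \<notin> \<int>" using v(2) by (simp add: u_def inner_commute)
  \<comment> \<open>The quadratic part of the shift is \<open>a c (u, u)\<close>, that is
    \<open>a d\<close> times the level times \<open>(v, v)\<close>, so it is even and only the
    nontrivial root of unity remains.\<close>
  obtain w :: int where "real (d * c) * (v \<bullet> v) = 2 * of_int w" using level_dual_norm[OF v(1)] by (auto simp: level_dc)
  then have cuu: "real c * (u \<bullet> u) = 2 * of_int (int d * w)" by (simp add: u_def mult_ac)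
  have "(axis i0 (real c *\<^sub>R u) :: real^'m^'n) $ i \<in> L" for i using cu L_0 by (simp add: axis_def)
  from L_tuple[OF this] obtain t where t: "(axis i0 (real c *\<^sub>R u) :: real^'m^'n) = lat B (ivec t)" by blast
  have ia: "x \<bullet> (axis i0 z :: real^'m^'n) = x $ i0 \<bullet> z" "(axis i0 z :: real^'m^'n) \<bullet> x = z \<bullet> x $ i0" for x z
    by (simp_all add: inner_axis inner_axis')
  have "gsum_term a y (\<lambda>i. v' i + t i) = gsum_term a y v' * cis (2 * pi * (u \<bullet> y $ i0))" for v'
  proof -
    let ?x = "lat B (ivec v') :: real^'m^'n"
    obtain z1 :: int where z1: "?x $ i0 \<bullet> u = of_int z1"
      using ud lat_in_L[of v' i0] by (metis (no_types, lifting) Ints_cases dual_def inner_commute mem_Collect_eq)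
    have "(2 * of_int a * (?x \<bullet> axis i0 (real c *\<^sub>R u)) + of_int a * (axis i0 (real c *\<^sub>R u) \<bullet> (axis i0 (real c *\<^sub>R u) :: real^'m^'n)) + 2 * (axis i0 (real c *\<^sub>R u) \<bullet> y)) / real c
      = 2 * of_int a * (?x $ i0 \<bullet> u) + of_int a * (real c * (u \<bullet> u)) + 2 * (u \<bullet> y $ i0)"
      unfolding ia using dc_pos by (simp add: axis_def field_simps)
    also have "\<dots> = 2 * (u \<bullet> y $ i0) + 2 * of_int (a * z1 + a * int d * w)"
      unfolding z1 cuu by (simp add: algebra_simps)
    finally have "gsum_term a y (\<lambda>i. v' i + t i) = cis (pi * (((of_int a * (?x \<bullet> ?x) + 2 * (?x \<bullet> y) + real d * (y \<bullet> y)) / real c + 2 * (u \<bullet> y $ i0)) + 2 * of_int (a * z1 + a * int d * w)))"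
      unfolding gsum_term_shift t[symmetric] by (simp only: add.assoc)
    also have "\<dots> = gsum_term a y v' * cis (2 * pi * (u \<bullet> y $ i0))"
      unfolding cis_pi_add_even gsum_term_def cis_mult by (simp add: algebra_simps)
    finally show ?thesis .
  qed
  then have "gsum a y * cis (2 * pi * (u \<bullet> y $ i0)) = gsum a y"
    using gsum_shift[OF y, of a t] by (simp add: gsum_def sum_distrib_right)
  moreover have "cis (2 * pi * (u \<bullet> y $ i0)) \<noteq> 1"
  proof
    assume "cis (2 * pi * (u \<bullet> y $ i0)) = 1"
    then have "cos (2 * pi * (u \<bullet> y $ i0)) = 1" by (simp add: complex_eq_iff)
    then obtain n :: int where "2 * pi * (u \<bullet> y $ i0) = of_int n * 2 * pi" by (auto simp: cos_one_2pi_int)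
    then have "u \<bullet> y $ i0 = of_int n" by simp
    then show False using uy by simp
  qed
  ultimately show ?thesis by (simp add: mult_cancel_left2)
qed

end

section \<open>Assembling the transformation formula\<close>

lemma sum_infsum_swap:
  fixes f :: "'a \<Rightarrow> 'b \<Rightarrow> complex"
  assumes "finite A" "\<And>v. f v summable_on X"
  shows "(\<Sum>v\<in>A. \<Sum>\<^sub>\<infinity>w\<in>X. f v w) = (\<Sum>\<^sub>\<infinity>w\<in>X. \<Sum>v\<in>A. f v w)"
proof -
  have "((\<lambda>w. \<Sum>v\<in>A. f v w) has_sum (\<Sum>v\<in>A. \<Sum>\<^sub>\<infinity>w\<in>X. f v w)) X"
    using assms(1)
  proof (induction A rule: finite_induct)
    case (insert a A)
    then show ?case using has_sum_add[OF has_sum_infsum[OF assms(2)[of a]] insert.IH] by simp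
  qed simp
  then show ?thesis by (rule infsumI[symmetric])
qed

lemma matrix_mult_add_rdistrib:
  fixes A B C :: "complex^'n^'n"
  shows "(A + B) ** C = A ** C + B ** C"
  by (simp add: matrix_matrix_mult_def vec_eq_iff distrib_right sum.distrib)

context lattice_divisor
begin

lemma theta_transformation:
  fixes Z :: "complex^'n^'n" and a b :: int
  assumes m: "CARD('m) = 2 * k" and abcd: "a * int d - b * int c = 1" and Z: "Z \<in> siegel_upper_half_space"
  shows "slash k (diag_embed a b (int c) (int d)) (theta L) Z =
    of_real (1 / sqrt \<bar>det (kron (gram B) (mat 1 :: real^'n^'n))\<bar>) * ((- \<i> / of_nat c) ^ CARD('n)) ^ k * gsum a (0 :: real^'m^'n) * theta pdual Z"
proof -
  define W where "W = (\<chi> i j. of_nat c * Z $ i $ j) + mat (of_nat d :: complex)"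
  \<comment> \<open>This is \<open>- \<i>\<close> times \<open>Z + d / c\<close>; the translation is
    real, so the real part is \<open>Im Z\<close>.\<close>
  define \<Omega> where "\<Omega> = (\<chi> i j. (- \<i> / of_nat c) * W $ i $ j)"
  define \<Omega>i where "\<Omega>i = matrix_inv \<Omega>"
  have c0: "(of_nat c :: complex) \<noteq> 0" using dc_pos by simp
  have Zsym: "Z $ i $ j = Z $ j $ i" for i j
    using Z unfolding siegel_upper_half_space_def transpose_def by (auto simp: vec_eq_iff)
  have \<Omega>_nth: "\<Omega> $ i $ j = - \<i> * Z $ i $ j + (if i = j then - \<i> * of_nat d / of_nat c else 0)" for i j
    using c0 by (simp add: \<Omega>_def W_def mat_def field_simps)
  have sym: "transpose \<Omega> = \<Omega>"
    by (simp add: transpose_def vec_eq_iff \<Omega>_nth Zsym[of _ _] eq_commute)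
  have "map_matrix Re \<Omega> = map_matrix Im Z"
    by (simp add: map_matrix_def vec_eq_iff \<Omega>_nth)
  then have pos: "qform (map_matrix Re \<Omega>) v > 0" if "v \<noteq> 0" for v
    using Z that by (simp add: siegel_upper_half_space_def qform_def)
  have det\<Omega>: "det \<Omega> \<noteq> 0" by (rule det_nonzero_if_Re_pos[OF sym pos])
  have \<Omega>\<Omega>i: "\<Omega> ** \<Omega>i = mat 1" using det\<Omega> by (simp add: \<Omega>i_def matrix_inv_right invertible_det_nz)
  have det\<Omega>_eq: "det \<Omega> = (- \<i> / of_nat c) ^ CARD('n) * det W"
  proof -
    have "\<Omega> = (\<chi> i. (- \<i> / of_nat c) *s W $ i)" by (simp add: \<Omega>_def vec_eq_iff)
    then show ?thesis using det_rows_mul[of "\<lambda>_. - \<i> / of_nat c" "\<lambda>i. W $ i"] by simp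
  qed
  then have detW: "det W \<noteq> 0" using det\<Omega> by auto
  have Winv: "matrix_inv W = (\<chi> i j. (- \<i> / of_nat c) * \<Omega>i $ i $ j)"
  proof (rule matrix_inv_eqI)
    have "W ** (\<chi> i j. (- \<i> / of_nat c) * \<Omega>i $ i $ j) = \<Omega> ** \<Omega>i"
      by (simp add: matrix_matrix_mult_def \<Omega>_def vec_eq_iff mult_ac)
    then show "W ** (\<chi> i j. (- \<i> / of_nat c) * \<Omega>i $ i $ j) = mat 1" using \<Omega>\<Omega>i by simp
  qed
  have mat_mult: "mat x ** A = (\<chi> i j. x * A $ i $ j)" for x and A :: "complex^'n^'n"
    by (simp add: matrix_matrix_mult_def mat_def vec_eq_iff if_distrib if_distribR cong: if_cong)
  have MZ: "((\<chi> i j. of_int a * Z $ i $ j) + mat (of_int b)) ** matrix_inv W =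
      mat (of_int a / of_nat c) + (\<chi> i j. (\<i> / (of_nat c)\<^sup>2) * \<Omega>i $ i $ j)"
  proof -
    have ab: "of_int a * of_nat d = (1 + of_int b * of_nat c :: complex)"
    proof -
      have "(of_int (a * int d) :: complex) = of_int (1 + b * int c)" using abcd by (intro arg_cong[where f = of_int]) linarith
      then show ?thesis by simp
    qed
    have bc: "of_int b = (of_int a * of_nat d - 1) / (of_nat c :: complex)" using ab c0 by (simp add: field_simps)
    \<comment> \<open>Division of \<open>a Z + b\<close> by \<open>W = c Z + d\<close>: the quotient
      is \<open>a / c\<close>, and the determinant condition makes the remainder
      \<open>- 1 / c\<close>.\<close>
    have "(\<chi> i j. of_int a * Z $ i $ j) + mat (of_int b) = (mat (of_int a / of_nat c) ** W + mat (- 1 / of_nat c) :: complex^'n^'n)"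
      unfolding mat_mult unfolding bc using c0 by (simp add: W_def mat_def vec_eq_iff field_simps)
    then have "((\<chi> i j. of_int a * Z $ i $ j) + mat (of_int b)) ** matrix_inv W =
       mat (of_int a / of_nat c) ** (W ** matrix_inv W) + mat (- 1 / of_nat c) ** matrix_inv W"
      by (simp only: matrix_mult_add_rdistrib matrix_mul_assoc)
    also have "W ** matrix_inv W = mat 1" using detW by (simp add: matrix_inv_right invertible_det_nz)
    finally show ?thesis
      unfolding mat_mult[of "- 1 / of_nat c"] by (simp add: Winv power2_eq_square)
  qed
  define S where "S = mat (of_int a / of_nat c) + (\<chi> i j. (\<i> / (of_nat c)\<^sup>2) * \<Omega>i $ i $ j)"
  have slash: "slash k (diag_embed a b (int c) (int d)) (theta L) Z = det W powi (- int k) * theta L S"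
  proof -
    have e: "(\<chi> r s. of_int (diag_embed a b (int c) (int d) $ Inl r $ Inl s)) = (mat (of_int a) :: complex^'n^'n)"
      "(\<chi> r s. of_int (diag_embed a b (int c) (int d) $ Inl r $ Inr s)) = (mat (of_int b) :: complex^'n^'n)"
      "(\<chi> r s. of_int (diag_embed a b (int c) (int d) $ Inr r $ Inl s)) = (mat (of_nat c) :: complex^'n^'n)"
      "(\<chi> r s. of_int (diag_embed a b (int c) (int d) $ Inr r $ Inr s)) = (mat (of_nat d) :: complex^'n^'n)"
      by (simp_all add: diag_embed_def block_matrix_def mat_def vec_eq_iff)
    show ?thesis unfolding slash_def e Let_def mat_mult W_def[symmetric] MZ S_def ..
  qed
  define q where "q = complex_of_real (1 / sqrt \<bar>det (kron (gram B) (mat 1 :: real^'n^'n))\<bar>)"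
  let ?x = "\<lambda>v. lat B (ivec v) :: real^'m^'n" and ?y = "\<lambda>w. lat (dual_basis B) (ivec w) :: real^'m^'n"
  let ?e = "\<lambda>v w. cis (2 * pi * (ivec w \<bullet> ((1 / real c) *\<^sub>R ivec v)))"
    and ?E = "\<lambda>w. exp (- (of_real pi * iform \<Omega> (?y w)))" and ?T = "\<lambda>w. exp (of_real pi * \<i> * iform Z (?y w))"
  define f where "f v = exp (of_real pi * \<i> * iform S (?x v))" for v
  define ph where "ph v = cis (pi * (of_int a * (?x v \<bullet> ?x v) / real c))" for v
  have iformS: "iform S x = of_real (of_int a * (x \<bullet> x) / real c) + \<i> * iform \<Omega>i ((1 / real c) *\<^sub>R x)" for x :: "real^'m^'n"
    unfolding S_def iform_add iform_mat iform_scale iform_scaleR by (simp add: power_one_over)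
  have f_eq: "f v = ph v * exp (- (of_real pi * iform \<Omega>i ((1 / real c) *\<^sub>R ?x v)))" for v
    unfolding f_def ph_def iformS cis_conv_exp exp_add[symmetric] by (simp add: algebra_simps)
  have shift: "f (\<lambda>i. v i + int c * w i) = ph v * exp (- (of_real pi * iform \<Omega>i (lat B (ivec w + (1 / real c) *\<^sub>R ivec v))))" for v w
  proof -
    \<comment> \<open>The phase depends only on the residue class because it is the Gauss sum term
      at \<open>y = 0\<close>.\<close>
    have "gsum_term a (0 :: real^'m^'n) v = ph v" for v by (simp add: gsum_term_def ph_def)
    then have "ph (\<lambda>i. v i + int c * w i) = ph v"
      using gsum_term_periodic[of "0 :: real^'m^'n" a v w] by (simp add: dual_0)
    moreover have "(1 / real c) *\<^sub>R ?x (\<lambda>i. v i + int c * w i) = lat B (ivec w + (1 / real c) *\<^sub>R ivec v)"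
      using dc_pos by (simp add: ivec_add ivec_mult linear_add[OF linear_lat] linear_scale[OF linear_lat] scaleR_add_right add.commute)
    ultimately show ?thesis by (simp add: f_eq)
  qed
  obtain \<epsilon> where \<epsilon>: "\<epsilon> > 0" "\<And>v. \<epsilon> * (norm v)\<^sup>2 \<le> qform (map_matrix Re \<Omega>) v"
    using qform_lower_bound[of UNIV "map_matrix Re \<Omega>"] pos by auto
  define C where "C = 1 + (\<Sum>i\<in>UNIV. \<Sum>j\<in>UNIV. cmod (\<Omega> $ i $ j))"
  have C: "C > 0" "(\<Sum>i\<in>UNIV. \<Sum>j\<in>UNIV. cmod (\<Omega> $ i $ j)) \<le> C"
    unfolding C_def by (intro add_pos_nonneg sum_nonneg) auto
  have low: "\<epsilon> / C\<^sup>2 * (norm x)\<^sup>2 \<le> Re (iform \<Omega>i x)" for x :: "real^'m^'n"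
    unfolding \<Omega>i_def by (intro Re_iform_lower_bound Re_matrix_inv_lower_bound sym \<epsilon> C)
  have fsum: "f summable_on UNIV"
  proof (rule abs_summable_summable, rule summable_on_comparison_test)
    have "\<epsilon> / C\<^sup>2 * (1 / real c)\<^sup>2 > 0" using \<epsilon> C dc_pos by simp
    from summable_on_gauss_lat[OF det_B this, of "0 :: real^('m \<times> 'n)"]
    show "(\<lambda>v :: 'm \<times> 'n \<Rightarrow> int. exp (- (pi * (\<epsilon> / C\<^sup>2 * (1 / real c)\<^sup>2) * (norm (?x v))\<^sup>2))) summable_on UNIV" by simp
    fix v :: "'m \<times> 'n \<Rightarrow> int"
    have "pi * (\<epsilon> / C\<^sup>2 * (norm ((1 / real c) *\<^sub>R ?x v))\<^sup>2) \<le> pi * Re (iform \<Omega>i ((1 / real c) *\<^sub>R ?x v))"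
      by (intro mult_left_mono low) simp
    then show "cmod (f v) \<le> exp (- (pi * (\<epsilon> / C\<^sup>2 * (1 / real c)\<^sup>2) * (norm (?x v))\<^sup>2))"
      by (simp add: f_eq ph_def norm_mult norm_exp_eq_Re power_mult_distrib power_divide mult_ac)
  qed simp
  have L_set: "bij_betw ?x UNIV {x :: real^'m^'n. \<forall>i. x $ i \<in> L}"
    using bij_betw_lat[OF det_B, where 'n = 'n] unfolding L_eq[symmetric] .
  have dual_set: "bij_betw ?y UNIV {x :: real^'m^'n. \<forall>i. x $ i \<in> dual}"
    using bij_betw_lat[OF det_dual_basis[OF det_B], where 'n = 'n] unfolding dual_eq[symmetric] .
  have "theta L S = (\<Sum>\<^sub>\<infinity>v. f v)"
    unfolding theta_eq f_def by (rule infsum_reindex_bij_betw[OF L_set, symmetric])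
  also have "\<dots> = (\<Sum>\<^sub>\<infinity>(v, w)\<in>residues c \<times> UNIV. f (\<lambda>i. v i + int c * w i))"
    unfolding infsum_reindex_bij_betw[OF bij_betw_residues[OF dc_pos(2)], symmetric] by (simp add: case_prod_unfold)
  also have "\<dots> = (\<Sum>v\<in>residues c. \<Sum>\<^sub>\<infinity>w. f (\<lambda>i. v i + int c * w i))"
  proof -
    have "(\<lambda>(v, w). f (\<lambda>i. v i + int c * w i)) summable_on residues c \<times> UNIV"
      using fsum unfolding summable_on_reindex_bij_betw[OF bij_betw_residues[OF dc_pos(2)], symmetric] by (simp add: case_prod_unfold)
    from infsum_Sigma'_banach[OF this, symmetric] show ?thesis by (simp add: finite_residues)
  qed
  \<comment> \<open>Divided by \<open>c\<close>, a residue class is the full lattice shifted by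
    \<open>v / c\<close>, so Poisson summation applies with this shift.\<close>
  also have "\<dots> = (\<Sum>v\<in>residues c. ph v * (q * det \<Omega> ^ k *
     (\<Sum>\<^sub>\<infinity>w. ?E w * ?e v w)))"
    unfolding shift infsum_cmult_right' \<Omega>i_def q_def
    by (intro sum.cong refl arg_cong2[where f = "(*)"] poisson_theta m det_B sym pos)
  also have "\<dots> = q * det \<Omega> ^ k * (\<Sum>v\<in>residues c. \<Sum>\<^sub>\<infinity>w. ph v * (?E w * ?e v w))"
    unfolding infsum_cmult_right' sum_distrib_left by (simp add: mult_ac)
  also have "(\<Sum>v\<in>residues c. \<Sum>\<^sub>\<infinity>w. ph v * (?E w * ?e v w))
     = (\<Sum>\<^sub>\<infinity>w. \<Sum>v\<in>residues c. ph v * (?E w * ?e v w))"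
  proof (rule sum_infsum_swap[OF finite_residues])
    fix v :: "'m \<times> 'n \<Rightarrow> int"
    show "(\<lambda>w. ph v * (?E w * ?e v w)) summable_on UNIV"
    proof (rule abs_summable_summable, rule summable_on_comparison_test)
      from summable_on_gauss_lat[OF det_dual_basis[OF det_B] \<epsilon>(1), of "0 :: real^('m \<times> 'n)"]
      show "(\<lambda>w :: 'm \<times> 'n \<Rightarrow> int. exp (- (pi * \<epsilon> * (norm (?y w))\<^sup>2))) summable_on UNIV" by simp
      fix w :: "'m \<times> 'n \<Rightarrow> int"
      have "pi * (\<epsilon> * (norm (?y w))\<^sup>2) \<le> pi * Re (iform \<Omega> (?y w))"
        by (intro mult_left_mono Re_iform_lower_bound \<epsilon>) simp
      then show "cmod (ph v * (?E w * ?e v w)) \<le> exp (- (pi * \<epsilon> * (norm (?y w))\<^sup>2))"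
        by (simp add: ph_def norm_mult norm_exp_eq_Re mult.assoc)
    qed simp
  qed
  also have "\<dots> = (\<Sum>\<^sub>\<infinity>w. ?T w * gsum a (?y w))"
  proof (rule infsum_cong)
    fix w :: "'m \<times> 'n \<Rightarrow> int"
    \<comment> \<open>The translation by \<open>d / c\<close> contributes the part of
      \<open>gsum_term\<close> with \<open>y \<bullet> y\<close>; the part with \<open>a\<close> is
      \<open>ph\<close>, and the mixed one is the character from Poisson summation.\<close>
    have "\<Omega> = (\<chi> i j. - \<i> * Z $ i $ j) + mat (- \<i> * of_nat d / of_nat c)"
      by (simp add: vec_eq_iff \<Omega>_nth mat_def)
    then have I: "iform \<Omega> (?y w) = - \<i> * iform Z (?y w) + (- \<i> * of_nat d / of_nat c) * of_real (?y w \<bullet> ?y w)"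
      by (simp only: iform_add iform_scale iform_mat)
    have 1: "?E w = ?T w * cis (pi * (real d * (?y w \<bullet> ?y w) / real c))"
      unfolding I cis_conv_exp exp_add[symmetric] by (simp add: algebra_simps)
    have "ph v * (cis (pi * (real d * (?y w \<bullet> ?y w) / real c)) * ?e v w) = gsum_term a (?y w) v" for v
    proof -
      have x: "ivec w \<bullet> ((1 / real c) *\<^sub>R ivec v) = (?x v \<bullet> ?y w) / real c"
        by (simp add: inner_lat_dual[OF det_B] inner_commute)
      then show ?thesis
        unfolding x ph_def gsum_term_def cis_mult by (simp add: add_divide_distrib algebra_simps)
    qed
    then show "(\<Sum>v\<in>residues c. ph v * (?E w * ?e v w))
      = ?T w * gsum a (?y w)"
      unfolding 1 gsum_def sum_distrib_left by (intro sum.cong refl) (simp add: mult_ac)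
  qed
  also have "\<dots> = (\<Sum>\<^sub>\<infinity>y\<in>{x :: real^'m^'n. \<forall>i. x $ i \<in> dual}. exp (of_real pi * \<i> * iform Z y) * gsum a y)"
    by (rule infsum_reindex_bij_betw[OF dual_set])
  also have "\<dots> = (\<Sum>\<^sub>\<infinity>y\<in>{x :: real^'m^'n. \<forall>i. x $ i \<in> pdual}. exp (of_real pi * \<i> * iform Z y) * gsum a (0 :: real^'m^'n))"
  \<comment> \<open>A single component outside \<open>pdual\<close> already kills a term.\<close>
  proof (rule infsum_cong_neutral)
    fix y :: "real^'m^'n"
    assume "y \<in> {x. \<forall>i. x $ i \<in> dual} \<inter> {x. \<forall>i. x $ i \<in> pdual}"
    then have "gsum a y = gsum a (0 :: real^'m^'n)" by (intro gsum_pdual[OF abcd]) auto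
    then show "exp (of_real pi * \<i> * iform Z y) * gsum a y = exp (of_real pi * \<i> * iform Z y) * gsum a (0 :: real^'m^'n)" by simp
  next
    fix y :: "real^'m^'n"
    assume "y \<in> {x. \<forall>i. x $ i \<in> dual} - {x. \<forall>i. x $ i \<in> pdual}"
    then obtain i where "\<And>j. y $ j \<in> dual" "y $ i \<notin> pdual" by auto
    then have "gsum a y = 0" by (rule gsum_not_pdual)
    then show "exp (of_real pi * \<i> * iform Z y) * gsum a y = 0" by simp
  qed (auto simp: pdual_def)
  also have "\<dots> = gsum a (0 :: real^'m^'n) * theta pdual Z"
    unfolding theta_eq infsum_cmult_left' by (simp add: mult.commute)
  finally have "theta L S = q * det \<Omega> ^ k * (gsum a (0 :: real^'m^'n) * theta pdual Z)" .
  \<comment> \<open>The \<open>k\<close>-th power of \<open>det W\<close> inside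
    \<open>det \<Omega> ^ k\<close> cancels the slash factor and leaves only constants.\<close>
  then show ?thesis
    unfolding slash det\<Omega>_eq q_def[symmetric] using detW
    by (simp add: power_mult_distrib power_int_minus)
qed

end

theorem theorem9p1:
  fixes L :: "(real^'m) set" and B :: "real^'m^'m"
    and k N d c :: nat and a b :: int
  assumes "CARD('m) = 2 * k"
    and "lattice_basis B L"
    and "even_integral L"
    and "N = lattice_level B"
    and "d dvd N"
    and "coprime d (N div d)"
    and "c = N div d"
    and "a * int d - b * int c = 1"
  shows "(\<exists>!L'. partial_dual B L d L') \<and>
    (\<forall>L'. partial_dual B L d L' \<longrightarrow>
      (\<exists>\<kappa>::complex. \<forall>Z \<in> (siegel_upper_half_space :: (complex^'n^'n) set).
         slash k (diag_embed a b (int c) (int d)) (theta L) Z = \<kappa> * theta L' Z))"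
proof -
  interpret lattice_divisor L B d c
    using assms by unfold_locales auto
  have unique: "L' = pdual" if "partial_dual B L d L'" for L'
    using partial_dual_unique[OF det_B that partial_dual_pdual] .
  show ?thesis
  proof (intro conjI allI impI)
    show "\<exists>!L'. partial_dual B L d L'" using partial_dual_pdual unique by blast
  next
    fix L' assume "partial_dual B L d L'"
    then have "L' = pdual" by (rule unique)
    then show "\<exists>\<kappa>::complex. \<forall>Z \<in> (siegel_upper_half_space :: (complex^'n^'n) set).
         slash k (diag_embed a b (int c) (int d)) (theta L) Z = \<kappa> * theta L' Z"
      using theta_transformation[OF assms(1,8)] by blast
  qed
qed

end
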